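(* Let $\Sigma$ be a finite nonempty alphabet and let $\varphi$ be a sentence of $\mathcal{L}(\mathcal{M}(\Sigma))$. Then there exists a deterministic Turing machine $\mathrm{TM}$ such that: (1) for all $w\in\Sigma^*$, $\mathrm{TM}$ halts in an accepting state on input $w$ if and only if $\mathcal{M}(w)\models^+\varphi$; (2) for all $w\in\Sigma^*$, $\mathrm{TM}$ halts in a rejecting state on input $w$ if and only if $\mathcal{M}(w)\models^-\varphi$.
   Context: Turing machines are standard deterministic single-tape machines with an input alphabet $\Sigma$ and possibly an additional disjoint finite tape alphabet; "accepting" means halting in an accepting state, "rejecting" means halting in a rejecting (non-accepting) state. Word models. For a finite nonempty alphabet $\Sigma$, $\mathcal{M}(\Sigma)$ is the vocabulary $\{\mathit{Succ}\}\cup\{P_a\mid a\in\Sigma\}$ with $\mathit{Succ}$ binary and each $P_a$ unary. For $w=a_1\cdots a_n\in\Sigma^*$, $\mathcal{M}(w)$ is the model with domain $\{0,\dots,n\}$, $\mathit{Succ}$ the successor relation $\{(i,i+1)\mid 0\le i<n\}$, and $P_a=\{i\ge1\mid a_i=a\}$. The logic $\mathcal{L}(\sigma)$ (for a relational vocabulary $\sigma$). There are first-order variables $x,y,\dots$ and, for each $k\ge1$, countably many $k$-ary relation variables $X$. Formulae of $\mathcal{L}^*(\sigma)$ are built by: atoms $R(x_1,\dots,x_k)$ ($R\in\sigma$ $k$-ary), $X(x_1,\dots,x_k)$ ($X$ a $k$-ary relation variable), $x=y$, and $k$ for each natural number $k$ (a "jump atom"); and if $\varphi,\psi$ are formulae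 then so are $\neg\varphi$, $(\varphi\wedge\psi)$, $\exists x\,\varphi$, $Ix\,\varphi$, $I_{Rx_1\dots x_k}\varphi$, $I_{Xx_1\dots x_k}\varphi$, $D_{Rx_1\dots x_k}\varphi$, $D_{Xx_1\dots x_k}\varphi$ (for $R\in\sigma$ or $X$ a relation variable, $k$-ary), and $k\varphi$ for $k\in\mathbb{N}$. Every occurrence of a subformula counts as a distinct subformula. A formula has a non-standard jump if it contains an atomic subformula (occurrence) $k$ and a subformula $k\psi$ such that this occurrence of $k$ is not a subformula of $k\psi$; $\mathcal{L}(\sigma)$ is the set of formulae of $\mathcal{L}^*(\sigma)$ without non-standard jumps. Free variables are defined as usual, where $\exists x$ and $Ix$ bind $x$, $I_{Rx_1\dots x_k}$ and $D_{Rx_1\dots x_k}$ bind $x_1,\dots,x_k$, $I_{Xx_1\dots x_k}$ and $D_{Xx_1\dots x_k}$ bind $X,x_1,\dots,x_k$, jump atoms $k$ have no free variables, $X(x_1,\dots,x_k)$ has free variables $X,x_1,\dots,x_k$, and $k\varphi$ has the free variables of $\varphi$. A sentence has no free variables. Semantics. For a $\sigma$-model $\mathfrak{A}$, an assignment $f$ (of elements to first-order variables and $k$-ary relations on the domain to $k$-ary relation variables) covering the free variables of $\varphi$, and $\#\in\{+,-\}$, the game $G(\mathfrak{A},f,\#,\varphi)$ between players $\exists$ and $\forall$ has positions $(\mathfrak{B},g,\#',\psi)$ and starts at $(\mathfrak{A},f,\#,\varphi)$. Call the "verifier" at a position $\exists$ if $\#'=+$ and $\forall$ if $\#'=-$,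 and the other player the "falsifier". Moves: from $\neg\psi$ go to $(\mathfrak{B},g,\#'',\psi)$ with $\#''$ the opposite sign; from $(\psi\wedge\psi')$ the falsifier picks one conjunct; from $\exists x\psi$ the verifier picks $b\in B$ and play goes to $(\mathfrak{B},g[x\mapsto b],\#',\psi)$; from $Ix\,\psi$ play goes to $(\mathfrak{C},g[x\mapsto b],\#',\psi)$ where $\mathfrak{C}$ is $\mathfrak{B}$ with one fresh isolated element $b$ added to the domain (all relations unchanged); from $I_{Rx_1\dots x_k}\psi$ (resp. $D_{Rx_1\dots x_k}\psi$) the verifier picks $(b_1,\dots,b_k)\in B^k$ and play goes to $(\mathfrak{B}^*,g[x_1\mapsto b_1,\dots,x_k\mapsto b_k],\#',\psi)$ where $\mathfrak{B}^*$ is $\mathfrak{B}$ with $(b_1,\dots,b_k)$ added to (resp. removed from) $R$; from $I_{Xx_1\dots x_k}\psi$ (resp. $D_{Xx_1\dots x_k}\psi$) the verifier picks $(b_1,\dots,b_k)\in B^k$ and play goes to $(\mathfrak{B},g[x_1\mapsto b_1,\dots,x_k\mapsto b_k,X\mapsto C\cup\{(b_1,\dots,b_k)\}],\#',\psi)$ (resp. $C\setminus\{(b_1,\dots,b_k)\}$), where $C=g(X)$ if $X$ is in the domain of $g$ and $C=\emptyset$ otherwise; from $k\psi$ play goes to $(\mathfrak{B},g,\#',\psi)$; at a jump atom $k$, if the original formula $\varphi$ has some subformula of the form $k\chi$, the verifier chooses such a subformula $k\chi$ of $\varphi$ and play continues from $(\mathfrak{B},g,\#',k\chi)$, otherwise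 the play ends and the falsifier wins. At atoms $R(\bar x)$, $X(\bar x)$, $x=y$ the play ends: if $\#'=+$, $\exists$ wins iff the atom holds in $(\mathfrak{B},g)$ in the usual first-order sense (else $\forall$ wins); if $\#'=-$, $\forall$ wins iff the atom holds (else $\exists$ wins). Plays last at most $\omega$ rounds; an infinite play is won by neither player. A strategy is winning for a player if every play following it ends after finitely many rounds in a win for that player. $\mathfrak{A}\models^+\varphi$ (for a sentence $\varphi$) iff $\exists$ has a winning strategy in $G(\mathfrak{A},\emptyset,+,\varphi)$, and $\mathfrak{A}\models^-\varphi$ iff $\exists$ has a winning strategy in $G(\mathfrak{A},\emptyset,-,\varphi)$, where $\emptyset$ is the empty assignment. *)

theory Defs
  imports Main "HOL-Library.Sublist"
begin

section \<open>Turing machines\<close>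

text \<open>The tape alphabet consists of the input letters, the blank, and finitely many further
  symbols. The tape is two-way infinite. A machine halts when its (partial) transition function is
  undefined; since the states have no significance beyond their number, they are natural numbers.\<close>

datatype 'a tsym = Blank | Inp 'a | Aux nat

datatype dir = MoveLeft | MoveRight | Stay

record 'a tm =
  tm_states :: "nat set"
  tm_aux :: "nat set"
  tm_start :: nat
  tm_accepting :: "nat set"
  tm_delta :: "nat \<Rightarrow> 'a tsym \<Rightarrow> (nat \<times> 'a tsym \<times> dir) option"

definition tm_alphabet :: "'a tm \<Rightarrow> 'a tsym set" where
  "tm_alphabet M = insert Blank (range Inp \<union> Aux ` tm_aux M)"

definition turing_machine :: "'a tm \<Rightarrow> bool" where
  "turing_machine M \<longleftrightarrow>
     finite (tm_states M) \<and> finite (tm_aux M) \<and>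
     tm_start M \<in> tm_states M \<and> tm_accepting M \<subseteq> tm_states M \<and>
     (\<forall>q \<in> tm_states M. \<forall>a \<in> tm_alphabet M. \<forall>q' a' d.
        tm_delta M q a = Some (q', a', d) \<longrightarrow> q' \<in> tm_states M \<and> a' \<in> tm_alphabet M)"

record 'a config =
  cf_state :: nat
  cf_tape :: "int \<Rightarrow> 'a tsym"
  cf_head :: int

fun shift :: "dir \<Rightarrow> int" where
  "shift MoveLeft = - 1"
| "shift MoveRight = 1"
| "shift Stay = 0"

definition tm_step :: "'a tm \<Rightarrow> 'a config \<Rightarrow> 'a config option" where
  "tm_step M c =
     (case tm_delta M (cf_state c) (cf_tape c (cf_head c)) of
        None \<Rightarrow> None
      | Some (q, a, d) \<Rightarrow>
          Some \<lparr>cf_state = q, cf_tape = (cf_tape c)(cf_head c := a), cf_head = cf_head c + shift d\<rparr>)"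

definition tm_initial :: "'a tm \<Rightarrow> 'a list \<Rightarrow> 'a config" where
  "tm_initial M w =
     \<lparr>cf_state = tm_start M,
      cf_tape = (\<lambda>i. if 0 \<le> i \<and> i < int (length w) then Inp (w ! nat i) else Blank),
      cf_head = 0\<rparr>"

definition tm_halts_in :: "'a tm \<Rightarrow> 'a list \<Rightarrow> nat \<Rightarrow> bool" where
  "tm_halts_in M w q \<longleftrightarrow>
     (\<exists>c. (\<lambda>c c'. tm_step M c = Some c')\<^sup>*\<^sup>* (tm_initial M w) c \<and> tm_step M c = None \<and> cf_state c = q)"

definition tm_accepts :: "'a tm \<Rightarrow> 'a list \<Rightarrow> bool" where
  "tm_accepts M w \<longleftrightarrow> (\<exists>q. q \<in> tm_accepting M \<and> tm_halts_in M w q)"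

definition tm_rejects :: "'a tm \<Rightarrow> 'a list \<Rightarrow> bool" where
  "tm_rejects M w \<longleftrightarrow> (\<exists>q. q \<notin> tm_accepting M \<and> tm_halts_in M w q)"


section \<open>Syntax\<close>

text \<open>A relational vocabulary is a type of symbols together with an arity function. First-order
  variables are natural numbers; the relation variables of arity \<open>k\<close> are \<open>RVar k 0\<close>, \<open>RVar k 1\<close>,
  \<open>\<dots>\<close>\<close>

datatype rvar = RVar (rvar_arity: nat) (rvar_index: nat)

datatype 'r fm =
    Rel 'r "nat list"
  | Var rvar "nat list"
  | Eq nat nat
  | Jump nat
  | Neg "'r fm"
  | Conj "'r fm" "'r fm"
  | Exists nat "'r fm"
  | Insert nat "'r fm"
  | InsertRel 'r "nat list" "'r fm"
  | InsertVar rvar "nat list" "'r fm"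
  | DeleteRel 'r "nat list" "'r fm"
  | DeleteVar rvar "nat list" "'r fm"
  | Label nat "'r fm"

fun in_Lstar :: "('r \<Rightarrow> nat) \<Rightarrow> 'r fm \<Rightarrow> bool" where
  "in_Lstar ar (Rel R xs) \<longleftrightarrow> length xs = ar R"
| "in_Lstar ar (Var X xs) \<longleftrightarrow> 1 \<le> rvar_arity X \<and> length xs = rvar_arity X"
| "in_Lstar ar (Eq x y) \<longleftrightarrow> True"
| "in_Lstar ar (Jump k) \<longleftrightarrow> True"
| "in_Lstar ar (Neg \<psi>) \<longleftrightarrow> in_Lstar ar \<psi>"
| "in_Lstar ar (Conj \<psi> \<chi>) \<longleftrightarrow> in_Lstar ar \<psi> \<and> in_Lstar ar \<chi>"
| "in_Lstar ar (Exists x \<psi>) \<longleftrightarrow> in_Lstar ar \<psi>"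
| "in_Lstar ar (Insert x \<psi>) \<longleftrightarrow> in_Lstar ar \<psi>"
| "in_Lstar ar (InsertRel R xs \<psi>) \<longleftrightarrow> length xs = ar R \<and> in_Lstar ar \<psi>"
| "in_Lstar ar (InsertVar X xs \<psi>) \<longleftrightarrow>
     1 \<le> rvar_arity X \<and> length xs = rvar_arity X \<and> in_Lstar ar \<psi>"
| "in_Lstar ar (DeleteRel R xs \<psi>) \<longleftrightarrow> length xs = ar R \<and> in_Lstar ar \<psi>"
| "in_Lstar ar (DeleteVar X xs \<psi>) \<longleftrightarrow>
     1 \<le> rvar_arity X \<and> length xs = rvar_arity X \<and> in_Lstar ar \<psi>"
| "in_Lstar ar (Label k \<psi>) \<longleftrightarrow> in_Lstar ar \<psi>"

fun children :: "'r fm \<Rightarrow> 'r fm list" where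
  "children (Rel R xs) = []"
| "children (Var X xs) = []"
| "children (Eq x y) = []"
| "children (Jump k) = []"
| "children (Neg \<psi>) = [\<psi>]"
| "children (Conj \<psi> \<chi>) = [\<psi>, \<chi>]"
| "children (Exists x \<psi>) = [\<psi>]"
| "children (Insert x \<psi>) = [\<psi>]"
| "children (InsertRel R xs \<psi>) = [\<psi>]"
| "children (InsertVar X xs \<psi>) = [\<psi>]"
| "children (DeleteRel R xs \<psi>) = [\<psi>]"
| "children (DeleteVar X xs \<psi>) = [\<psi>]"
| "children (Label k \<psi>) = [\<psi>]"

text \<open>An occurrence of a subformula of \<open>\<phi>\<close> is represented by the path leading to it from the root
  of the syntax tree; \<open>sub_at \<phi> p\<close> is the formula occurring there (\<open>None\<close> if there is no such path).
  Hence the occurrence \<open>p\<close> is a subformula of the occurrence \<open>q\<close> iff \<open>q\<close> is a prefix of \<open>p\<close>.\<close>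

type_synonym occ = "nat list"

fun sub_at :: "'r fm \<Rightarrow> occ \<Rightarrow> 'r fm option" where
  "sub_at \<phi> [] = Some \<phi>"
| "sub_at \<phi> (i # p) = (if i < length (children \<phi>) then sub_at (children \<phi> ! i) p else None)"

definition nonstandard_jump :: "'r fm \<Rightarrow> bool" where
  "nonstandard_jump \<phi> \<longleftrightarrow>
     (\<exists>p q k \<psi>. sub_at \<phi> p = Some (Jump k) \<and> sub_at \<phi> q = Some (Label k \<psi>) \<and> \<not> prefix q p)"

definition L :: "('r \<Rightarrow> nat) \<Rightarrow> 'r fm set" where
  "L ar = {\<phi>. in_Lstar ar \<phi> \<and> \<not> nonstandard_jump \<phi>}"

fun free_fo :: "'r fm \<Rightarrow> nat set" where
  "free_fo (Rel R xs) = set xs"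
| "free_fo (Var X xs) = set xs"
| "free_fo (Eq x y) = {x, y}"
| "free_fo (Jump k) = {}"
| "free_fo (Neg \<psi>) = free_fo \<psi>"
| "free_fo (Conj \<psi> \<chi>) = free_fo \<psi> \<union> free_fo \<chi>"
| "free_fo (Exists x \<psi>) = free_fo \<psi> - {x}"
| "free_fo (Insert x \<psi>) = free_fo \<psi> - {x}"
| "free_fo (InsertRel R xs \<psi>) = free_fo \<psi> - set xs"
| "free_fo (InsertVar X xs \<psi>) = free_fo \<psi> - set xs"
| "free_fo (DeleteRel R xs \<psi>) = free_fo \<psi> - set xs"
| "free_fo (DeleteVar X xs \<psi>) = free_fo \<psi> - set xs"
| "free_fo (Label k \<psi>) = free_fo \<psi>"

fun free_so :: "'r fm \<Rightarrow> rvar set" where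
  "free_so (Rel R xs) = {}"
| "free_so (Var X xs) = {X}"
| "free_so (Eq x y) = {}"
| "free_so (Jump k) = {}"
| "free_so (Neg \<psi>) = free_so \<psi>"
| "free_so (Conj \<psi> \<chi>) = free_so \<psi> \<union> free_so \<chi>"
| "free_so (Exists x \<psi>) = free_so \<psi>"
| "free_so (Insert x \<psi>) = free_so \<psi>"
| "free_so (InsertRel R xs \<psi>) = free_so \<psi>"
| "free_so (InsertVar X xs \<psi>) = free_so \<psi> - {X}"
| "free_so (DeleteRel R xs \<psi>) = free_so \<psi>"
| "free_so (DeleteVar X xs \<psi>) = free_so \<psi> - {X}"
| "free_so (Label k \<psi>) = free_so \<psi>"

definition sentence :: "'r fm \<Rightarrow> bool" where
  "sentence \<phi> \<longleftrightarrow> free_fo \<phi> = {} \<and> free_so \<phi> = {}"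


section \<open>Two-player games and winning strategies\<close>

text \<open>A game is given by the successors \<open>mv p\<close> of each position, the player \<open>tn p\<close> whose turn it is,
  and the winner \<open>wn p\<close> of the play if it ends at \<open>p\<close>; a play ends exactly when there are no
  successors. A strategy of player \<open>P\<close> may depend on the history of the play.\<close>

datatype player = Eloise | Abelard

inductive play_prefix ::
    "('p \<Rightarrow> 'p set) \<Rightarrow> ('p \<Rightarrow> player) \<Rightarrow> player \<Rightarrow> ('p list \<Rightarrow> 'p) \<Rightarrow> 'p \<Rightarrow> 'p list \<Rightarrow> bool"
  for mv tn P s p0 where
  start: "play_prefix mv tn P s p0 [p0]"
| step: "play_prefix mv tn P s p0 h \<Longrightarrow> q \<in> mv (last h) \<Longrightarrow> (tn (last h) = P \<Longrightarrow> q = s h)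
         \<Longrightarrow> play_prefix mv tn P s p0 (h @ [q])"

definition winning_strategy ::
    "('p \<Rightarrow> 'p set) \<Rightarrow> ('p \<Rightarrow> player) \<Rightarrow> ('p \<Rightarrow> player) \<Rightarrow> player \<Rightarrow> 'p \<Rightarrow> ('p list \<Rightarrow> 'p) \<Rightarrow> bool"
  where
  "winning_strategy mv tn wn P p0 s \<longleftrightarrow>
     (\<forall>h. play_prefix mv tn P s p0 h \<and> tn (last h) = P \<and> mv (last h) \<noteq> {} \<longrightarrow> s h \<in> mv (last h)) \<and>
     (\<forall>h. play_prefix mv tn P s p0 h \<and> mv (last h) = {} \<longrightarrow> wn (last h) = P) \<and>
     \<not> (\<exists>\<pi> :: nat \<Rightarrow> 'p. \<forall>n. play_prefix mv tn P s p0 (map \<pi> [0..<Suc n]))"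


section \<open>Semantics\<close>

text \<open>Models have a set of natural numbers as their domain, and tuples are lists. Assignments are
  partial.\<close>

record 'r model =
  dom_of :: "nat set"
  rel_of :: "'r \<Rightarrow> nat list set"

record asg =
  fo :: "nat \<rightharpoonup> nat"
  so :: "rvar \<rightharpoonup> nat list set"

definition empty_asg :: asg where
  "empty_asg = \<lparr>fo = Map.empty, so = Map.empty\<rparr>"

definition tuples :: "nat set \<Rightarrow> nat \<Rightarrow> nat list set" where
  "tuples B k = {bs. set bs \<subseteq> B \<and> length bs = k}"

text \<open>For a finite domain (and only such domains are reachable from a word model) this is an
  element outside of it. Which one is taken does not matter, up to isomorphism.\<close>

definition fresh :: "nat set \<Rightarrow> nat" where
  "fresh B = (LEAST b. b \<notin> B)"

text \<open>Value of a relation variable before it is updated.\<close>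

definition so_val :: "asg \<Rightarrow> rvar \<Rightarrow> nat list set" where
  "so_val g X = (case so g X of None \<Rightarrow> {} | Some C \<Rightarrow> C)"

text \<open>Truth of an atom; the assignment is meant to cover its variables.\<close>

fun atom_holds :: "'r model \<Rightarrow> asg \<Rightarrow> 'r fm \<Rightarrow> bool" where
  "atom_holds B g (Rel R xs) \<longleftrightarrow> (\<exists>bs. map (fo g) xs = map Some bs \<and> bs \<in> rel_of B R)"
| "atom_holds B g (Var X xs) \<longleftrightarrow>
     (\<exists>bs C. map (fo g) xs = map Some bs \<and> so g X = Some C \<and> bs \<in> C)"
| "atom_holds B g (Eq x y) \<longleftrightarrow> (\<exists>b. fo g x = Some b \<and> fo g y = Some b)"
| "atom_holds B g _ \<longleftrightarrow> False"

datatype sign = Plus | Minus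

fun opp :: "sign \<Rightarrow> sign" where
  "opp Plus = Minus"
| "opp Minus = Plus"

fun verifier :: "sign \<Rightarrow> player" where
  "verifier Plus = Eloise"
| "verifier Minus = Abelard"

fun falsifier :: "sign \<Rightarrow> player" where
  "falsifier Plus = Abelard"
| "falsifier Minus = Eloise"

type_synonym 'r position = "'r model \<times> asg \<times> sign \<times> occ"

text \<open>The fourth component of a position is an occurrence of a subformula in the original formula
  \<open>\<phi>\<close>. If a variable is repeated in \<open>x\<^sub>1, \<dots>, x\<^sub>k\<close>, its last value counts.\<close>

fun moves :: "'r fm \<Rightarrow> 'r position \<Rightarrow> 'r position set" where
  "moves \<phi> (B, g, sg, p) =
     (case sub_at \<phi> p of
        Some (Neg \<psi>) \<Rightarrow> {(B, g, opp sg, p @ [0])}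
      | Some (Conj \<psi> \<chi>) \<Rightarrow> {(B, g, sg, p @ [0]), (B, g, sg, p @ [1])}
      | Some (Exists x \<psi>) \<Rightarrow> {(B, g\<lparr>fo := (fo g)(x \<mapsto> b)\<rparr>, sg, p @ [0]) | b. b \<in> dom_of B}
      | Some (Insert x \<psi>) \<Rightarrow>
          (let b = fresh (dom_of B)
           in {(B\<lparr>dom_of := insert b (dom_of B)\<rparr>, g\<lparr>fo := (fo g)(x \<mapsto> b)\<rparr>, sg, p @ [0])})
      | Some (InsertRel R xs \<psi>) \<Rightarrow>
          {(B\<lparr>rel_of := (rel_of B)(R := insert bs (rel_of B R))\<rparr>,
            g\<lparr>fo := (fo g)(xs [\<mapsto>] bs)\<rparr>, sg, p @ [0]) | bs. bs \<in> tuples (dom_of B) (length xs)}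
      | Some (DeleteRel R xs \<psi>) \<Rightarrow>
          {(B\<lparr>rel_of := (rel_of B)(R := rel_of B R - {bs})\<rparr>,
            g\<lparr>fo := (fo g)(xs [\<mapsto>] bs)\<rparr>, sg, p @ [0]) | bs. bs \<in> tuples (dom_of B) (length xs)}
      | Some (InsertVar X xs \<psi>) \<Rightarrow>
          {(B, \<lparr>fo = (fo g)(xs [\<mapsto>] bs), so = (so g)(X \<mapsto> insert bs (so_val g X))\<rparr>,
            sg, p @ [0]) | bs. bs \<in> tuples (dom_of B) (length xs)}
      | Some (DeleteVar X xs \<psi>) \<Rightarrow>
          {(B, \<lparr>fo = (fo g)(xs [\<mapsto>] bs), so = (so g)(X \<mapsto> so_val g X - {bs})\<rparr>,
            sg, p @ [0]) | bs. bs \<in> tuples (dom_of B) (length xs)}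
      | Some (Label k \<psi>) \<Rightarrow> {(B, g, sg, p @ [0])}
      | Some (Jump k) \<Rightarrow> {(B, g, sg, q) | q \<psi>. sub_at \<phi> q = Some (Label k \<psi>)}
      | _ \<Rightarrow> {})"

text \<open>At negations, labels and \<open>Insert\<close> the successor is unique, so it is immaterial whose turn it
  is there.\<close>

fun turn :: "'r fm \<Rightarrow> 'r position \<Rightarrow> player" where
  "turn \<phi> (B, g, sg, p) =
     (case sub_at \<phi> p of Some (Conj \<psi> \<chi>) \<Rightarrow> falsifier sg | _ \<Rightarrow> verifier sg)"

text \<open>Only relevant where there are no moves. On nonempty domains these positions are the
  first-order atoms and the jump atoms without a target; the latter count as false.\<close>

fun winner :: "'r fm \<Rightarrow> 'r position \<Rightarrow> player" where
  "winner \<phi> (B, g, sg, p) =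
     (case sub_at \<phi> p of
        Some \<psi> \<Rightarrow> (if atom_holds B g \<psi> then verifier sg else falsifier sg)
      | None \<Rightarrow> falsifier sg)"

definition satisfies :: "'r model \<Rightarrow> sign \<Rightarrow> 'r fm \<Rightarrow> bool" where
  "satisfies A sg \<phi> \<longleftrightarrow>
     (\<exists>s. winning_strategy (moves \<phi>) (turn \<phi>) (winner \<phi>) Eloise (A, empty_asg, sg, []) s)"

abbreviation models_pos :: "'r model \<Rightarrow> 'r fm \<Rightarrow> bool" (infix "\<Turnstile>\<^sup>+" 50) where
  "A \<Turnstile>\<^sup>+ \<phi> \<equiv> satisfies A Plus \<phi>"

abbreviation models_neg :: "'r model \<Rightarrow> 'r fm \<Rightarrow> bool" (infix "\<Turnstile>\<^sup>-" 50) where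
  "A \<Turnstile>\<^sup>- \<phi> \<equiv> satisfies A Minus \<phi>"


section \<open>Word models\<close>

datatype 'a word_sym = Succ | P 'a

fun word_arity :: "'a word_sym \<Rightarrow> nat" where
  "word_arity Succ = 2"
| "word_arity (P a) = 1"

text \<open>Lists are indexed from \<open>0\<close>, whereas the letters of the word sit at positions \<open>1, \<dots>, n\<close>.\<close>

fun word_rel :: "'a list \<Rightarrow> 'a word_sym \<Rightarrow> nat list set" where
  "word_rel w Succ = {[i, i + 1] | i. i < length w}"
| "word_rel w (P a) = {[i] | i. 1 \<le> i \<and> i \<le> length w \<and> w ! (i - 1) = a}"

definition word_model :: "'a list \<Rightarrow> 'a word_sym model" where
  "word_model w = \<lparr>dom_of = {0..length w}, rel_of = word_rel w\<rparr>"

end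

theory Submission
  imports Defs "HOL-Library.Countable_Set" "HOL-Library.Nat_Bijection"
begin

text \<open>Winning a play by a strategy is a least fixed point, hence can be defined by Horn clauses. A
  position is coded as a number: the history of all updates of the model and the assignment is kept
  as a list of key-value pairs, so that looking up the current value of a key is again given by Horn
  clauses, and a universal choice over the finite domain is a bounded iteration. Bottom-up evaluation
  of finitely many clauses over numbers with successor and pairing needs only registers and one
  bit array, and a machine whose tape cells carry, besides the input letter, the set of
  registers whose value is the address of the cell and one bit of the array simulates this. It
  searches at the same time for a win of the existential player from the initial position with
  sign \<open>+\<close> and from the one with sign \<open>-\<close>; exchanging the players shows that at most one of them is
  won.\<close>

section \<open>Turing machines simulating programs on marked tapes\<close>

datatype 'a act = Put nat nat | Del nat | Shift nat bool | Tst nat nat | TstLetter nat "'a option"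

datatype 'a com =
    Do "'a act"
  | Seq "'a com" "'a com"
  | Cond "'a act" "'a com" "'a com"
  | Until "'a act" "'a com"
  | Stop

type_synonym marking = "nat \<Rightarrow> nat set"

definition letter_at :: "'a list \<Rightarrow> nat \<Rightarrow> 'a option" where
  "letter_at w i = (if i < length w then Some (w ! i) else None)"

text \<open>Marks are sought from the left end, so an action takes place at the leftmost cell
  carrying its mark; for a register this is its only cell.\<close>

definition spot :: "marking \<Rightarrow> nat \<Rightarrow> nat" where
  "spot S x = (LEAST p. p \<in> S x)"

fun target :: "'a act \<Rightarrow> nat" where
  "target (Put x y) = x"
| "target (Del x) = x"
| "target (Shift x up) = x"
| "target (Tst x y) = x"
| "target (TstLetter x l) = x"

fun marks_of :: "'a act \<Rightarrow> nat set" where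
  "marks_of (Put x y) = {x, y}"
| "marks_of (Del x) = {x}"
| "marks_of (Shift x up) = {x}"
| "marks_of (Tst x y) = {x, y}"
| "marks_of (TstLetter x l) = {x}"

fun eff :: "'a act \<Rightarrow> marking \<Rightarrow> marking" where
  "eff (Put x y) S = S(y := insert (spot S x) (S y))"
| "eff (Del x) S = S(x := S x - {spot S x})"
| "eff (Shift x up) S =
     S(x := insert (if up then Suc (spot S x) else spot S x - 1) (S x - {spot S x}))"
| "eff (Tst x y) S = S"
| "eff (TstLetter x l) S = S"

fun outcome :: "'a list \<Rightarrow> 'a act \<Rightarrow> marking \<Rightarrow> bool" where
  "outcome w (Tst x y) S \<longleftrightarrow> spot S x \<in> S y"
| "outcome w (TstLetter x l) S \<longleftrightarrow> letter_at w (spot S x) = l"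
| "outcome w _ S \<longleftrightarrow> True"

text \<open>Mark 1 must stay at address 0 and nowhere else, and no mark may leave the represented
  half of the two-way infinite tape.\<close>

fun guard :: "'a act \<Rightarrow> marking \<Rightarrow> bool" where
  "guard (Put x y) S \<longleftrightarrow> y \<noteq> 1"
| "guard (Del x) S \<longleftrightarrow> x \<noteq> 1"
| "guard (Shift x up) S \<longleftrightarrow> x \<noteq> 1 \<and> (up \<or> spot S x > 0)"
| "guard _ S \<longleftrightarrow> True"

text \<open>A list of commands is a control stack. \<open>Seq\<close> performs the dummy test
  \<open>Tst 1 1\<close>, whose mark sits at address 0, so that every unfolding of the stack is
  driven by an action. No action means halting: on \<open>[]\<close> in an accepting state, on a
  leading \<open>Stop\<close> in a rejecting one.\<close>

fun act_of :: "'a com list \<Rightarrow> 'a act option" where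
  "act_of [] = None"
| "act_of (Do a # K) = Some a"
| "act_of (Seq c d # K) = Some (Tst 1 1)"
| "act_of (Cond a c d # K) = Some a"
| "act_of (Until a c # K) = Some a"
| "act_of (Stop # K) = None"

fun continue :: "'a com list \<Rightarrow> bool \<Rightarrow> 'a com list" where
  "continue [] b = []"
| "continue (Do a # K) b = K"
| "continue (Seq c d # K) b = c # d # K"
| "continue (Cond a c d # K) b = (if b then c else d) # K"
| "continue (Until a c # K) b = (if b then K else c # Until a c # K)"
| "continue (Stop # K) b = Stop # K"

text \<open>The side conditions keep the head from getting lost: the scan to the right needs an
  occurrence of the target mark, the way back needs mark 1 at address 0 only.\<close>

inductive mstep :: "'a list \<Rightarrow> 'a com list \<times> marking \<Rightarrow> 'a com list \<times> marking \<Rightarrow> bool" for w where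
  "act_of K = Some a \<Longrightarrow> S (target a) \<noteq> {} \<Longrightarrow> S 1 = {0} \<Longrightarrow> guard a S
     \<Longrightarrow> mstep w (K, S) (continue K (outcome w a S), eff a S)"

text \<open>These stacks become machine states. They are finitely many because \<open>Until\<close>
  puts itself back directly below its body, so iterating does not deepen the stack.\<close>

fun stacks :: "'a com \<Rightarrow> 'a com list \<Rightarrow> 'a com list set" where
  "stacks (Do a) K = {Do a # K}"
| "stacks (Seq c d) K = {Seq c d # K} \<union> stacks c (d # K) \<union> stacks d K"
| "stacks (Cond a c d) K = {Cond a c d # K} \<union> stacks c K \<union> stacks d K"
| "stacks (Until a c) K = {Until a c # K} \<union> stacks c (Until a c # K)"
| "stacks Stop K = {Stop # K}"

lemma finite_stacks: "finite (stacks c K)"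
  by (induction c arbitrary: K) auto

lemma stacks_self: "c # K \<in> stacks c K"
  by (cases c) auto

lemma continue_stacks: "K' \<in> stacks c K \<Longrightarrow> continue K' b \<in> insert K (stacks c K)"
proof (induction c arbitrary: K)
  case (Seq c d)
  then consider "K' = Seq c d # K" | "K' \<in> stacks c (d # K)" | "K' \<in> stacks d K" by auto
  then show ?case
  proof cases
    case 2
    then show ?thesis using Seq.IH(1)[OF 2] stacks_self[of d K] by auto
  qed (use Seq.IH(2) stacks_self[of c "d # K"] in auto)
next
  case (Cond a c d)
  then consider "K' = Cond a c d # K" | "K' \<in> stacks c K" | "K' \<in> stacks d K" by auto
  then show ?case
    by cases (use Cond.IH stacks_self[of c K] stacks_self[of d K] in auto)
next
  case (Until a c)
  then consider "K' = Until a c # K" | "K' \<in> stacks c (Until a c # K)" by auto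
  then show ?case
    by cases (use Until.IH stacks_self[of c "Until a c # K"] in auto)
qed auto

fun com_marks :: "'a com \<Rightarrow> nat set" where
  "com_marks (Do a) = marks_of a"
| "com_marks (Seq c d) = {1} \<union> com_marks c \<union> com_marks d"
| "com_marks (Cond a c d) = marks_of a \<union> com_marks c \<union> com_marks d"
| "com_marks (Until a c) = marks_of a \<union> com_marks c"
| "com_marks Stop = {}"

lemma finite_marks_of: "finite (marks_of a)"
  by (cases a) auto

lemma finite_com_marks: "finite (com_marks c)"
  by (induction c) (auto simp: finite_marks_of)

lemma act_of_stacks: "K' \<in> stacks c K \<Longrightarrow> act_of K' = Some a \<Longrightarrow> marks_of a \<subseteq> com_marks c"
proof (induction c arbitrary: K)
  case (Seq c d)
  then show ?case by (auto dest!: Seq.IH)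
next
  case (Cond a c d)
  then show ?case by (auto dest!: Cond.IH)
next
  case (Until a c)
  then show ?case by (auto dest!: Until.IH)
qed auto

section \<open>Compilation of commands into a Turing machine\<close>

datatype phase = Scan | Adjust bool | Return bool

datatype 'a ctrl = Boot | At "'a com list" phase

lemma finite_phases: "finite (UNIV :: phase set)"
proof (rule finite_subset)
  show "UNIV \<subseteq> insert Scan (Adjust ` UNIV \<union> Return ` UNIV)"
  proof
    fix ph
    show "ph \<in> insert Scan (Adjust ` UNIV \<union> Return ` UNIV)" by (cases ph) auto
  qed
qed simp

text \<open>\<open>mod1\<close> changes the cell where the target mark was found,
  \<open>mod2\<close> the cell reached by the move \<open>dir_of\<close>. Only \<open>Shift\<close>
  needs both: it erases its mark in one cell and writes it in a neighbour.\<close>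

fun mod1 :: "'a act \<Rightarrow> nat set \<Rightarrow> nat set" where
  "mod1 (Put x y) M = insert y M"
| "mod1 (Del x) M = M - {x}"
| "mod1 (Shift x up) M = M - {x}"
| "mod1 _ M = M"

fun dir_of :: "'a act \<Rightarrow> dir" where
  "dir_of (Shift x up) = (if up then MoveRight else MoveLeft)"
| "dir_of _ = Stay"

fun mod2 :: "'a act \<Rightarrow> nat set \<Rightarrow> nat set" where
  "mod2 (Shift x up) M = insert x M"
| "mod2 _ M = M"

fun cell_outcome :: "'a act \<Rightarrow> 'a option \<Rightarrow> nat set \<Rightarrow> bool" where
  "cell_outcome (Tst x y) l M \<longleftrightarrow> y \<in> M"
| "cell_outcome (TstLetter x l') l M \<longleftrightarrow> l = l'"
| "cell_outcome _ l M \<longleftrightarrow> True"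

lemma mod1_subset: "marks_of a \<subseteq> N \<Longrightarrow> M \<subseteq> N \<Longrightarrow> mod1 a M \<subseteq> N"
  by (cases a) auto

lemma mod2_subset: "marks_of a \<subseteq> N \<Longrightarrow> M \<subseteq> N \<Longrightarrow> mod2 a M \<subseteq> N"
  by (cases a) auto

locale simulator =
  fixes prog :: "'a::finite com" and k :: nat
  assumes k: "com_marks prog \<subseteq> {..<k}" "1 < k"
begin

definition stk :: "'a com list set" where
  "stk = insert [] (stacks prog [])"

definition ctrls :: "'a ctrl set" where
  "ctrls = insert Boot (case_prod At ` (stk \<times> UNIV))"

definition cells :: "('a option \<times> nat set) set" where
  "cells = UNIV \<times> Pow {..<k}"

text \<open>Input letters and blanks count as cells without marks, so the tape needs no preparation;
  whatever is written is an \<open>Aux\<close> symbol that still carries the input letter.\<close>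

fun contents :: "'a tsym \<Rightarrow> 'a option \<times> nat set" where
  "contents Blank = (None, {})"
| "contents (Inp a) = (Some a, {})"
| "contents (Aux n) = from_nat_into cells n"

definition symbol :: "'a option \<times> nat set \<Rightarrow> 'a tsym" where
  "symbol x = Aux (to_nat_on cells x)"

text \<open>\<open>Boot\<close> puts all marks except 0 on the first cell: all registers are zero
  and the bit array is empty.\<close>

fun delta :: "'a ctrl \<Rightarrow> 'a option \<times> nat set \<Rightarrow> ('a ctrl \<times> nat set \<times> dir) option" where
  "delta Boot (l, M) = Some (At [prog] Scan, {1..<k}, Stay)"
| "delta (At K Scan) (l, M) = (case act_of K of None \<Rightarrow> None
     | Some a \<Rightarrow> if target a \<in> M then Some (At K (Adjust (cell_outcome a l M)), mod1 a M, dir_of a)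
                else Some (At K Scan, M, MoveRight))"
| "delta (At K (Adjust b)) (l, M) = (case act_of K of None \<Rightarrow> None
     | Some a \<Rightarrow> Some (At K (Return b), mod2 a M, Stay))"
| "delta (At K (Return b)) (l, M) =
     (if 1 \<in> M then Some (At (continue K b) Scan, M, Stay) else Some (At K (Return b), M, MoveLeft))"

definition machine :: "'a tm" where
  "machine = \<lparr>tm_states = to_nat_on ctrls ` ctrls, tm_aux = to_nat_on cells ` cells,
     tm_start = to_nat_on ctrls Boot, tm_accepting = {to_nat_on ctrls (At [] Scan)},
     tm_delta = (\<lambda>q s. case delta (from_nat_into ctrls q) (contents s) of None \<Rightarrow> None
        | Some (q', M, d) \<Rightarrow> Some (to_nat_on ctrls q', symbol (fst (contents s), M), d))\<rparr>"

lemma finite_ctrls: "finite ctrls"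
  by (simp add: ctrls_def stk_def finite_stacks finite_phases)

lemma finite_cells: "finite cells"
  by (simp add: cells_def)

lemma ctrls_dec [simp]: "q \<in> ctrls \<Longrightarrow> from_nat_into ctrls (to_nat_on ctrls q) = q"
  using finite_ctrls by (simp add: countable_finite)

lemma ctrls_inj: "q \<in> ctrls \<Longrightarrow> q' \<in> ctrls \<Longrightarrow> to_nat_on ctrls q = to_nat_on ctrls q' \<longleftrightarrow> q = q'"
  by (metis ctrls_dec)

lemma contents_symbol [simp]: "x \<in> cells \<Longrightarrow> contents (symbol x) = x"
  using finite_cells by (simp add: symbol_def countable_finite)

lemma contents_cells: "s \<in> tm_alphabet machine \<Longrightarrow> contents s \<in> cells"
  using finite_cells by (auto simp: tm_alphabet_def machine_def cells_def countable_finite)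

lemma continue_stk: "K \<in> stk \<Longrightarrow> continue K b \<in> stk"
  using continue_stacks[of K prog "[]" b] by (auto simp: stk_def)

lemma act_of_stk: "K \<in> stk \<Longrightarrow> act_of K = Some a \<Longrightarrow> marks_of a \<subseteq> {..<k}"
  using act_of_stacks[of K prog "[]" a] k by (auto simp: stk_def)

lemma prog_stk: "[prog] \<in> stk" "[] \<in> stk"
  using stacks_self by (auto simp: stk_def)

lemma At_ctrls: "At K ph \<in> ctrls \<longleftrightarrow> K \<in> stk"
  by (auto simp: ctrls_def)

lemma Boot_ctrls: "Boot \<in> ctrls"
  by (auto simp: ctrls_def)

lemma delta_closed:
  assumes "q \<in> ctrls" "(l, M) \<in> cells" "delta q (l, M) = Some (q', M', d)"
  shows "q' \<in> ctrls \<and> M' \<subseteq> {..<k}"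
proof -
  have M: "M \<subseteq> {..<k}" using assms by (auto simp: cells_def)
  consider "q = Boot" | K ph where "q = At K ph" by (cases q) auto
  then show ?thesis
  proof cases
    case 1
    then show ?thesis using assms prog_stk by (auto simp: At_ctrls)
  next
    case (2 K ph)
    then have K: "K \<in> stk" using assms(1) by (simp add: At_ctrls)
    have sub: "mod1 a M \<subseteq> {..<k}" "mod2 a M \<subseteq> {..<k}" if "act_of K = Some a" for a
      by (rule mod1_subset[OF act_of_stk[OF K that] M], rule mod2_subset[OF act_of_stk[OF K that] M])
    show ?thesis
      by (cases ph)
        (use 2 K M assms sub continue_stk in \<open>auto simp: At_ctrls split: option.splits if_splits\<close>)
  qed
qed

lemma turing_machine_machine: "turing_machine machine"
proof -
  have "q' \<in> tm_states machine \<and> s' \<in> tm_alphabet machine"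
    if "q \<in> tm_states machine" "s \<in> tm_alphabet machine" "tm_delta machine q s = Some (q', s', d)"
    for q s q' s' d
  proof -
    have "q \<in> to_nat_on ctrls ` ctrls" using that(1) by (simp add: machine_def)
    then obtain c where c: "c \<in> ctrls" "q = to_nat_on ctrls c" by blast
    obtain l M where lM: "contents s = (l, M)" by fastforce
    have lMc: "(l, M) \<in> cells" using contents_cells[OF that(2)] lM by simp
    from that(3) obtain c' M' where *: "delta c (l, M) = Some (c', M', d)" "q' = to_nat_on ctrls c'"
      "s' = symbol (l, M')"
      using c lM by (auto simp: machine_def split: option.splits)
    have "c' \<in> ctrls" "M' \<subseteq> {..<k}" using delta_closed[OF c(1) lMc *(1)] by auto
    then show ?thesis using * by (auto simp: machine_def tm_alphabet_def symbol_def cells_def)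
  qed
  moreover have "tm_accepting machine \<subseteq> tm_states machine" "tm_start machine \<in> tm_states machine"
    using prog_stk Boot_ctrls by (simp_all add: machine_def At_ctrls)
  moreover have "finite (tm_states machine)" "finite (tm_aux machine)"
    using finite_ctrls finite_cells by (simp_all add: machine_def)
  ultimately show ?thesis
    unfolding turing_machine_def by blast
qed

text \<open>Cells at negative positions are unconstrained; the head never visits them, as the way
  back stops at address 0.\<close>

definition conf :: "'a list \<Rightarrow> 'a ctrl \<Rightarrow> (nat \<Rightarrow> nat set) \<Rightarrow> nat \<Rightarrow> 'a config \<Rightarrow> bool" where
  "conf w q C h c \<longleftrightarrow> q \<in> ctrls \<and> cf_state c = to_nat_on ctrls q \<and> cf_head c = int h \<and>
     (\<forall>i. C i \<subseteq> {..<k} \<and> contents (cf_tape c (int i)) = (letter_at w i, C i))"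

abbreviation tstep :: "'a config \<Rightarrow> 'a config \<Rightarrow> bool" where
  "tstep c c' \<equiv> tm_step machine c = Some c'"

lemma conf_step:
  assumes "conf w q C h c" "delta q (letter_at w h, C h) = Some (q', M, d)"
    "int h + shift d = int h'"
  shows "\<exists>c'. tstep c c' \<and> conf w q' (C(h := M)) h' c'"
proof -
  have cell: "(letter_at w h, C h) \<in> cells" using assms(1) by (auto simp: conf_def cells_def)
  have cl: "q' \<in> ctrls" "M \<subseteq> {..<k}"
    using delta_closed[OF _ cell assms(2)] assms(1) by (auto simp: conf_def)
  then have "(letter_at w h, M) \<in> cells" by (auto simp: cells_def)
  then show ?thesis using assms cl by (auto simp: conf_def tm_step_def machine_def)
qed

lemma conf_scan:
  assumes "act_of K = Some a" "target a \<in> C p" "\<And>i. i < p \<Longrightarrow> target a \<notin> C i"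
  shows "h \<le> p \<Longrightarrow> conf w (At K Scan) C h c \<Longrightarrow> \<exists>c'. tstep\<^sup>*\<^sup>* c c' \<and> conf w (At K Scan) C p c'"
proof (induction h arbitrary: c rule: inc_induct)
  case base
  then show ?case by blast
next
  case (step h)
  have "delta (At K Scan) (letter_at w h, C h) = Some (At K Scan, C h, MoveRight)"
    using assms(1,3) step.hyps by auto
  from conf_step[OF step.prems this, of "Suc h"]
  obtain c1 where "tstep c c1" "conf w (At K Scan) C (Suc h) c1" by auto
  then show ?case using step.IH by (meson converse_rtranclp_into_rtranclp)
qed

lemma conf_return:
  assumes "\<And>i. 1 \<in> C i \<longleftrightarrow> i = 0"
  shows "conf w (At K (Return b)) C h c \<Longrightarrow>
    \<exists>c'. tstep\<^sup>+\<^sup>+ c c' \<and> conf w (At (continue K b) Scan) C 0 c'"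
proof (induction h arbitrary: c)
  case 0
  from conf_step[OF 0, of "At (continue K b) Scan" "C 0" Stay 0] show ?case using assms by auto
next
  case (Suc h)
  from conf_step[OF Suc.prems, of "At K (Return b)" "C (Suc h)" MoveLeft h] assms
  obtain c1 where "tstep c c1" "conf w (At K (Return b)) C h c1" by auto
  then show ?case using Suc.IH by (meson tranclp_into_tranclp2)
qed

definition cells_of :: "marking \<Rightarrow> nat \<Rightarrow> nat set" where
  "cells_of S i = {m. m < k \<and> i \<in> S m}"

definition sim :: "'a list \<Rightarrow> 'a com list \<times> marking \<Rightarrow> 'a config \<Rightarrow> bool" where
  "sim w x c \<longleftrightarrow> conf w (At (fst x) Scan) (cells_of (snd x)) 0 c"

text \<open>The strict closure matters for divergence: endlessly many program steps then force
  arbitrarily long machine runs.\<close>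

lemma sim_mstep:
  assumes "mstep w x y" "sim w x c"
  shows "\<exists>c'. tstep\<^sup>+\<^sup>+ c c' \<and> sim w y c'"
  using assms
proof cases
  case (1 K a S)
  define p where "p = spot S (target a)"
  define C where "C = cells_of S"
  have cf: "conf w (At K Scan) C 0 c" using assms(2) 1 by (simp add: sim_def C_def)
  then have K: "K \<in> stk" by (simp add: conf_def At_ctrls)
  have mk: "marks_of a \<subseteq> {..<k}" using act_of_stk K 1 by blast
  have tk: "target a < k" using mk by (cases a) auto
  have p: "p \<in> S (target a)" using 1(4) unfolding p_def spot_def by (meson LeastI ex_in_conv)
  have np: "i \<notin> S (target a)" if "i < p" for i
    using that not_less_Least unfolding p_def spot_def by blast
  obtain c1 where c1: "tstep\<^sup>*\<^sup>* c c1" "conf w (At K Scan) C p c1"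
    using conf_scan[OF 1(3) _ _ _ cf, of p] p np tk by (auto simp: C_def cells_of_def)
  define b where "b = cell_outcome a (letter_at w p) (C p)"
  have b: "b = outcome w a S"
    using mk by (cases a) (auto simp: b_def C_def cells_of_def p_def)
  \<comment> \<open>The first change happens at \<open>p\<close>, the second at \<open>p'\<close>;
    they differ only for \<open>Shift\<close>, where the guard gives \<open>p > 0\<close> before a
    move to the left.\<close>
  obtain p' where p': "int p + shift (dir_of a) = int p'"
    "p' = (case a of Shift x up \<Rightarrow> if up then Suc p else p - 1 | _ \<Rightarrow> p)"
    using 1(6) by (cases a) (auto simp: p_def)
  define C1 where "C1 = C(p := mod1 a (C p))"
  define C2 where "C2 = C1(p' := mod2 a (C1 p'))"
  have "delta (At K Scan) (letter_at w p, C p) = Some (At K (Adjust b), mod1 a (C p), dir_of a)"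
    using 1(3) p tk by (auto simp: b_def C_def cells_of_def)
  from conf_step[OF c1(2) this p'(1)]
  obtain c2 where c2: "tstep c1 c2" "conf w (At K (Adjust b)) C1 p' c2" by (auto simp: C1_def)
  have "delta (At K (Adjust b)) (letter_at w p', C1 p') = Some (At K (Return b), mod2 a (C1 p'), Stay)"
    using 1(3) by auto
  from conf_step[OF c2(2) this, of p']
  obtain c3 where c3: "tstep c2 c3" "conf w (At K (Return b)) C2 p' c3" by (auto simp: C2_def)
  have C2: "C2 = cells_of (eff a S)"
    using mk 1(6) unfolding C2_def C1_def C_def cells_of_def p'(2)
    by (cases a) (auto simp: p_def fun_eq_iff)
  have "eff a S 1 = {0}" using 1(5,6) by (cases a) auto
  then have "1 \<in> C2 i \<longleftrightarrow> i = 0" for i using k by (auto simp: C2 cells_of_def)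
  from conf_return[OF this c3(2)]
  obtain c4 where c4: "tstep\<^sup>+\<^sup>+ c3 c4" "conf w (At (continue K b) Scan) C2 0 c4" by auto
  have "tstep\<^sup>+\<^sup>+ c c4"
    using c1(1) c2(1) c3(1) c4(1) by (meson rtranclp_into_tranclp1 tranclp.trancl_into_trancl tranclp_trans)
  then show ?thesis using c4(2) 1 b C2 by (auto simp: sim_def)
qed

lemma sim_msteps:
  "(mstep w)\<^sup>*\<^sup>* x y \<Longrightarrow> sim w x c \<Longrightarrow> \<exists>c'. tstep\<^sup>*\<^sup>* c c' \<and> sim w y c'"
proof (induction arbitrary: c rule: rtranclp_induct)
  case (step y z)
  then show ?case using sim_mstep by (meson rtranclp_trans tranclp_into_rtranclp)
qed blast

lemma sim_msteps_plus:
  "(mstep w)\<^sup>+\<^sup>+ x y \<Longrightarrow> sim w x c \<Longrightarrow> \<exists>c'. tstep\<^sup>+\<^sup>+ c c' \<and> sim w y c'"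
proof (induction arbitrary: c rule: tranclp_induct)
  case (step y z)
  then show ?case using sim_mstep by (meson tranclp_trans)
qed (use sim_mstep in blast)

section \<open>Initial configuration, halting and divergence\<close>

definition start_marking :: marking where
  "start_marking m = (if m = 0 then {} else {0})"

lemma sim_start: "\<exists>c. tstep (tm_initial machine w) c \<and> sim w ([prog], start_marking) c"
proof -
  have "conf w Boot (\<lambda>_. {}) 0 (tm_initial machine w)"
    by (auto simp: conf_def tm_initial_def machine_def letter_at_def Boot_ctrls)
  moreover have "delta Boot (letter_at w 0, {}) = Some (At [prog] Scan, {1..<k}, Stay)" by simp
  ultimately obtain c where "tstep (tm_initial machine w) c"
    "conf w (At [prog] Scan) ((\<lambda>_. {})(0 := {1..<k})) 0 c"
    using conf_step[of w Boot "\<lambda>_. {}" 0 _ _ _ Stay 0] by fastforce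
  moreover have "(\<lambda>_. {})(0 := {1..<k}) = cells_of start_marking"
    by (auto simp: cells_of_def start_marking_def fun_eq_iff)
  ultimately show ?thesis by (auto simp: sim_def)
qed

lemma sim_halt: "sim w (K, S) c \<Longrightarrow> act_of K = None \<Longrightarrow> tm_step machine c = None"
  by (cases "contents (cf_tape c 0)") (auto simp: sim_def conf_def tm_step_def machine_def)

lemma sim_accepting:
  assumes "sim w (K, S) c"
  shows "cf_state c \<in> tm_accepting machine \<longleftrightarrow> K = []"
proof -
  have "At K Scan \<in> ctrls" "cf_state c = to_nat_on ctrls (At K Scan)"
    using assms by (simp_all add: sim_def conf_def)
  then have "cf_state c = to_nat_on ctrls (At [] Scan) \<longleftrightarrow> At K Scan = At [] Scan"
    using ctrls_inj[of "At K Scan" "At [] Scan"] prog_stk(2) by (simp add: At_ctrls)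
  then show ?thesis by (simp add: machine_def)
qed

text \<open>By determinism, a run that ends in a halted configuration passes through everything
  reachable from its start.\<close>

lemma reach_det:
  assumes "tstep\<^sup>*\<^sup>* c c1" "tm_step machine c1 = None"
  shows "tstep\<^sup>*\<^sup>* c c2 \<Longrightarrow> tstep\<^sup>*\<^sup>* c2 c1"
  using assms(1)
proof (induction arbitrary: c2 rule: converse_rtranclp_induct)
  case base
  then show ?case using assms(2) by (auto elim: converse_rtranclpE)
next
  case (step y z)
  from step.prems show ?case
  proof (cases rule: converse_rtranclpE)
    case base
    then show ?thesis
      using converse_rtranclp_into_rtranclp[of tstep, OF step.hyps(1,2)] by simp
  next
    case (step z')
    then show ?thesis using step.IH \<open>tstep y z\<close> by simp
  qed
qed

lemma halts_det:
  assumes "tstep\<^sup>*\<^sup>* (tm_initial machine w) c" "tm_step machine c = None"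
  shows "tm_halts_in machine w q \<longleftrightarrow> q = cf_state c"
proof
  assume "tm_halts_in machine w q"
  then obtain d where d: "tstep\<^sup>*\<^sup>* (tm_initial machine w) d" "tm_step machine d = None"
    "cf_state d = q" by (auto simp: tm_halts_in_def)
  have "tstep\<^sup>*\<^sup>* d c" using reach_det assms d(1) by blast
  then show "q = cf_state c" using d by (auto elim: converse_rtranclpE)
qed (use assms in \<open>auto simp: tm_halts_in_def\<close>)

lemma machine_halts:
  assumes "(mstep w)\<^sup>*\<^sup>* ([prog], start_marking) (K, S)" "act_of K = None"
  shows "tm_accepts machine w \<longleftrightarrow> K = []" "tm_rejects machine w \<longleftrightarrow> K \<noteq> []"
proof -
  obtain c where "tstep\<^sup>*\<^sup>* (tm_initial machine w) c" "sim w (K, S) c"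
    using sim_start sim_msteps[OF assms(1)] by (meson converse_rtranclp_into_rtranclp)
  then show "tm_accepts machine w \<longleftrightarrow> K = []" "tm_rejects machine w \<longleftrightarrow> K \<noteq> []"
    using halts_det[OF _ sim_halt[OF _ assms(2)]] sim_accepting
    unfolding tm_accepts_def tm_rejects_def by metis+
qed

text \<open>The invariant \<open>I\<close> always admits at least one more step. If the machine
  halted, induction along the halting run would show that no configuration on it, or reachable from
  it, simulates a state satisfying \<open>I\<close>; the one simulating \<open>x0\<close>
  contradicts this.\<close>

lemma machine_diverges:
  assumes "(mstep w)\<^sup>*\<^sup>* ([prog], start_marking) x0" "I x0"
    and I: "\<And>x. I x \<Longrightarrow> \<exists>y. (mstep w)\<^sup>+\<^sup>+ x y \<and> I y"
  shows "\<not> tm_accepts machine w" "\<not> tm_rejects machine w"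
proof -
  have next_d: "\<exists>d' y. tstep\<^sup>+\<^sup>+ d d' \<and> I y \<and> sim w y d'" if "I x" "sim w x d" for x d
    using I[OF that(1)] sim_msteps_plus[OF _ that(2)] by blast
  have "\<not> tm_halts_in machine w q" for q
  proof
    assume "tm_halts_in machine w q"
    then obtain c where c: "tstep\<^sup>*\<^sup>* (tm_initial machine w) c" "tm_step machine c = None"
      by (auto simp: tm_halts_in_def)
    obtain c0 where c0: "tstep (tm_initial machine w) c0" "sim w ([prog], start_marking) c0"
      using sim_start by blast
    obtain c' where c': "tstep\<^sup>*\<^sup>* c0 c'" "sim w x0 c'"
      using sim_msteps[OF assms(1) c0(2)] by blast
    have "tstep\<^sup>*\<^sup>* c' c"
      using reach_det[OF c converse_rtranclp_into_rtranclp[of tstep, OF c0(1) c'(1)]] .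
    then have "\<not> (I x \<and> sim w x d)" if "tstep\<^sup>*\<^sup>* c' d" for d x
      using that
    proof (induction arbitrary: d x rule: converse_rtranclp_induct)
      case base
      then have "d = c" using c(2) by (auto elim: converse_rtranclpE)
      show ?case
      proof
        assume "I x \<and> sim w x d"
        then obtain d' where "tstep\<^sup>+\<^sup>+ d d'" using next_d by blast
        then show False using \<open>d = c\<close> c(2) by (auto dest: tranclpD)
      qed
    next
      case (step y z)
      show ?case
      proof
        assume d: "I x \<and> sim w x d"
        then obtain d' x' where d': "tstep\<^sup>+\<^sup>+ d d'" "I x'" "sim w x' d'"
          using next_d by blast
        have "tstep\<^sup>+\<^sup>+ y d'" using rtranclp_tranclp_tranclp[OF step.prems d'(1)] .
        then have "tstep\<^sup>*\<^sup>* z d'" using step.hyps(1) by (auto dest!: tranclpD)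
        then show False using step.IH d'(2,3) by blast
      qed
    qed
    from this[of c' x0] show False using c'(2) assms(2) by simp
  qed
  then show "\<not> tm_accepts machine w" "\<not> tm_rejects machine w"
    by (auto simp: tm_accepts_def tm_rejects_def)
qed

end

section \<open>Programs on registers\<close>

text \<open>Mark \<open>0\<close> is the bit array. Mark \<open>1\<close> never leaves address \<open>0\<close>: it stops the head on its way
  back, and serves as a register that is constantly zero. All other marks are registers.\<close>

definition rep :: "(nat \<Rightarrow> nat) \<Rightarrow> nat set \<Rightarrow> marking" where
  "rep v W m = (if m = 0 then W else if m = 1 then {0} else {v m})"

definition reg :: "(nat \<Rightarrow> nat) \<Rightarrow> nat \<Rightarrow> nat" where
  "reg v r = (if r = 1 then 0 else v r)"

lemma spot_rep [simp]: "0 < r \<Longrightarrow> spot (rep v W) r = reg v r"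
  by (auto simp: spot_def rep_def reg_def intro: Least_equality)

lemma reg_simps [simp]: "reg v (Suc 0) = 0" "r \<noteq> Suc 0 \<Longrightarrow> reg v r = v r"
  by (simp_all add: reg_def)

text \<open>Total correctness. The final state must be the same for all commands \<open>K\<close>
  waiting below, which turns sequential composition into a mere chaining of runs.\<close>

definition wp ::
    "'a list \<Rightarrow> 'a com \<Rightarrow> ((nat \<Rightarrow> nat) \<Rightarrow> nat set \<Rightarrow> bool) \<Rightarrow> (nat \<Rightarrow> nat) \<Rightarrow> nat set \<Rightarrow> bool"
  where
  "wp w c Q v W \<longleftrightarrow>
     (\<exists>v' W'. (\<forall>K. (mstep w)\<^sup>*\<^sup>* (c # K, rep v W) (K, rep v' W')) \<and> Q v' W')"

lemma wp_mono:
  "wp w c Q v W \<Longrightarrow> (\<And>v' W'. Q v' W' \<Longrightarrow> R v' W') \<Longrightarrow> wp w c R v W"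
  unfolding wp_def by blast

lemma mstepI:
  "act_of K = Some a \<Longrightarrow> S (target a) \<noteq> {} \<Longrightarrow> S 1 = {0} \<Longrightarrow> guard a S
     \<Longrightarrow> K' = continue K (outcome w a S) \<Longrightarrow> S' = eff a S \<Longrightarrow> mstep w (K, S) (K', S')"
  using mstep.intros by blast

lemma rep_nonempty: "0 < r \<Longrightarrow> rep v W r \<noteq> {}"
  by (simp add: rep_def)

lemma rep_home [simp]: "rep v W 1 = {0}" "rep v W (Suc 0) = {0}"
  by (simp_all add: rep_def)

lemma wp_seq:
  assumes "wp w c (\<lambda>v' W'. wp w d Q v' W') v W"
  shows "wp w (Seq c d) Q v W"
proof -
  obtain v1 W1 v2 W2 where
    1: "\<forall>K. (mstep w)\<^sup>*\<^sup>* (c # K, rep v W) (K, rep v1 W1)" and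
    2: "\<forall>K. (mstep w)\<^sup>*\<^sup>* (d # K, rep v1 W1) (K, rep v2 W2)" and "Q v2 W2"
    using assms unfolding wp_def by blast
  have "mstep w (Seq c d # K, rep v W) (c # d # K, rep v W)" for K
    by (rule mstepI) (auto simp: rep_nonempty)
  then have "(mstep w)\<^sup>*\<^sup>* (Seq c d # K, rep v W) (K, rep v2 W2)" for K
    using 1 2 by (meson converse_rtranclp_into_rtranclp rtranclp_trans)
  then show ?thesis using \<open>Q v2 W2\<close> unfolding wp_def by blast
qed

lemma wp_step:
  assumes "\<And>K. mstep w (c # K, rep v W) (d # K, rep v W)" "wp w d Q v W"
  shows "wp w c Q v W"
  using assms(2) converse_rtranclp_into_rtranclp[of "mstep w", OF assms(1)] unfolding wp_def by blast

fun is_test :: "'a act \<Rightarrow> bool" where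
  "is_test (Tst x y) \<longleftrightarrow> 0 < x"
| "is_test (TstLetter x l) \<longleftrightarrow> 0 < x"
| "is_test _ \<longleftrightarrow> False"

text \<open>One kind of test serves two purposes: against mark 0 it reads a bit of the array,
  against a register it compares two values.\<close>

fun passes :: "'a list \<Rightarrow> 'a act \<Rightarrow> (nat \<Rightarrow> nat) \<Rightarrow> nat set \<Rightarrow> bool" where
  "passes w (Tst x y) v W \<longleftrightarrow> (if y = 0 then reg v x \<in> W else reg v x = reg v y)"
| "passes w (TstLetter x l) v W \<longleftrightarrow> letter_at w (reg v x) = l"
| "passes w _ v W \<longleftrightarrow> True"

lemma test_simps:
  assumes "is_test a"
  shows "rep v W (target a) \<noteq> {}" "guard a S" "eff a S = S"
    "outcome w a (rep v W) = passes w a v W"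
  using assms by (cases a; auto simp: rep_nonempty rep_def reg_def)+

lemma wp_cond:
  assumes "is_test a"
    and "passes w a v W \<Longrightarrow> wp w c Q v W" "\<not> passes w a v W \<Longrightarrow> wp w d Q v W"
  shows "wp w (Cond a c d) Q v W"
proof -
  have "mstep w (Cond a c d # K, rep v W) ((if passes w a v W then c else d) # K, rep v W)" for K
    by (rule mstepI[where a = a]) (simp_all add: assms(1) test_simps)
  then show ?thesis using assms(2,3) by (cases "passes w a v W") (auto intro: wp_step)
qed

text \<open>Meant for terminating loops whose body leaves the array alone. The outer search, which
  fills the array and may run forever, is followed step by step instead.\<close>

lemma wp_until:
  fixes m :: "(nat \<Rightarrow> nat) \<Rightarrow> nat"
  assumes a: "is_test a" and "I v"
    and body: "\<And>v. I v \<Longrightarrow> \<not> passes w a v W \<Longrightarrow>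
      wp w c (\<lambda>v' W'. W' = W \<and> I v' \<and> m v' < m v) v W"
    and Q: "\<And>v. I v \<Longrightarrow> passes w a v W \<Longrightarrow> Q v W"
  shows "wp w (Until a c) Q v W"
  using \<open>I v\<close>
proof (induction "m v" arbitrary: v rule: less_induct)
  case less
  have step: "mstep w (Until a c # K, rep v W)
      (if passes w a v W then K else c # Until a c # K, rep v W)" for K
    by (rule mstepI[where a = a]) (simp_all add: a test_simps)
  show ?case
  proof (cases "passes w a v W")
    case True
    then have "\<forall>K. (mstep w)\<^sup>*\<^sup>* (Until a c # K, rep v W) (K, rep v W)"
      using step by auto
    then show ?thesis using Q[OF less.prems True] unfolding wp_def by blast
  next
    case False
    obtain v1 where 1: "\<forall>K. (mstep w)\<^sup>*\<^sup>* (c # K, rep v W) (K, rep v1 W)" "I v1" "m v1 < m v"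
      using body[OF less.prems False] unfolding wp_def by blast
    obtain v2 W2 where 2: "\<forall>K. (mstep w)\<^sup>*\<^sup>* (Until a c # K, rep v1 W) (K, rep v2 W2)" "Q v2 W2"
      using less.hyps[OF 1(3,2)] unfolding wp_def by blast
    have "(mstep w)\<^sup>*\<^sup>* (Until a c # K, rep v W) (K, rep v2 W2)" for K
    proof -
      have "mstep w (Until a c # K, rep v W) (c # Until a c # K, rep v W)"
        using step[of K] False by simp
      also have "(mstep w)\<^sup>*\<^sup>* (c # Until a c # K, rep v W) (Until a c # K, rep v1 W)" using 1 by simp
      also have "(mstep w)\<^sup>*\<^sup>* (Until a c # K, rep v1 W) (K, rep v2 W2)" using 2 by simp
      finally show ?thesis by simp
    qed
    then show ?thesis using 2(2) unfolding wp_def by blast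
  qed
qed

section \<open>Copying registers, and Cantor pairing by counting\<close>

definition copy :: "nat \<Rightarrow> nat \<Rightarrow> 'a com" where
  "copy r s = Seq (Do (Del r)) (Do (Put s r))"

abbreviation zero :: "nat \<Rightarrow> 'a com" where
  "zero r \<equiv> copy r 1"

abbreviation inc :: "nat \<Rightarrow> 'a com" where
  "inc r \<equiv> Do (Shift r True)"

abbreviation dec :: "nat \<Rightarrow> 'a com" where
  "dec r \<equiv> Do (Shift r False)"

text \<open>Between \<open>Del r\<close> and \<open>Put s r\<close> the mark \<open>r\<close> is
  nowhere on the tape, so the intermediate marking is no \<open>rep\<close> and the run has to be
  composed from single steps.\<close>

lemma wp_copy:
  assumes "1 < r" "0 < s" "r \<noteq> s" "Q (v(r := reg v s)) W"
  shows "wp w (copy r s) Q v W"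
proof -
  let ?S = "(rep v W)(r := {})"
  have s: "spot ?S s = reg v s"
    using assms spot_rep[of s v W] by (simp add: spot_def)
  have "(mstep w)\<^sup>*\<^sup>* (copy r s # K, rep v W) (K, rep (v(r := reg v s)) W)" for K
  proof -
    have 1: "mstep w (copy r s # K, rep v W) (Do (Del r) # Do (Put s r) # K, rep v W)"
      by (rule mstepI) (auto simp: copy_def rep_nonempty)
    have 2: "mstep w (Do (Del r) # Do (Put s r) # K, rep v W) (Do (Put s r) # K, ?S)"
      by (rule mstepI) (use assms in \<open>auto simp: rep_nonempty rep_def\<close>)
    have 3: "mstep w (Do (Put s r) # K, ?S) (K, rep (v(r := reg v s)) W)"
      by (rule mstepI) (use assms s in \<open>auto simp: rep_nonempty rep_def fun_eq_iff\<close>)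
    note r = converse_rtranclp_into_rtranclp[of "mstep w"]
    show ?thesis by (rule r[OF 1 r[OF 2 r[OF 3 rtranclp.rtrancl_refl]]])
  qed
  then show ?thesis using assms(4) unfolding wp_def by blast
qed

lemma wp_do:
  assumes "rep v W (target a) \<noteq> {}" "guard a (rep v W)" "eff a (rep v W) = rep v' W'" "Q v' W'"
  shows "wp w (Do a) Q v W"
proof -
  have "mstep w (Do a # K, rep v W) (K, rep v' W')" for K
    by (rule mstepI) (use assms in auto)
  then show ?thesis using assms(4) unfolding wp_def by blast
qed

lemma wp_inc: "1 < r \<Longrightarrow> Q (v(r := Suc (v r))) W \<Longrightarrow> wp w (inc r) Q v W"
  by (rule wp_do) (auto simp: rep_def fun_eq_iff)

lemma wp_dec: "1 < r \<Longrightarrow> 0 < v r \<Longrightarrow> Q (v(r := v r - 1)) W \<Longrightarrow> wp w (dec r) Q v W"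
  by (rule wp_do) (auto simp: rep_def fun_eq_iff)

lemma wp_collect: "1 < r \<Longrightarrow> Q v (insert (v r) W) \<Longrightarrow> wp w (Do (Put r 0)) Q v W"
  by (rule wp_do) (auto simp: rep_def fun_eq_iff)

text \<open>Cantor pairing runs through the antidiagonals, and \<open>y = 0\<close> is the end of
  one. Hence a decoding can be kept up to date by increments and decrements while a counter
  runs.\<close>

lemma prod_decode_Suc:
  "prod_decode (Suc n) = (case prod_decode n of (x, y) \<Rightarrow> if y = 0 then (0, Suc x) else (Suc x, y - 1))"
proof -
  obtain x y where xy: "prod_decode n = (x, y)" by fastforce
  then have n: "n = prod_encode (x, y)" by (metis prod_decode_inverse)
  have "Suc n = prod_encode (if y = 0 then (0, Suc x) else (Suc x, y - 1))"
    by (cases y) (simp_all add: n prod_encode_def)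
  then show ?thesis by (simp only: prod_encode_inverse xy) simp
qed

definition advance :: "nat \<Rightarrow> nat \<Rightarrow> nat \<Rightarrow> 'a com" where
  "advance t a b = Seq (inc t)
     (Cond (Tst b 1) (Seq (copy b a) (Seq (inc b) (zero a))) (Seq (inc a) (dec b)))"

lemma wp_advance:
  assumes "1 < t" "1 < a" "1 < b" "distinct [t, a, b]" "prod_decode (v t) = (v a, v b)"
    and "Q (v(t := Suc (v t), a := fst (prod_decode (Suc (v t))),
      b := snd (prod_decode (Suc (v t))))) W"
  shows "wp w (advance t a b) Q v W"
  unfolding advance_def
  by (intro wp_seq wp_inc wp_cond wp_copy wp_dec)
    (use assms in \<open>auto simp: prod_decode_Suc fun_upd_twist split: if_splits\<close>)

definition unpair :: "nat \<Rightarrow> nat \<Rightarrow> nat \<Rightarrow> nat \<Rightarrow> 'a com" where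
  "unpair s a b t = Seq (zero t) (Seq (zero a) (Seq (zero b) (Until (Tst t s) (advance t a b))))"

lemma wp_unpair:
  assumes "1 < s" "1 < a" "1 < b" "1 < t" "distinct [s, a, b, t]"
    and Q: "Q (v(t := v s, a := fst (prod_decode (v s)), b := snd (prod_decode (v s)))) W"
  shows "wp w (unpair s a b t) Q v W"
proof -
  \<comment> \<open>Closed form of the registers once the counter has reached \<open>n\<close>; the
    loop invariant is being of this form.\<close>
  define st where "st n = v(t := n, a := fst (prod_decode n), b := snd (prod_decode n))" for n
  have st: "st n t = n" "st n s = v s" "st n a = fst (prod_decode n)" "st n b = snd (prod_decode n)"
    for n using assms(5) by (auto simp: st_def)
  have st_Suc: "(st n)(t := Suc n, a := fst (prod_decode (Suc n)), b := snd (prod_decode (Suc n)))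
      = st (Suc n)" for n
    using assms(5) by (auto simp: st_def fun_eq_iff)
  have loop: "wp w (Until (Tst t s) (advance t a b)) Q (st 0) W"
  proof (rule wp_until[where I = "\<lambda>v'. \<exists>n\<le>v s. v' = st n" and m = "\<lambda>v'. v s - v' t"])
    fix v' assume "\<exists>n\<le>v s. v' = st n" "\<not> passes w (Tst t s) v' W"
    then obtain n where n: "n < v s" "v' = st n"
      using assms(1,4) by (auto simp: st le_less)
    then have ex: "\<exists>m\<le>v s. st (Suc n) = st m" by (intro exI[of _ "Suc n"]) auto
    show "wp w (advance t a b) (\<lambda>v'' W'. W' = W \<and> (\<exists>n\<le>v s. v'' = st n) \<and> v s - v'' t < v s - v' t) v' W"
      by (rule wp_advance) (use assms n ex in \<open>auto simp: st st_Suc\<close>)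
  next
    fix v' assume "\<exists>n\<le>v s. v' = st n" "passes w (Tst t s) v' W"
    then show "Q v' W" using assms(1,4) Q by (auto simp: st) (simp add: st_def)
  qed (use assms(4) in auto)
  have "st 0 = v(t := 0, a := 0, b := 0)"
    by (simp add: st_def prod_decode_def prod_decode_aux.simps)
  with loop show ?thesis
    unfolding unpair_def by (intro wp_seq wp_copy) (use assms in auto)
qed

text \<open>Pairing inverts the enumeration by search: \<open>t\<close> counts until its decoding is
  the wanted pair. The flag \<open>f\<close> is there because a loop exits on a single test, while
  here two components must agree.\<close>

definition mkpair :: "nat \<Rightarrow> nat \<Rightarrow> nat \<Rightarrow> nat \<Rightarrow> nat \<Rightarrow> nat \<Rightarrow> 'a com" where
  "mkpair t x y a b f = Seq (zero t) (Seq (zero a) (Seq (zero b) (Seq (zero f) (Seq (inc f)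
     (Until (Tst f 1)
       (Cond (Tst a x) (Cond (Tst b y) (zero f) (advance t a b)) (advance t a b)))))))"

lemma wp_mkpair:
  assumes "\<forall>r\<in>{t, x, y, a, b, f}. 1 < r" "distinct [t, x, y, a, b, f]"
    and Q: "\<And>v'. v' t = prod_encode (v x, v y) \<Longrightarrow> (\<forall>r. r \<notin> {t, a, b, f} \<longrightarrow> v' r = v r) \<Longrightarrow> Q v' W"
  shows "wp w (mkpair t x y a b f) Q v W"
proof -
  define st where "st n = v(t := n, a := fst (prod_decode n), b := snd (prod_decode n), f := 1)" for n
  define N where "N = prod_encode (v x, v y)"
  have st: "st n t = n" "st n x = v x" "st n y = v y" "st n a = fst (prod_decode n)"
      "st n b = snd (prod_decode n)" "st n f = 1" for n
    using assms(2) by (auto simp: st_def)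
  have st_Suc: "(st n)(t := Suc n, a := fst (prod_decode (Suc n)), b := snd (prod_decode (Suc n)))
      = st (Suc n)" for n
    using assms(2) by (auto simp: st_def fun_eq_iff)
  have N: "fst (prod_decode n) = v x \<and> snd (prod_decode n) = v y \<longleftrightarrow> n = N" for n
    unfolding N_def by (metis prod.collapse prod.sel prod_decode_inverse prod_encode_inverse)
  let ?I = "\<lambda>v'. (\<exists>n\<le>N. v' = st n) \<or> v' = (st N)(f := 0)"
  \<comment> \<open>The last iteration clears \<open>f\<close> and leaves \<open>t\<close> alone, so
    the flag has to contribute to the measure.\<close>
  let ?m = "\<lambda>v'. (N - v' t) + v' f"
  let ?R = "\<lambda>v' v'' W'. W' = W \<and> ?I v'' \<and> ?m v'' < ?m v'"
  have loop: "wp w (Until (Tst f 1)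
       (Cond (Tst a x) (Cond (Tst b y) (zero f) (advance t a b)) (advance t a b))) Q (st 0) W"
  proof (rule wp_until[where I = ?I and m = ?m])
    fix v' assume "?I v'" "\<not> passes w (Tst f 1) v' W"
    then obtain n where n: "n \<le> N" "v' = st n"
      using assms(1) by (auto simp: st)
    have ex: "\<exists>m\<le>N. st (Suc n) = st m" if "n \<noteq> N"
      using n that by (intro exI[of _ "Suc n"]) auto
    have adv: "wp w (advance t a b) (?R v') v' W" if "n \<noteq> N"
      by (rule wp_advance) (use assms(1,2) n that ex in \<open>auto simp: st st_Suc\<close>)
    show "wp w (Cond (Tst a x) (Cond (Tst b y) (zero f) (advance t a b)) (advance t a b)) (?R v') v' W"
      by (intro wp_cond wp_copy adv) (use assms(1,2) n N[of n] in \<open>auto simp: st\<close>)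
  next
    fix v' assume *: "?I v'" "passes w (Tst f 1) v' W"
    then have "v' = (st N)(f := 0)" using assms(1) by (auto simp: st)
    then show "Q v' W" using assms(2) by (intro Q) (auto simp: st_def N_def)
  qed (use assms(1) in auto)
  have "st 0 = v(t := 0, a := 0, b := 0, f := 1)"
    by (simp add: st_def prod_decode_def prod_decode_aux.simps)
  with loop show ?thesis
    unfolding mkpair_def by (intro wp_seq wp_copy wp_inc) (use assms(1,2) in auto)
qed

section \<open>Evaluation of terms\<close>

datatype trm = TVar nat | TConst nat | TSuc trm | TPair trm trm

fun ev :: "(nat \<Rightarrow> nat) \<Rightarrow> trm \<Rightarrow> nat" where
  "ev \<rho> (TVar i) = \<rho> i"
| "ev \<rho> (TConst n) = n"
| "ev \<rho> (TSuc t) = Suc (ev \<rho> t)"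
| "ev \<rho> (TPair s t) = prod_encode (ev \<rho> s, ev \<rho> t)"

fun tvars :: "trm \<Rightarrow> nat set" where
  "tvars (TVar i) = {i}"
| "tvars (TConst n) = {}"
| "tvars (TSuc t) = tvars t"
| "tvars (TPair s t) = tvars s \<union> tvars t"

fun const_com :: "nat \<Rightarrow> nat \<Rightarrow> 'a com" where
  "const_com 0 d = zero d"
| "const_com (Suc n) d = Seq (const_com n d) (inc d)"

lemma wp_const: "1 < d \<Longrightarrow> Q (v(d := n)) W \<Longrightarrow> wp w (const_com n d) Q v W"
proof (induction n arbitrary: Q)
  case (Suc n)
  show ?case unfolding const_com.simps
    by (rule wp_seq, rule Suc.IH, rule Suc.prems, rule wp_inc)
      (simp_all only: fun_upd_same fun_upd_upd Suc.prems)
qed (auto intro: wp_copy)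

text \<open>Variable \<open>i\<close> lives in register \<open>i + 2\<close>, after the array and
  the constant zero. Everything from \<open>d\<close> on is scratch space; the second subterm is
  evaluated above \<open>d + 1\<close>, so that the value of the first survives.\<close>

fun eval_com :: "trm \<Rightarrow> nat \<Rightarrow> 'a com" where
  "eval_com (TVar i) d = copy d (i + 2)"
| "eval_com (TConst n) d = const_com n d"
| "eval_com (TSuc t) d = Seq (eval_com t d) (inc d)"
| "eval_com (TPair s t) d = Seq (eval_com s (d + 1)) (Seq (eval_com t (d + 2))
     (mkpair d (d + 1) (d + 2) (d + 3) (d + 4) (d + 5)))"

lemma wp_eval:
  assumes "tvars t \<subseteq> {..<k}" "k + 2 \<le> d" "\<forall>i<k. v (i + 2) = \<rho> i"
    and "\<And>v'. v' d = ev \<rho> t \<Longrightarrow> (\<forall>r<d. v' r = v r) \<Longrightarrow> Q v' W"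
  shows "wp w (eval_com t d) Q v W"
  using assms
proof (induction t arbitrary: d v Q)
  case (TVar i)
  then show ?case by (auto intro!: wp_copy)
next
  case (TConst n)
  then show ?case by (auto intro!: wp_const)
next
  case (TSuc t)
  show ?case unfolding eval_com.simps
  proof (rule wp_seq, rule TSuc.IH)
    fix v' assume "v' d = ev \<rho> t" "\<forall>r<d. v' r = v r"
    then show "wp w (inc d) Q v' W" using TSuc.prems by (intro wp_inc TSuc.prems) auto
  qed (use TSuc.prems in auto)
next
  case (TPair s t)
  show ?case unfolding eval_com.simps
  proof (rule wp_seq, rule TPair.IH(1))
    fix v1 assume 1: "v1 (d + 1) = ev \<rho> s" "\<forall>r<d + 1. v1 r = v r"
    show "wp w (Seq (eval_com t (d + 2)) (mkpair d (d + 1) (d + 2) (d + 3) (d + 4) (d + 5))) Q v1 W"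
    proof (rule wp_seq, rule TPair.IH(2))
      fix v2 assume 2: "v2 (d + 2) = ev \<rho> t" "\<forall>r<d + 2. v2 r = v1 r"
      show "wp w (mkpair d (d + 1) (d + 2) (d + 3) (d + 4) (d + 5)) Q v2 W"
      proof (rule wp_mkpair)
        fix v' assume "v' d = prod_encode (v2 (d + 1), v2 (d + 2))"
          "\<forall>r. r \<notin> {d, d + 3, d + 4, d + 5} \<longrightarrow> v' r = v2 r"
        then show "Q v' W" using 1 2 by (intro TPair.prems(4)) auto
      qed (use TPair.prems(2) in auto)
    qed (use TPair.prems 1 in auto)
  qed (use TPair.prems in auto)
qed

section \<open>Horn clauses over the natural numbers\<close>

datatype 'a prem = Fact trm | Neq trm trm | Letter trm "'a option"

type_synonym 'a rule = "'a prem list \<times> trm"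

fun side :: "'a list \<Rightarrow> (nat \<Rightarrow> nat) \<Rightarrow> 'a prem \<Rightarrow> bool" where
  "side w \<rho> (Fact t) \<longleftrightarrow> True"
| "side w \<rho> (Neq s t) \<longleftrightarrow> ev \<rho> s \<noteq> ev \<rho> t"
| "side w \<rho> (Letter t l) \<longleftrightarrow> letter_at w (ev \<rho> t) = l"

inductive_set derived :: "'a rule list \<Rightarrow> 'a list \<Rightarrow> nat set" for H w where
  derivedI: "(ps, t) \<in> set H \<Longrightarrow> (\<And>s. Fact s \<in> set ps \<Longrightarrow> ev \<rho> s \<in> derived H w) \<Longrightarrow>
     \<forall>p\<in>set ps. side w \<rho> p \<Longrightarrow> ev \<rho> t \<in> derived H w"

definition holds :: "'a list \<Rightarrow> (nat \<Rightarrow> nat) \<Rightarrow> nat set \<Rightarrow> 'a prem \<Rightarrow> bool" where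
  "holds w \<rho> W p \<longleftrightarrow> side w \<rho> p \<and> (case p of Fact t \<Rightarrow> ev \<rho> t \<in> W | _ \<Rightarrow> True)"

lemma holds_Fact [simp]: "holds w \<rho> W (Fact t) \<longleftrightarrow> ev \<rho> t \<in> W"
  by (simp add: holds_def)

lemma holds_side: "holds w \<rho> W p \<Longrightarrow> side w \<rho> p"
  by (simp add: holds_def)

definition fire :: "'a list \<Rightarrow> (nat \<Rightarrow> nat) \<Rightarrow> 'a rule \<Rightarrow> nat set \<Rightarrow> nat set" where
  "fire w \<rho> r W = (if \<forall>p\<in>set (fst r). holds w \<rho> W p then insert (ev \<rho> (snd r)) W else W)"

fun pvars :: "'a prem \<Rightarrow> nat set" where
  "pvars (Fact t) = tvars t"
| "pvars (Neq s t) = tvars s \<union> tvars t"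
| "pvars (Letter t l) = tvars t"

definition rule_vars :: "'a rule \<Rightarrow> nat set" where
  "rule_vars r = tvars (snd r) \<union> (\<Union>p\<in>set (fst r). pvars p)"

section \<open>Fair bottom-up evaluation in stages\<close>

definition coord :: "nat \<Rightarrow> nat \<Rightarrow> nat" where
  "coord n i = fst (prod_decode (((snd \<circ> prod_decode) ^^ i) n))"

text \<open>Coordinates beyond the first \<open>k\<close> are free, so every valuation is tried again and again.\<close>

lemma coord_surj: "\<exists>n\<ge>m. \<forall>i<k. coord n i = \<rho> i"
proof (induction k arbitrary: \<rho>)
  case (Suc k)
  from Suc.IH[of "\<lambda>i. \<rho> (Suc i)"] obtain n where n: "n \<ge> m" "\<forall>i<k. coord n i = \<rho> (Suc i)"
    by blast
  let ?n = "prod_encode (\<rho> 0, n)"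
  have "coord ?n (Suc i) = coord n i" for i by (simp add: coord_def funpow_Suc_right del: funpow.simps)
  moreover have "coord ?n 0 = \<rho> 0" by (simp add: coord_def)
  ultimately have "\<forall>i<Suc k. coord ?n i = \<rho> i" using n(2) by (auto simp: less_Suc_eq_0_disj)
  moreover have "n \<le> ?n" by (rule le_prod_encode_2)
  ultimately show ?case using n(1) by (meson le_trans)
qed auto

text \<open>A round tries every rule once under a single valuation, read off from the round number;
  later rules already see what earlier ones added.\<close>

fun stage :: "'a rule list \<Rightarrow> 'a list \<Rightarrow> nat \<Rightarrow> nat set" where
  "stage H w 0 = {}"
| "stage H w (Suc n) = fold (fire w (coord n)) H (stage H w n)"

lemma fire_mono: "W \<subseteq> fire w \<rho> r W"
  by (auto simp: fire_def)

lemma fold_fire_mono: "W \<subseteq> fold (fire w \<rho>) H W"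
proof (induction H arbitrary: W)
  case (Cons r H)
  then show ?case using order_trans[OF fire_mono Cons.IH] by simp
qed simp

lemma stage_mono: "m \<le> n \<Longrightarrow> stage H w m \<subseteq> stage H w n"
  by (rule lift_Suc_mono_le) (simp_all add: fold_fire_mono)

lemma holds_mono: "W \<subseteq> W' \<Longrightarrow> holds w \<rho> W p \<Longrightarrow> holds w \<rho> W' p"
  by (auto simp: holds_def split: prem.splits)

lemma fold_fire_complete:
  "r \<in> set H \<Longrightarrow> \<forall>p\<in>set (fst r). holds w \<rho> W p \<Longrightarrow> ev \<rho> (snd r) \<in> fold (fire w \<rho>) H W"
proof (induction H arbitrary: W)
  case (Cons r' H)
  show ?case
  proof (cases "r = r'")
    case True
    then have "ev \<rho> (snd r) \<in> fire w \<rho> r' W" using Cons.prems(2) by (simp add: fire_def)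
    then show ?thesis using fold_fire_mono[of "fire w \<rho> r' W" w \<rho> H] by auto
  next
    case False
    then show ?thesis using Cons.prems Cons.IH[of "fire w \<rho> r' W"]
      by (simp add: holds_mono[OF fire_mono[of W w \<rho> r']])
  qed
qed simp

lemma fold_fire_sound:
  "set H' \<subseteq> set H \<Longrightarrow> W \<subseteq> derived H w \<Longrightarrow> fold (fire w \<rho>) H' W \<subseteq> derived H w"
proof (induction H' arbitrary: W)
  case (Cons r H')
  obtain ps t where r: "r = (ps, t)" by fastforce
  have "fire w \<rho> r W \<subseteq> derived H w"
  proof (cases "\<forall>p\<in>set ps. holds w \<rho> W p")
    case True
    have "ev \<rho> t \<in> derived H w"
    proof (rule derivedI)
      show "(ps, t) \<in> set H" using Cons.prems r by simp
      show "ev \<rho> s \<in> derived H w" if "Fact s \<in> set ps" for s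
        using bspec[OF True that] Cons.prems(2) by auto
    qed (use True holds_side in blast)
    then show ?thesis using Cons.prems(2) r by (simp add: fire_def)
  next
    case False
    then show ?thesis using Cons.prems(2) r unfolding fire_def by auto
  qed
  then show ?case using Cons by simp
qed simp

lemma stage_sound: "stage H w n \<subseteq> derived H w"
  by (induction n) (simp_all add: fold_fire_sound)

lemma ev_cong: "(\<And>i. i \<in> tvars t \<Longrightarrow> \<rho> i = \<rho>' i) \<Longrightarrow> ev \<rho> t = ev \<rho>' t"
  by (induction t) auto

lemma holds_cong: "(\<And>i. i \<in> pvars p \<Longrightarrow> \<rho> i = \<rho>' i) \<Longrightarrow> holds w \<rho> W p = holds w \<rho>' W p"
  using ev_cong[of _ \<rho> \<rho>'] by (cases p) (auto simp: holds_def)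

text \<open>The finitely many premises of a rule instance are all present at some stage, and the
  valuation needed recurs after that stage. The bound \<open>k\<close> is essential, as only
  finitely many coordinates of a round number can be prescribed.\<close>

lemma derived_stage:
  assumes k: "\<forall>r\<in>set H. rule_vars r \<subseteq> {..<k}"
  shows "derived H w = (\<Union>n. stage H w n)"
proof
  show "derived H w \<subseteq> (\<Union>n. stage H w n)"
  proof
    fix x assume "x \<in> derived H w"
    then show "x \<in> (\<Union>n. stage H w n)"
    proof induction
      case (derivedI ps t \<rho>)
      have "\<exists>n. \<forall>p\<in>set qs. holds w \<rho> (stage H w n) p" if "set qs \<subseteq> set ps" for qs
        using that
      proof (induction qs)
        case (Cons q qs)
        then obtain n where n: "\<forall>p\<in>set qs. holds w \<rho> (stage H w n) p" by auto
        obtain n' where n': "holds w \<rho> (stage H w n') q"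
        proof (cases q)
          case (Fact s)
          then show ?thesis using derivedI.IH[of s] Cons.prems that by auto
        qed (use derivedI.hyps Cons.prems that in \<open>auto simp: holds_def\<close>)
        have "holds w \<rho> (stage H w (max n n')) p" if "p \<in> set (q # qs)" for p
          using that n n'
          by (auto intro: holds_mono[OF stage_mono[of n "max n n'"]]
              holds_mono[OF stage_mono[of n' "max n n'"]])
        then show ?case by blast
      qed simp
      then obtain n where n: "\<forall>p\<in>set ps. holds w \<rho> (stage H w n) p" by blast
      obtain m where m: "m \<ge> n" "\<forall>i<k. coord m i = \<rho> i" using coord_surj by blast
      have kv: "i < k" if "i \<in> rule_vars (ps, t)" for i using that k derivedI(1) by auto
      have "\<forall>p\<in>set ps. holds w (coord m) (stage H w m) p"
      proof
        fix p assume p: "p \<in> set ps"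
        have "holds w \<rho> (stage H w m) p" using n p holds_mono[OF stage_mono[OF m(1)]] by blast
        moreover have "coord m i = \<rho> i" if "i \<in> pvars p" for i
          using that p kv m(2) by (auto simp: rule_vars_def)
        ultimately show "holds w (coord m) (stage H w m) p" using holds_cong[of p "coord m" \<rho>] by simp
      qed
      then have "ev (coord m) t \<in> stage H w (Suc m)"
        using fold_fire_complete[OF derivedI(1)] by simp
      moreover have "ev (coord m) t = ev \<rho> t"
        by (rule ev_cong) (use kv m(2) in \<open>auto simp: rule_vars_def\<close>)
      ultimately show ?case by (metis UN_I UNIV_I)
    qed
  qed
qed (use stage_sound in blast)

section \<open>Programs that evaluate Horn clauses\<close>

fun check_com :: "nat \<Rightarrow> trm \<Rightarrow> 'a prem list \<Rightarrow> 'a com" where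
  "check_com d t [] = Seq (eval_com t d) (Do (Put d 0))"
| "check_com d t (Fact s # ps) = Seq (eval_com s d) (Cond (Tst d 0) (check_com d t ps) (zero d))"
| "check_com d t (Neq s s' # ps) = Seq (eval_com s d) (Seq (eval_com s' (d + 1))
     (Cond (Tst d (d + 1)) (zero d) (check_com d t ps)))"
| "check_com d t (Letter s l # ps) = Seq (eval_com s d) (Cond (TstLetter d l) (check_com d t ps) (zero d))"

text \<open>Premises are tested in order, and the first failure ends the check. There
  \<open>zero d\<close> only overwrites scratch space: it plays the part of a command that does
  nothing.\<close>

lemma wp_check:
  assumes "tvars t \<subseteq> {..<k}" "\<forall>p\<in>set ps. pvars p \<subseteq> {..<k}" "k + 2 \<le> d" "\<forall>i<k. v (i + 2) = \<rho> i"
    and "\<And>v'. (\<forall>r<d. v' r = v r) \<Longrightarrow>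
      Q v' (if \<forall>p\<in>set ps. holds w \<rho> W p then insert (ev \<rho> t) W else W)"
  shows "wp w (check_com d t ps) Q v W"
  using assms(2,4,5)
proof (induction ps arbitrary: v)
  case Nil
  show ?case unfolding check_com.simps
    by (rule wp_seq, rule wp_eval[OF assms(1,3) Nil(2)], rule wp_collect)
      (use assms(3) Nil(3) in auto)
next
  case (Cons p ps)
  have pv: "pvars p \<subseteq> {..<k}" "\<forall>p\<in>set ps. pvars p \<subseteq> {..<k}" using Cons.prems(1) by auto
  have go: "wp w (check_com d t ps) Q v' W" if "\<forall>r<d. v' r = v r" "holds w \<rho> W p" for v'
    by (rule Cons.IH) (use pv that Cons.prems(2,3) assms(3) in auto)
  have stop: "wp w (zero d) Q v' W" if "\<forall>r<d. v' r = v r" "\<not> holds w \<rho> W p" for v'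
  proof (rule wp_copy)
    have "Q (v'(d := 0)) (if \<forall>q\<in>set (p # ps). holds w \<rho> W q then insert (ev \<rho> t) W else W)"
      by (rule Cons.prems(3)) (use that in auto)
    moreover have "\<not> (\<forall>q\<in>set (p # ps). holds w \<rho> W q)" using that(2) by simp
    ultimately have "Q (v'(d := 0)) W" by (simp only: if_False)
    then show "Q (v'(d := reg v' 1)) W" by (simp only: reg_simps One_nat_def)
  qed (use assms(3) in auto)
  show ?case
  proof (cases p)
    case (Fact s)
    show ?thesis unfolding check_com.simps Fact
      by (rule wp_seq, rule wp_eval[OF _ assms(3) Cons.prems(2)], use pv Fact in simp, rule wp_cond)
        (use assms(3) in \<open>auto intro!: go stop simp: holds_def Fact simp del: One_nat_def\<close>)
  next
    case (Letter s l)
    show ?thesis unfolding check_com.simps Letter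
      by (rule wp_seq, rule wp_eval[OF _ assms(3) Cons.prems(2)], use pv Letter in simp, rule wp_cond)
        (use assms(3) in \<open>auto intro!: go stop simp: holds_def Letter simp del: One_nat_def\<close>)
  next
    case (Neq s s')
    show ?thesis unfolding check_com.simps Neq
    proof (rule wp_seq, rule wp_eval[OF _ assms(3) Cons.prems(2)])
      fix v1 assume v1: "v1 d = ev \<rho> s" "\<forall>r<d. v1 r = v r"
      have v1r: "\<forall>i<k. v1 (i + 2) = \<rho> i" using v1(2) Cons.prems(2) assms(3) by auto
      show "wp w (Seq (eval_com s' (d + 1)) (Cond (Tst d (d + 1)) (zero d) (check_com d t ps))) Q v1 W"
      proof (rule wp_seq, rule wp_eval[OF _ _ v1r])
        fix v2 assume v2: "v2 (d + 1) = ev \<rho> s'" "\<forall>r<d + 1. v2 r = v1 r"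
        show "wp w (Cond (Tst d (d + 1)) (zero d) (check_com d t ps)) Q v2 W"
          by (rule wp_cond) (use assms(3) v1 v2 in \<open>auto intro!: go stop simp: holds_def Neq simp del: One_nat_def\<close>)
      qed (use pv Neq assms(3) in auto)
    qed (use pv Neq in auto)
  qed
qed

fun rules_com :: "nat \<Rightarrow> 'a rule list \<Rightarrow> 'a com" where
  "rules_com d [] = zero d"
| "rules_com d (r # H) = Seq (check_com d (snd r) (fst r)) (rules_com d H)"

lemma wp_rules:
  assumes "\<forall>r\<in>set H. rule_vars r \<subseteq> {..<k}" "k + 2 \<le> d" "\<forall>i<k. v (i + 2) = \<rho> i"
    and "\<And>v'. (\<forall>r<d. v' r = v r) \<Longrightarrow> Q v' (fold (fire w \<rho>) H W)"
  shows "wp w (rules_com d H) Q v W"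
  using assms(1,3,4)
proof (induction H arbitrary: v W)
  case Nil
  then show ?case using assms(2) by (auto intro!: wp_copy)
next
  case (Cons r H)
  show ?case unfolding rules_com.simps
  proof (rule wp_seq, rule wp_check[OF _ _ assms(2) Cons.prems(2)])
    fix v1 assume v1: "\<forall>q<d. v1 q = v q"
    show "wp w (rules_com d H) Q v1
        (if \<forall>p\<in>set (fst r). holds w \<rho> W p then insert (ev \<rho> (snd r)) W else W)"
      unfolding fire_def[symmetric]
      by (rule Cons.IH) (use Cons.prems v1 assms(2) in auto)
  qed (use Cons.prems(1) in \<open>auto simp: rule_vars_def\<close>)
qed

text \<open>Register \<open>d\<close> holds the part of the number not decoded yet; each step splits
  off its head into the next variable register.\<close>

fun coords_com :: "nat \<Rightarrow> nat \<Rightarrow> nat \<Rightarrow> 'a com" where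
  "coords_com s d 0 = copy d s"
| "coords_com s d (Suc i) =
     Seq (coords_com s d i) (Seq (unpair d (i + 2) (d + 1) (d + 2)) (copy d (d + 1)))"

lemma wp_coords:
  assumes "k + 2 \<le> s" "s < d"
    and "\<And>v'. v' d = ((snd \<circ> prod_decode) ^^ k) (v s) \<Longrightarrow> \<forall>i<k. v' (i + 2) = coord (v s) i \<Longrightarrow>
      (\<forall>r<d. k + 2 \<le> r \<longrightarrow> v' r = v r) \<Longrightarrow> Q v' W"
  shows "wp w (coords_com s d k) Q v W"
  using assms(1,3)
proof (induction k arbitrary: Q)
  case 0
  then show ?case using assms(2) by (auto intro!: wp_copy)
next
  case (Suc k)
  show ?case unfolding coords_com.simps
  proof (rule wp_seq, rule Suc.IH)
    fix v1 assume v1: "v1 d = ((snd \<circ> prod_decode) ^^ k) (v s)" "\<forall>i<k. v1 (i + 2) = coord (v s) i"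
      "\<forall>r<d. k + 2 \<le> r \<longrightarrow> v1 r = v r"
    show "wp w (Seq (unpair d (k + 2) (d + 1) (d + 2)) (copy d (d + 1))) Q v1 W"
    proof (rule wp_seq, rule wp_unpair, goal_cases)
      case 6
      show ?case
        by (rule wp_copy) (use Suc.prems(1) assms(2) v1 in
          \<open>auto intro!: Suc.prems(2) simp: less_Suc_eq coord_def comp_def\<close>)
    qed (use Suc.prems(1) assms(2) in auto)
  qed (use Suc.prems in auto)
qed

text \<open>Register layout: \<open>2, \<dots>, k + 1\<close> hold the rule variables, \<open>k + 2\<close> the round
  number, \<open>k + 3\<close> is zero once a verdict has been reached.\<close>

definition probe_com :: "nat \<Rightarrow> nat \<Rightarrow> 'a com" where
  "probe_com k x = Seq (const_com x (k + 4)) (Cond (Tst (k + 4) 0) (zero (k + 3)) (zero (k + 4)))"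

lemma wp_probe:
  assumes "\<And>v'. (\<forall>r<k + 3. v' r = v r) \<Longrightarrow> v' (k + 3) = (if x \<in> W then 0 else v (k + 3)) \<Longrightarrow> Q v' W"
  shows "wp w (probe_com k x) Q v W"
  unfolding probe_com_def
  by (rule wp_seq, rule wp_const, simp, rule wp_cond)
    (auto intro!: wp_copy assms simp: reg_def simp del: One_nat_def)

definition round_com :: "nat \<Rightarrow> 'a rule list \<Rightarrow> nat \<Rightarrow> nat \<Rightarrow> 'a com" where
  "round_com k H x y = Seq (coords_com (k + 2) (k + 4) k) (Seq (rules_com (k + 4) H)
     (Seq (probe_com k x) (Seq (probe_com k y) (inc (k + 2)))))"

lemma wp_round:
  assumes "\<forall>r\<in>set H. rule_vars r \<subseteq> {..<k}"
  shows "wp w (round_com k H x y) (\<lambda>v' W'. W' = fold (fire w (coord (v (k + 2)))) H W \<and>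
    v' (k + 2) = Suc (v (k + 2)) \<and> v' (k + 3) = (if x \<in> W' \<or> y \<in> W' then 0 else v (k + 3))) v W"
  unfolding round_com_def
proof (rule wp_seq, rule wp_coords, simp, simp)
  fix v1
  assume v1: "\<forall>i<k. v1 (i + 2) = coord (v (k + 2)) i" "\<forall>r<k + 4. k + 2 \<le> r \<longrightarrow> v1 r = v r"
  let ?Q = "\<lambda>v' W'. W' = fold (fire w (coord (v (k + 2)))) H W \<and>
    v' (k + 2) = Suc (v (k + 2)) \<and> v' (k + 3) = (if x \<in> W' \<or> y \<in> W' then 0 else v (k + 3))"
  show "wp w (Seq (rules_com (k + 4) H) (Seq (probe_com k x) (Seq (probe_com k y) (inc (k + 2))))) ?Q v1 W"
  proof (rule wp_seq, rule wp_rules[OF assms _ v1(1)], simp)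
    fix v2 assume v2: "\<forall>r<k + 4. v2 r = v1 r"
    let ?W = "fold (fire w (coord (v (k + 2)))) H W"
    show "wp w (Seq (probe_com k x) (Seq (probe_com k y) (inc (k + 2)))) ?Q v2 ?W"
    proof (rule wp_seq, rule wp_probe)
      fix v3 assume v3: "\<forall>r<k + 3. v3 r = v2 r" "v3 (k + 3) = (if x \<in> ?W then 0 else v2 (k + 3))"
      show "wp w (Seq (probe_com k y) (inc (k + 2))) ?Q v3 ?W"
      proof (rule wp_seq, rule wp_probe)
        fix v4 assume v4: "\<forall>r<k + 3. v4 r = v3 r" "v4 (k + 3) = (if y \<in> ?W then 0 else v3 (k + 3))"
        show "wp w (inc (k + 2)) ?Q v4 ?W"
          by (rule wp_inc) (use v1(2) v2 v3 v4 in auto)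
      qed
    qed
  qed
qed

text \<open>The loop compares register \<open>k + 3\<close> with mark 1, that is, with zero; it is
  raised to 1 beforehand so that the search begins. Afterwards the bit of \<open>x\<close> decides
  between the emptied stack, which accepts, and \<open>Stop\<close>, which rejects;
  \<open>zero (k + 4)\<close> is a filler.\<close>

definition search_com :: "nat \<Rightarrow> 'a rule list \<Rightarrow> nat \<Rightarrow> nat \<Rightarrow> 'a com" where
  "search_com k H x y = Seq (inc (k + 3)) (Seq (Until (Tst (k + 3) 1) (round_com k H x y))
     (Seq (const_com x (k + 4)) (Cond (Tst (k + 4) 0) (zero (k + 4)) Stop)))"

text \<open>The joint search is correct because of \<open>excl\<close>: if it ends with
  \<open>x\<close> absent, it was ended by \<open>y\<close>, and then \<open>x\<close> cannot be
  derived at any later stage either.\<close>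

theorem semidecision_machine:
  fixes H :: "'a::finite rule list"
  assumes excl: "\<And>w. \<not> (x \<in> derived H w \<and> y \<in> derived H w)"
  shows "\<exists>M. turing_machine M \<and> (\<forall>w. tm_accepts M w \<longleftrightarrow> x \<in> derived H w) \<and>
    (\<forall>w. tm_rejects M w \<longleftrightarrow> y \<in> derived H w)"
proof -
  have fin: "finite (tvars t)" for t by (induction t) auto
  then have "finite (pvars p)" for p :: "'a prem" by (cases p) auto
  then have "finite (\<Union>r\<in>set H. rule_vars r)" using fin by (simp add: rule_vars_def)
  then obtain k where "(\<Union>r\<in>set H. rule_vars r) \<subseteq> {..<k}"
    using finite_nat_bounded by blast
  then have vars: "\<forall>r\<in>set H. rule_vars r \<subseteq> {..<k}" by blast
  define prog where "prog = search_com k H x y"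
  obtain m where "com_marks prog \<subseteq> {..<m}" using finite_com_marks finite_nat_bounded by blast
  then interpret simulator prog "max m 2" by unfold_locales auto
  have start: "start_marking = rep (\<lambda>_. 0) {}"
    by (auto simp: start_marking_def rep_def fun_eq_iff)
  define tail :: "'a com" where "tail = Seq (const_com x (k + 4)) (Cond (Tst (k + 4) 0) (zero (k + 4)) Stop)"
  define loop :: "'a com" where "loop = Until (Tst (k + 3) 1) (round_com k H x y)"
  have prog: "prog = Seq (inc (k + 3)) (Seq loop tail)"
    by (simp add: prog_def search_com_def loop_def tail_def)
  have "tm_accepts machine w \<longleftrightarrow> x \<in> derived H w" "tm_rejects machine w \<longleftrightarrow> y \<in> derived H w" for w
  proof -
    define won where "won n \<longleftrightarrow> x \<in> stage H w n \<or> y \<in> stage H w n" for n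
    \<comment> \<open>The loop test is due after \<open>n\<close> complete rounds. Following the
      loop round by round replaces a loop rule, which would presuppose termination.\<close>
    define at where "at n z \<longleftrightarrow> (\<exists>v. z = ([loop, tail], rep v (stage H w n)) \<and> v (k + 2) = n \<and>
      v (k + 3) = (if won n then 0 else 1))" for n z
    have "(mstep w)\<^sup>*\<^sup>* ([prog], start_marking) ([loop, tail], rep ((\<lambda>_. 0)(k + 3 := 1)) {})"
    proof -
      note r = converse_rtranclp_into_rtranclp[of "mstep w"]
      have 1: "mstep w ([prog], start_marking) ([inc (k + 3), Seq loop tail], start_marking)"
        by (rule mstepI) (auto simp: prog start rep_nonempty)
      have 2: "mstep w ([inc (k + 3), Seq loop tail], start_marking)
          ([Seq loop tail], rep ((\<lambda>_. 0)(k + 3 := 1)) {})"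
        by (rule mstepI) (auto simp: start rep_nonempty rep_def fun_eq_iff)
      have 3: "mstep w ([Seq loop tail], rep ((\<lambda>_. 0)(k + 3 := 1)) {})
          ([loop, tail], rep ((\<lambda>_. 0)(k + 3 := 1)) {})"
        by (rule mstepI) (auto simp: rep_nonempty)
      show ?thesis by (rule r[OF 1 r[OF 2 r[OF 3 rtranclp.rtrancl_refl]]])
    qed
    moreover have "at 0 ([loop, tail], rep ((\<lambda>_. 0)(k + 3 := 1)) {})"
      unfolding at_def won_def by (intro exI[of _ "(\<lambda>_. 0)(k + 3 := 1)"]) auto
    ultimately obtain z0 where z0: "(mstep w)\<^sup>*\<^sup>* ([prog], start_marking) z0" "at 0 z0" by blast
    have round: "\<exists>z'. (mstep w)\<^sup>+\<^sup>+ z z' \<and> at (Suc n) z'" if z: "at n z" "\<not> won n" for n z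
    proof -
      obtain v where v: "z = ([loop, tail], rep v (stage H w n))" "v (k + 2) = n" "v (k + 3) = 1"
        using z by (auto simp: at_def)
      have "mstep w z ([round_com k H x y, loop, tail], rep v (stage H w n))"
        unfolding v(1) by (rule mstepI) (use v(3) in \<open>auto simp: loop_def rep_nonempty rep_def\<close>)
      moreover have "wp w (round_com k H x y) (\<lambda>v' W'. W' = stage H w (Suc n) \<and>
          v' (k + 2) = Suc n \<and> v' (k + 3) = (if won (Suc n) then 0 else 1)) v (stage H w n)"
        by (rule wp_mono[OF wp_round[OF vars]], elim conjE) (simp only: won_def stage.simps v(2,3))
      then obtain v' where "(mstep w)\<^sup>*\<^sup>* ([round_com k H x y, loop, tail], rep v (stage H w n))
          ([loop, tail], rep v' (stage H w (Suc n)))" "v' (k + 2) = Suc n"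
          "v' (k + 3) = (if won (Suc n) then 0 else 1)"
        unfolding wp_def by blast
      ultimately show ?thesis unfolding at_def by (blast intro: rtranclp_into_tranclp2)
    qed
    have halted: "tm_accepts machine w \<longleftrightarrow> x \<in> stage H w n" "tm_rejects machine w \<longleftrightarrow> x \<notin> stage H w n"
      if n: "won n" "\<And>i. i < n \<Longrightarrow> \<not> won i" for n
    proof -
      have reach: "i \<le> n \<Longrightarrow> \<exists>z. (mstep w)\<^sup>*\<^sup>* z0 z \<and> at i z" for i
      proof (induction i)
        case (Suc i)
        then obtain z where "(mstep w)\<^sup>*\<^sup>* z0 z" "at i z" by auto
        then show ?case using round[of i z] n(2)[of i] Suc.prems
          by (meson Suc_le_lessD rtranclp_trans tranclp_into_rtranclp)
      qed (use z0 in blast)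
      from reach[of n] obtain v where v: "(mstep w)\<^sup>*\<^sup>* z0 ([loop, tail], rep v (stage H w n))" "v (k + 3) = 0"
        using n(1) unfolding at_def by auto
      let ?b = "x \<in> stage H w n"
      let ?W = "stage H w n"
      have exit: "mstep w ([loop, tail], rep v ?W) ([tail], rep v ?W)"
        by (rule mstepI) (use v(2) in \<open>auto simp: loop_def rep_nonempty rep_def\<close>)
      obtain S K where SK: "(mstep w)\<^sup>*\<^sup>* ([tail], rep v ?W) (K, S)" "act_of K = None" "K = [] \<longleftrightarrow> ?b"
      proof -
        let ?c = "Cond (Tst (k + 4) 0) (zero (k + 4)) Stop"
        have 1: "mstep w ([tail], rep v ?W) ([const_com x (k + 4), ?c], rep v ?W)"
          by (rule mstepI) (auto simp: tail_def rep_nonempty)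
        have "wp w (const_com x (k + 4)) (\<lambda>v' W'. W' = ?W \<and> v' (k + 4) = x) v ?W"
          by (rule wp_const) auto
        then obtain v1 where 2: "(mstep w)\<^sup>*\<^sup>* ([const_com x (k + 4), ?c], rep v ?W) ([?c], rep v1 ?W)"
          "v1 (k + 4) = x" unfolding wp_def by blast
        have 3: "mstep w ([?c], rep v1 ?W) ([if ?b then zero (k + 4) else Stop], rep v1 ?W)"
          by (rule mstepI) (use 2(2) in \<open>auto simp: rep_nonempty rep_def[of _ _ 0]\<close>)
        note r = rtranclp.rtrancl_into_rtrancl[of "mstep w"]
        have 4: "(mstep w)\<^sup>*\<^sup>* ([tail], rep v ?W) ([if ?b then zero (k + 4) else Stop], rep v1 ?W)"
          using 3 converse_rtranclp_into_rtranclp[of "mstep w", OF 1 2(1)] by (rule r[rotated])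
        show ?thesis
        proof (cases ?b)
          case True
          have "wp w (zero (k + 4)) (\<lambda>v' W'. True) v1 ?W" by (rule wp_copy) auto
          then obtain S where "(mstep w)\<^sup>*\<^sup>* ([zero (k + 4)], rep v1 ?W) ([], S)"
            unfolding wp_def by blast
          then show ?thesis using that[of "[]" S] 4 True by (auto intro: rtranclp_trans)
        next
          case False
          then show ?thesis using that[of "[Stop]" "rep v1 ?W"] 4 by auto
        qed
      qed
      have "(mstep w)\<^sup>*\<^sup>* ([prog], start_marking) (K, S)"
        using z0(1) v(1) exit SK(1) by (meson converse_rtranclp_into_rtranclp rtranclp_trans)
      from machine_halts[OF this SK(2)] SK(3)
      show "tm_accepts machine w \<longleftrightarrow> ?b" "tm_rejects machine w \<longleftrightarrow> \<not> ?b" by auto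
    qed
    have der: "derived H w = (\<Union>n. stage H w n)" by (rule derived_stage[OF vars])
    show "tm_accepts machine w \<longleftrightarrow> x \<in> derived H w" "tm_rejects machine w \<longleftrightarrow> y \<in> derived H w"
    proof -
      consider n where "won n" "\<And>i. i < n \<Longrightarrow> \<not> won i" | "\<And>n. \<not> won n"
        using exists_least_iff[of won] by blast
      then have "(tm_accepts machine w \<longleftrightarrow> x \<in> derived H w) \<and> (tm_rejects machine w \<longleftrightarrow> y \<in> derived H w)"
      proof cases
        case 1
        then show ?thesis using halted[OF 1] excl[of w] der by (auto simp: won_def)
      next
        case 2
        have "\<not> tm_accepts machine w" "\<not> tm_rejects machine w"
          using machine_diverges[OF z0(1), of "\<lambda>z. \<exists>n. at n z"] z0(2) round 2 by blast+
        then show ?thesis using der 2 by (auto simp: won_def)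
      qed
      then show "tm_accepts machine w \<longleftrightarrow> x \<in> derived H w" "tm_rejects machine w \<longleftrightarrow> y \<in> derived H w"
        by auto
    qed
  qed
  then show ?thesis using turing_machine_machine by blast
qed

section \<open>Determining the winner\<close>

text \<open>One round from the point of view of \<open>pl\<close>, with the rest of the game
  abstracted into \<open>X\<close>. Thus a round can be compared with the clauses before any fixed
  point is taken.\<close>

definition force ::
    "('p \<Rightarrow> 'p set) \<Rightarrow> ('p \<Rightarrow> player) \<Rightarrow> ('p \<Rightarrow> player) \<Rightarrow> player \<Rightarrow> ('p \<Rightarrow> bool) \<Rightarrow> 'p \<Rightarrow> bool" where
  "force mv tn wn pl X p \<longleftrightarrow>
     (if mv p = {} then wn p = pl else if tn p = pl then \<exists>q\<in>mv p. X q else \<forall>q\<in>mv p. X q)"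

lemma force_mono [mono]: "X \<le> Y \<Longrightarrow> force mv tn wn pl X p \<longrightarrow> force mv tn wn pl Y p"
  by (auto simp: force_def)

inductive wins ::
    "('p \<Rightarrow> 'p set) \<Rightarrow> ('p \<Rightarrow> player) \<Rightarrow> ('p \<Rightarrow> player) \<Rightarrow> player \<Rightarrow> 'p \<Rightarrow> bool"
  for mv tn wn pl where
  winsI: "force mv tn wn pl (wins mv tn wn pl) p \<Longrightarrow> wins mv tn wn pl p"

lemma wins_iff: "wins mv tn wn pl p \<longleftrightarrow> force mv tn wn pl (wins mv tn wn pl) p"
  by (auto elim: wins.cases intro: winsI)

lemma play_prefix_hd: "play_prefix mv tn pl s p h \<Longrightarrow> h \<noteq> [] \<and> hd h = p"
  by (induction rule: play_prefix.induct) auto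

text \<open>Prepares the gluing of strategies: by the assumption, after a first move to
  \<open>q\<close> the strategy \<open>s\<close> forgets the starting position and follows
  \<open>t q\<close>.\<close>

lemma play_prefix_tl:
  assumes "\<And>h. length h > 1 \<Longrightarrow> s h = t (h ! 1) (tl h)"
  shows "play_prefix mv tn pl s p h \<Longrightarrow> h = [p] \<or> (\<exists>q h'. h = p # h' \<and> q \<in> mv p \<and>
    (tn p = pl \<longrightarrow> q = s [p]) \<and> play_prefix mv tn pl (t q) q h')"
proof (induction rule: play_prefix.induct)
  case (step h q)
  show ?case
  proof (cases "h = [p]")
    case True
    then show ?thesis using step.hyps by (auto intro: play_prefix.start)
  next
    case False
    then obtain q1 h' where h': "h = p # h'" "q1 \<in> mv p" "tn p = pl \<longrightarrow> q1 = s [p]"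
      "play_prefix mv tn pl (t q1) q1 h'" using step.IH by blast
    have ne: "h' \<noteq> []" "hd h' = q1" using play_prefix_hd[OF h'(4)] by auto
    then have "h ! 1 = q1" "length h > 1" using h'(1) by (auto simp: hd_conv_nth)
    then have "s h = t q1 h'" using assms[of h] h'(1) by simp
    then have "play_prefix mv tn pl (t q1) q1 (h' @ [q])"
      using play_prefix.step[OF h'(4)] step.hyps(2,3) h'(1) ne by simp
    then show ?thesis using h' by auto
  qed
qed simp

text \<open>Strategies for the won successors are glued: if \<open>pl\<close> is to move, the first
  move goes to a won successor, and from then on the strategy chosen for the position reached is
  followed.\<close>

lemma wins_imp_strategy:
  "wins mv tn wn pl p \<Longrightarrow> \<exists>s. winning_strategy mv tn wn pl p s"
proof (induction rule: wins.induct)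
  case (winsI p)
  define X where "X q \<longleftrightarrow> (\<exists>s. winning_strategy mv tn wn pl q s)" for q
  have f: "force mv tn wn pl X p" 
    by (rule force_mono[rule_format, OF _ winsI]) (auto simp: X_def)
  obtain q0 where q0: "mv p \<noteq> {} \<Longrightarrow> tn p = pl \<Longrightarrow> q0 \<in> mv p \<and> X q0"
    using f by (auto simp: force_def split: if_splits)
  define t where "t q = (SOME s. winning_strategy mv tn wn pl q s)" for q
  have t: "X q \<Longrightarrow> winning_strategy mv tn wn pl q (t q)" for q
    unfolding X_def t_def by (erule exE, erule someI[of "winning_strategy mv tn wn pl q"])
  define s where "s h = (if length h > 1 then t (h ! 1) (tl h) else q0)" for h
  have good: "winning_strategy mv tn wn pl q (t q)" if "q \<in> mv p" "tn p = pl \<longrightarrow> q = s [p]" for q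
    using f q0 that t by (auto simp: force_def s_def split: if_splits)
  have split: "h = [p] \<or> (\<exists>q h'. h = p # h' \<and> winning_strategy mv tn wn pl q (t q) \<and> h' \<noteq> [] \<and>
      play_prefix mv tn pl (t q) q h' \<and> hd h' = q)" if "play_prefix mv tn pl s p h" for h
    using play_prefix_tl[of s t, OF _ that] good play_prefix_hd by (fastforce simp: s_def)
  have "winning_strategy mv tn wn pl p s"
    unfolding winning_strategy_def
  proof (intro conjI allI impI)
    fix h assume h: "play_prefix mv tn pl s p h \<and> tn (last h) = pl \<and> mv (last h) \<noteq> {}"
    consider "h = [p]" | q h' where "h = p # h'" "winning_strategy mv tn wn pl q (t q)" "h' \<noteq> []"
        "play_prefix mv tn pl (t q) q h'" "hd h' = q" using split h by blast
    then show "s h \<in> mv (last h)"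
    proof cases
      case (2 q h')
      then have "s h = t q h'" by (auto simp: s_def hd_conv_nth)
      then show ?thesis using 2 h unfolding winning_strategy_def by auto
    qed (use q0 h in \<open>auto simp: s_def\<close>)
  next
    fix h assume h: "play_prefix mv tn pl s p h \<and> mv (last h) = {}"
    consider "h = [p]" | q h' where "h = p # h'" "winning_strategy mv tn wn pl q (t q)" "h' \<noteq> []"
        "play_prefix mv tn pl (t q) q h'" using split h by blast
    then show "wn (last h) = pl"
    proof cases
      case (2 q h')
      then show ?thesis using h unfolding winning_strategy_def by auto
    qed (use f h in \<open>auto simp: force_def\<close>)
  next
    show "\<nexists>\<pi>. \<forall>n. play_prefix mv tn pl s p (map \<pi> [0..<Suc n])"
    proof
      assume "\<exists>\<pi>. \<forall>n. play_prefix mv tn pl s p (map \<pi> [0..<Suc n])"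
      then obtain \<pi> where \<pi>: "\<And>n. play_prefix mv tn pl s p (map \<pi> [0..<Suc n])" by blast
      have up: "map \<pi> [0..<Suc (Suc n)] = \<pi> 0 # map (\<lambda>i. \<pi> (Suc i)) [0..<Suc n]" for n
        by (simp add: upt_conv_Cons map_Suc_upt[symmetric] del: upt_Suc)
      \<comment> \<open>The conjunct \<open>q = \<pi> 1\<close> makes the strategy the same for all
        \<open>n\<close>, so that this one strategy would admit an infinite play.\<close>
      have "\<exists>q. winning_strategy mv tn wn pl q (t q) \<and>
          play_prefix mv tn pl (t q) q (map (\<lambda>i. \<pi> (Suc i)) [0..<Suc n]) \<and> q = \<pi> 1" for n
        using split[OF \<pi>[of "Suc n"]] unfolding up by (auto simp: upt_conv_Cons simp del: upt_Suc)
      then show False unfolding winning_strategy_def by metis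
    qed
  qed
  then show ?case by blast
qed

text \<open>From outside \<open>wins\<close>, play according to \<open>s\<close> can be kept
  outside: a final position reached under a winning strategy lies in \<open>wins\<close>, so there
  is always a next move. The result is an infinite play, which a winning strategy excludes.\<close>

lemma strategy_imp_wins:
  assumes "winning_strategy mv tn wn pl p s"
  shows "wins mv tn wn pl p"
proof (rule ccontr)
  let ?bad = "\<lambda>h. play_prefix mv tn pl s p h \<and> \<not> wins mv tn wn pl (last h)"
  assume "\<not> wins mv tn wn pl p"
  then have 0: "?bad [p]" by (simp add: play_prefix.start)
  have "\<exists>q. ?bad (h @ [q])" if h: "?bad h" for h
  proof -
    have nf: "\<not> force mv tn wn pl (wins mv tn wn pl) (last h)"
      using h winsI[of mv tn wn pl "last h"] by argo
    have ne: "mv (last h) \<noteq> {}"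
      using nf h assms by (auto simp: force_def winning_strategy_def)
    show ?thesis
    proof (cases "tn (last h) = pl")
      case True
      then have "s h \<in> mv (last h)" using assms h ne by (auto simp: winning_strategy_def)
      then show ?thesis using nf ne True h
        by (intro exI[of _ "s h"]) (auto simp: force_def intro: play_prefix.step)
    next
      case False
      then obtain q where "q \<in> mv (last h)" "\<not> wins mv tn wn pl q"
        using nf ne by (auto simp: force_def)
      then show ?thesis using False h by (intro exI[of _ q]) (auto intro: play_prefix.step)
    qed
  qed
  then obtain nx where nx: "?bad h \<Longrightarrow> ?bad (h @ [nx h])" for h by metis
  define f where "f n = ((\<lambda>h. h @ [nx h]) ^^ n) [p]" for n
  have f: "?bad (f n)" for n
    by (induction n) (use 0 nx in \<open>auto simp: f_def simp del: last_snoc\<close>)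
  \<comment> \<open>The histories \<open>f n\<close> extend one another, so they are the prefixes of
    the sequence of their last entries.\<close>
  have "map (\<lambda>i. last (f i)) [0..<Suc n] = f n" for n
    by (induction n) (auto simp: f_def)
  then have "play_prefix mv tn pl s p (map (\<lambda>i. last (f i)) [0..<Suc n])" for n using f by simp
  then show False using assms unfolding winning_strategy_def by blast
qed

lemma strategy_iff_wins: "(\<exists>s. winning_strategy mv tn wn pl p s) \<longleftrightarrow> wins mv tn wn pl p"
  by (rule iffI, erule exE, erule strategy_imp_wins, erule wins_imp_strategy)

section \<open>Exchanging the players\<close>

abbreviation eloise :: "'r fm \<Rightarrow> 'r position \<Rightarrow> bool" where
  "eloise \<phi> \<equiv> wins (moves \<phi>) (turn \<phi>) (winner \<phi>) Eloise"

fun flip :: "'r position \<Rightarrow> 'r position" where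
  "flip (B, g, sg, p) = (B, g, opp sg, p)"

lemma flip_moves: "moves \<phi> (flip x) = flip ` moves \<phi> x"
proof -
  obtain B g sg p where x: "x = (B, g, sg, p)" by (cases x) auto
  show ?thesis unfolding x
    by (auto simp: Let_def image_iff split: option.splits fm.splits) blast+
qed

lemma flip_turn: "turn \<phi> (flip x) = Eloise \<longleftrightarrow> turn \<phi> x \<noteq> Eloise"
proof -
  obtain B g sg p where x: "x = (B, g, sg, p)" by (cases x) auto
  show ?thesis unfolding x
    by (cases sg) (auto split: option.splits fm.splits)
qed

lemma flip_winner: "winner \<phi> (flip x) = Eloise \<longleftrightarrow> winner \<phi> x \<noteq> Eloise"
proof -
  obtain B g sg p where x: "x = (B, g, sg, p)" by (cases x) auto
  show ?thesis unfolding x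
    by (cases sg) (auto split: option.splits)
qed

text \<open>The opposite sign keeps the moves and hands turns and wins to the other player. So
  winning at \<open>x\<close> and at \<open>flip x\<close> would mean that both players win at
  \<open>x\<close>, which induction on the first win rules out.\<close>

lemma eloise_flip: "eloise \<phi> x \<Longrightarrow> \<not> eloise \<phi> (flip x)"
proof (induction rule: wins.induct)
  case (winsI x)
  then show ?case
    unfolding wins_iff[of _ _ _ _ "flip x"]
    by (auto simp: force_def flip_moves flip_turn flip_winner split: if_splits)
qed

section \<open>Coding positions of the game\<close>

definition bind :: "nat \<Rightarrow> nat \<Rightarrow> nat \<Rightarrow> nat" where
  "bind k v l = Suc (prod_encode (prod_encode (k, v), l))"

definition push :: "nat \<Rightarrow> nat \<Rightarrow> nat" where
  "push b acc = Suc (prod_encode (b, acc))"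

definition rvar_code :: "rvar \<Rightarrow> nat" where
  "rvar_code X = prod_encode (rvar_arity X, rvar_index X)"

text \<open>Starts at 4 because the tags 0 to 3 mark the other kinds of keys.\<close>

fun sym_code :: "'a::finite word_sym \<Rightarrow> nat" where
  "sym_code Succ = 4"
| "sym_code (P a) = 5 + to_nat_on (UNIV :: 'a set) a"

abbreviation dom_key :: nat where
  "dom_key \<equiv> prod_encode (0, 0)"

definition fo_key :: "nat \<Rightarrow> nat" where
  "fo_key x = prod_encode (1, x)"

definition var_key :: "rvar \<Rightarrow> nat \<Rightarrow> nat" where
  "var_key X acc = prod_encode (2, prod_encode (rvar_code X, acc))"

text \<open>Distinguishes an unassigned relation variable from one with an empty value; no rule looks
  it up.\<close>

definition bound_key :: "rvar \<Rightarrow> nat" where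
  "bound_key X = prod_encode (3, rvar_code X)"

definition rel_key :: "'a::finite word_sym \<Rightarrow> nat \<Rightarrow> nat" where
  "rel_key R acc = prod_encode (sym_code R, acc)"

lemma rvar_code_inject [simp]: "rvar_code X = rvar_code Y \<longleftrightarrow> X = Y"
  by (cases X; cases Y) (auto simp: rvar_code_def)

lemma sym_code_inject [simp]: "sym_code R = sym_code S \<longleftrightarrow> R = S"
  by (cases R; cases S) (auto simp: inj_on_eq_iff[OF inj_on_to_nat_on] countable_finite)

lemma sym_code_ge: "4 \<le> sym_code R"
  by (cases R) auto

lemma sym_code_neq [simp]:
  "sym_code R \<noteq> 0" "sym_code R \<noteq> Suc 0" "sym_code R \<noteq> 2" "sym_code R \<noteq> 3"
  "0 \<noteq> sym_code R" "Suc 0 \<noteq> sym_code R" "2 \<noteq> sym_code R" "3 \<noteq> sym_code R"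
  using sym_code_ge[of R] by linarith+

lemmas key_defs = fo_key_def var_key_def bound_key_def rel_key_def

lemma key_simps [simp]:
  "fo_key x = fo_key y \<longleftrightarrow> x = y" "var_key X a = var_key Y b \<longleftrightarrow> X = Y \<and> a = b"
  "bound_key X = bound_key Y \<longleftrightarrow> X = Y" "rel_key R a = rel_key S b \<longleftrightarrow> R = S \<and> a = b"
  "dom_key \<noteq> fo_key x" "dom_key \<noteq> var_key X a" "dom_key \<noteq> bound_key X" "dom_key \<noteq> rel_key R a"
  "fo_key x \<noteq> dom_key" "fo_key x \<noteq> var_key X a" "fo_key x \<noteq> bound_key X" "fo_key x \<noteq> rel_key R a"
  "var_key X a \<noteq> dom_key" "var_key X a \<noteq> fo_key x" "var_key X a \<noteq> bound_key Y" "var_key X a \<noteq> rel_key R b"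
  "bound_key X \<noteq> dom_key" "bound_key X \<noteq> fo_key x" "bound_key X \<noteq> var_key Y a" "bound_key X \<noteq> rel_key R b"
  "rel_key R a \<noteq> dom_key" "rel_key R a \<noteq> fo_key x" "rel_key R a \<noteq> var_key X b" "rel_key R a \<noteq> bound_key X"
  by (auto simp: key_defs)

section \<open>Logs and the positions that they denote\<close>

definition init :: "'a::finite list \<Rightarrow> nat \<Rightarrow> nat" where
  "init w k = (if k = dom_key then Suc (length w)
     else if \<exists>R bs. k = rel_key R (list_encode (rev bs)) \<and> bs \<in> word_rel w R then 1 else 0)"

lemma snd_decode_less: "(e, l) = prod_decode n \<Longrightarrow> l < Suc n"
  by (metis le_imp_less_Suc le_prod_encode_2 prod_decode_inverse)

text \<open>Newer entries shadow older ones, and at the end of the log the word answers; updates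
  thus never change stored data, they only lengthen the log.\<close>

function lk :: "'a::finite list \<Rightarrow> nat \<Rightarrow> nat \<Rightarrow> nat" where
  "lk w 0 k = init w k"
| "lk w (Suc n) k = (let (e, l) = prod_decode n; (k', v) = prod_decode e
     in if k = k' then v else lk w l k)"
  by pat_completeness auto
termination
  by (relation "measure (\<lambda>(w, l, k). l)") (auto dest: snd_decode_less)

lemma lk_bind [simp]: "lk w (bind k' v l) k = (if k = k' then v else lk w l k)"
  by (simp add: bind_def)

lemma code_cases:
  obtains "l = 0" | k v l' where "l = bind k v l'"
proof (cases l)
  case (Suc n)
  obtain e l' where e: "prod_decode n = (e, l')" by fastforce
  obtain k v where k: "prod_decode e = (k, v)" by fastforce
  have "n = prod_encode (prod_encode (k, v), l')"
    using e k by (metis prod_decode_inverse)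
  then have "l = bind k v l'" using Suc by (simp add: bind_def)
  then show ?thesis using that by blast
qed (use that in blast)

lemma code_induct [case_names empty bind]:
  assumes "Q 0" "\<And>k v l. Q l \<Longrightarrow> Q (bind k v l)"
  shows "Q l"
proof (induction l rule: less_induct)
  case (less l)
  show ?case
  proof (cases l rule: code_cases)
    case (2 k v l')
    then have "l' < l" using le_prod_encode_2[of l' "prod_encode (k, v)"] by (simp add: bind_def)
    then show ?thesis using less assms(2) 2 by blast
  qed (use assms(1) in simp)
qed

text \<open>Tuples are accumulated from left to right by \<^const>\<open>push\<close>, hence the reversal.\<close>

abbreviation tuple_code :: "nat list \<Rightarrow> nat" where
  "tuple_code bs \<equiv> list_encode (rev bs)"

text \<open>The cardinality is enough to store the domain, because \<open>fresh\<close> always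
  extends an initial segment by its least missing number. Any nonzero value means
  membership.\<close>

definition model_of :: "'a::finite list \<Rightarrow> nat \<Rightarrow> 'a word_sym model" where
  "model_of w l = \<lparr>dom_of = {..<lk w l dom_key}, rel_of = (\<lambda>R. {bs. lk w l (rel_key R (tuple_code bs)) \<noteq> 0})\<rparr>"

definition so_of :: "'a::finite list \<Rightarrow> nat \<Rightarrow> rvar \<Rightarrow> nat list set" where
  "so_of w l X = {bs. lk w l (var_key X (tuple_code bs)) \<noteq> 0}"

lemma so_of_bind [simp]:
  "so_of w (bind dom_key v l) X = so_of w l X" "so_of w (bind (fo_key x) v l) X = so_of w l X"
  "so_of w (bind (rel_key R a) v l) X = so_of w l X" "so_of w (bind (bound_key Y) v l) X = so_of w l X"
  by (simp_all add: so_of_def)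

text \<open>Elements are stored with a successor, which leaves 0 for unassigned first-order
  variables.\<close>

definition asg_of :: "'a::finite list \<Rightarrow> nat \<Rightarrow> asg" where
  "asg_of w l =
     \<lparr>fo = (\<lambda>x. case lk w l (fo_key x) of 0 \<Rightarrow> None | Suc b \<Rightarrow> Some b),
      so = (\<lambda>X. if so_of w l X = {} \<and> lk w l (bound_key X) = 0 then None else Some (so_of w l X))\<rparr>"

lemma so_val_asg_of [simp]: "so_val (asg_of w l) X = so_of w l X"
  by (simp add: so_val_def asg_of_def)

lemma model_of_0: "model_of w 0 = word_model w"
  by (auto simp: model_of_def word_model_def init_def fun_eq_iff list_encode_eq)

lemma asg_of_0: "asg_of w 0 = empty_asg"
  by (auto simp: asg_of_def so_of_def empty_asg_def init_def fun_eq_iff)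

lemma model_of_bind_fo [simp]: "model_of w (bind (fo_key x) v l) = model_of w l"
  by (simp add: model_of_def)

lemma asg_of_bind_fo [simp]:
  "asg_of w (bind (fo_key x) (Suc b) l) = (asg_of w l)\<lparr>fo := (fo (asg_of w l))(x \<mapsto> b)\<rparr>"
  by (auto simp: asg_of_def so_of_def fun_eq_iff)

lemma model_of_bind_dom:
  "model_of w (bind dom_key v l) = (model_of w l)\<lparr>dom_of := {..<v}\<rparr>"
  by (simp add: model_of_def)

lemma asg_of_bind_dom [simp]: "asg_of w (bind dom_key v l) = asg_of w l"
  by (simp add: asg_of_def fun_eq_iff)

lemma model_of_bind_rel:
  "model_of w (bind (rel_key R (tuple_code bs)) v l) = (model_of w l)\<lparr>rel_of := (rel_of (model_of w l))
     (R := if v = 0 then rel_of (model_of w l) R - {bs} else insert bs (rel_of (model_of w l) R))\<rparr>"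
  by (auto simp: model_of_def fun_eq_iff list_encode_eq)

lemma asg_of_bind_rel [simp]: "asg_of w (bind (rel_key R a) v l) = asg_of w l"
  by (simp add: asg_of_def fun_eq_iff)

lemma model_of_bind_var [simp]:
  "model_of w (bind (var_key X a) v l) = model_of w l" "model_of w (bind (bound_key X) v l) = model_of w l"
  by (simp_all add: model_of_def)

lemma asg_of_bind_var:
  "asg_of w (bind (bound_key X) (Suc 0) (bind (var_key X (tuple_code bs)) v l)) =
     (asg_of w l)\<lparr>so := (so (asg_of w l))
       (X \<mapsto> if v = 0 then so_of w l X - {bs} else insert bs (so_of w l X))\<rparr>"
  by (auto simp: asg_of_def so_of_def fun_eq_iff list_encode_eq)

section \<open>One round of the game on codes\<close>

fun valuation_vars :: "'r fm \<Rightarrow> nat list" where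
  "valuation_vars (Rel R xs) = xs"
| "valuation_vars (Var X xs) = xs"
| "valuation_vars (Eq x y) = [x, y]"
| "valuation_vars (Exists x \<psi>) = [x]"
| "valuation_vars (InsertRel R xs \<psi>) = xs"
| "valuation_vars (InsertVar X xs \<psi>) = xs"
| "valuation_vars (DeleteRel R xs \<psi>) = xs"
| "valuation_vars (DeleteVar X xs \<psi>) = xs"
| "valuation_vars _ = []"

fun is_atom :: "'r fm \<Rightarrow> bool" where
  "is_atom (Rel R xs) \<longleftrightarrow> True"
| "is_atom (Var X xs) \<longleftrightarrow> True"
| "is_atom (Eq x y) \<longleftrightarrow> True"
| "is_atom _ \<longleftrightarrow> False"

definition labels :: "'r fm \<Rightarrow> nat \<Rightarrow> occ set" where
  "labels \<phi> k = {q. \<exists>\<psi>. sub_at \<phi> q = Some (Label k \<psi>)}"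

type_synonym target = "sign \<Rightarrow> occ \<Rightarrow> nat \<Rightarrow> bool"

text \<open>One round of the game at the occurrence \<open>p\<close> of \<open>\<psi>\<close>, seen by the existential player, once the
  values \<open>acc\<close> of the variables of \<open>\<psi>\<close> are known; \<open>X\<close> says which continuations are good.\<close>

fun sem_end :: "target \<Rightarrow> 'a::finite list \<Rightarrow> 'a word_sym fm \<Rightarrow> sign \<Rightarrow> occ \<Rightarrow> 'a word_sym fm \<Rightarrow> nat \<Rightarrow> nat \<Rightarrow> bool" where
  "sem_end X w \<phi> sg p (Rel R xs) acc l \<longleftrightarrow> (lk w l (rel_key R acc) \<noteq> 0 \<longleftrightarrow> sg = Plus)"
| "sem_end X w \<phi> sg p (Var Y xs) acc l \<longleftrightarrow> (lk w l (var_key Y acc) \<noteq> 0 \<longleftrightarrow> sg = Plus)"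
| "sem_end X w \<phi> sg p (Eq x y) acc l \<longleftrightarrow> ((\<exists>b. acc = push b (push b 0)) \<longleftrightarrow> sg = Plus)"
| "sem_end X w \<phi> sg p (Jump k) acc l \<longleftrightarrow>
     (if sg = Plus then \<exists>q\<in>labels \<phi> k. X sg q l else \<forall>q\<in>labels \<phi> k. X sg q l)"
| "sem_end X w \<phi> sg p (Neg \<psi>) acc l \<longleftrightarrow> X (opp sg) (p @ [0]) l"
| "sem_end X w \<phi> sg p (Conj \<psi> \<chi>) acc l \<longleftrightarrow>
     (if sg = Plus then X sg (p @ [0]) l \<and> X sg (p @ [1]) l else X sg (p @ [0]) l \<or> X sg (p @ [1]) l)"
| "sem_end X w \<phi> sg p (Exists x \<psi>) acc l \<longleftrightarrow> X sg (p @ [0]) l"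
| "sem_end X w \<phi> sg p (Insert x \<psi>) acc l \<longleftrightarrow>
     X sg (p @ [0]) (bind (fo_key x) (Suc (lk w l dom_key)) (bind dom_key (Suc (lk w l dom_key)) l))"
| "sem_end X w \<phi> sg p (InsertRel R xs \<psi>) acc l \<longleftrightarrow> X sg (p @ [0]) (bind (rel_key R acc) 1 l)"
| "sem_end X w \<phi> sg p (InsertVar Y xs \<psi>) acc l \<longleftrightarrow>
     X sg (p @ [0]) (bind (bound_key Y) 1 (bind (var_key Y acc) 1 l))"
| "sem_end X w \<phi> sg p (DeleteRel R xs \<psi>) acc l \<longleftrightarrow> X sg (p @ [0]) (bind (rel_key R acc) 0 l)"
| "sem_end X w \<phi> sg p (DeleteVar Y xs \<psi>) acc l \<longleftrightarrow>
     X sg (p @ [0]) (bind (bound_key Y) 1 (bind (var_key Y acc) 0 l))"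
| "sem_end X w \<phi> sg p (Label k \<psi>) acc l \<longleftrightarrow> X sg (p @ [0]) l"

text \<open>Tuples are treated entry by entry: an atom reads its variables from the log, any other
  formula has them chosen. The tuple is collected in \<open>acc\<close> because, if a variable is
  repeated, the log shows only its last value. An unassigned variable makes an atom false.\<close>

fun sem :: "target \<Rightarrow> 'a::finite list \<Rightarrow> 'a word_sym fm \<Rightarrow> sign \<Rightarrow> occ \<Rightarrow> 'a word_sym fm \<Rightarrow> nat list \<Rightarrow>
    nat \<Rightarrow> nat \<Rightarrow> bool" where
  "sem X w \<phi> sg p \<psi> [] acc l \<longleftrightarrow> sem_end X w \<phi> sg p \<psi> acc l"
| "sem X w \<phi> sg p \<psi> (x # xs) acc l \<longleftrightarrow>
     (if is_atom \<psi>
      then (case lk w l (fo_key x) of 0 \<Rightarrow> sg = Minus | Suc b \<Rightarrow> sem X w \<phi> sg p \<psi> xs (push b acc) l)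
      else if sg = Plus
      then \<exists>b\<in>{..<lk w l dom_key}. sem X w \<phi> sg p \<psi> xs (push b acc) (bind (fo_key x) (Suc b) l)
      else \<forall>b\<in>{..<lk w l dom_key}. sem X w \<phi> sg p \<psi> xs (push b acc) (bind (fo_key x) (Suc b) l))"

definition pos :: "'a::finite list \<Rightarrow> sign \<Rightarrow> occ \<Rightarrow> nat \<Rightarrow> 'a word_sym position" where
  "pos w sg p l = (model_of w l, asg_of w l, sg, p)"

fun assign :: "nat list \<Rightarrow> nat list \<Rightarrow> nat \<Rightarrow> nat" where
  "assign (x # xs) (b # bs) l = assign xs bs (bind (fo_key x) (Suc b) l)"
| "assign _ _ l = l"

fun push_all :: "nat list \<Rightarrow> nat \<Rightarrow> nat" where
  "push_all [] acc = acc"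
| "push_all (b # bs) acc = push_all bs (push b acc)"

lemma push_list_encode: "push b (list_encode bs) = list_encode (b # bs)"
  by (simp add: push_def)

lemma push_all_tuple: "push_all bs (list_encode cs) = list_encode (rev bs @ cs)"
  by (induction bs arbitrary: cs) (simp_all add: push_list_encode del: list_encode.simps(2))

lemma push_all_0: "push_all bs 0 = tuple_code bs"
  using push_all_tuple[of bs "[]"] by simp

lemma model_of_assign [simp]: "model_of w (assign xs bs l) = model_of w l"
  by (induction xs bs l rule: assign.induct) auto

lemma asg_of_assign:
  "length xs = length bs \<Longrightarrow>
    asg_of w (assign xs bs l) = (asg_of w l)\<lparr>fo := (fo (asg_of w l))(xs [\<mapsto>] bs)\<rparr>"
  by (induction xs bs l rule: assign.induct) (auto simp: map_upds_Cons)

lemma so_of_assign [simp]: "so_of w (assign xs bs l) X = so_of w l X"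
  by (induction xs bs l rule: assign.induct) auto

lemma lk_assign_dom [simp]: "lk w (assign xs bs l) dom_key = lk w l dom_key"
  by (induction xs bs l rule: assign.induct) auto

lemma tuples_0: "tuples B 0 = {[]}"
  by (auto simp: tuples_def)

lemma tuples_Suc: "tuples B (Suc k) = (\<Union>b\<in>B. (\<lambda>bs. b # bs) ` tuples B k)"
  by (auto simp: tuples_def length_Suc_conv image_iff)

lemma sem_choice:
  assumes "\<not> is_atom \<psi>"
  shows "sem X w \<phi> sg p \<psi> xs acc l \<longleftrightarrow>
    (if sg = Plus
     then \<exists>bs\<in>tuples {..<lk w l dom_key} (length xs). sem_end X w \<phi> sg p \<psi> (push_all bs acc) (assign xs bs l)
     else \<forall>bs\<in>tuples {..<lk w l dom_key} (length xs). sem_end X w \<phi> sg p \<psi> (push_all bs acc) (assign xs bs l))"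
  using assms
  by (cases sg; induction xs arbitrary: acc l) (simp_all add: tuples_0 tuples_Suc)

lemma sem_atom:
  assumes "is_atom \<psi>"
  shows "sem X w \<phi> sg p \<psi> xs acc l \<longleftrightarrow>
    (case those (map (fo (asg_of w l)) xs) of None \<Rightarrow> sg = Minus
     | Some bs \<Rightarrow> sem_end X w \<phi> sg p \<psi> (push_all bs acc) l)"
  using assms
proof (induction xs arbitrary: acc)
  case (Cons x xs)
  then show ?case
    by (cases "lk w l (fo_key x)") (auto simp: asg_of_def option.map_comp split: option.splits)
qed simp

lemma those_Some: "those os = Some bs \<longleftrightarrow> os = map Some bs"
  by (induction os arbitrary: bs) (auto split: option.splits)

abbreviation eforce :: "'r fm \<Rightarrow> ('r position \<Rightarrow> bool) \<Rightarrow> 'r position \<Rightarrow> bool" where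
  "eforce \<phi> \<equiv> force (moves \<phi>) (turn \<phi>) (winner \<phi>) Eloise"

text \<open>Dead ends, such as jumps without a target, need no separate case: there the falsifier
  wins, and this is what a quantifier over the empty set of moves says for either sign.\<close>

lemma eforce_verifier:
  assumes "sub_at \<phi> p = Some \<psi>" "\<not> is_atom \<psi>" "\<And>\<psi>1 \<psi>2. \<psi> \<noteq> Conj \<psi>1 \<psi>2"
  shows "eforce \<phi> X (B, g, sg, p) \<longleftrightarrow>
    (if sg = Plus then \<exists>q\<in>moves \<phi> (B, g, sg, p). X q else \<forall>q\<in>moves \<phi> (B, g, sg, p). X q)"
proof -
  have "turn \<phi> (B, g, sg, p) = verifier sg" "winner \<phi> (B, g, sg, p) = falsifier sg"
    using assms by (cases \<psi>; simp)+
  then show ?thesis by (cases sg) (auto simp: force_def simp del: moves.simps)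
qed

lemma eforce_atom:
  assumes "sub_at \<phi> p = Some \<psi>" "is_atom \<psi>"
  shows "eforce \<phi> X (B, g, sg, p) \<longleftrightarrow> (atom_holds B g \<psi> \<longleftrightarrow> sg = Plus)"
  using assms by (cases \<psi>; cases sg) (auto simp: force_def)

lemma fresh_lessThan [simp]: "fresh {..<n} = n"
  unfolding fresh_def by (rule Least_equality) auto

text \<open>The play ends at an atom, so no continuation is consulted and \<open>Y\<close> and
  \<open>X\<close> are unrelated.\<close>

lemma sem_step_atom:
  assumes p: "sub_at \<phi> p = Some \<psi>" and atom: "is_atom \<psi>"
  shows "sem Y w \<phi> sg p \<psi> (valuation_vars \<psi>) 0 l \<longleftrightarrow> eforce \<phi> X (pos w sg p l)"
proof -
  have "(case those (map (fo (asg_of w l)) (valuation_vars \<psi>)) of None \<Rightarrow> sg = Minus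
      | Some bs \<Rightarrow> sem_end Y w \<phi> sg p \<psi> (push_all bs 0) l) \<longleftrightarrow>
    (atom_holds (model_of w l) (asg_of w l) \<psi> \<longleftrightarrow> sg = Plus)"
  proof (cases "those (map (fo (asg_of w l)) (valuation_vars \<psi>))")
    case None
    then have "map (fo (asg_of w l)) (valuation_vars \<psi>) \<noteq> map Some bs" for bs
      by (metis option.distinct(1) those_Some)
    moreover have "sg = Minus \<longleftrightarrow> sg \<noteq> Plus" by (cases sg) auto
    ultimately show ?thesis using None atom
      by (cases \<psi>) (auto dest: spec[of _ "[_, _]"])
  next
    case (Some bs)
    then have bs: "map (fo (asg_of w l)) (valuation_vars \<psi>) = map Some bs"
      by (simp add: those_Some)
    have inj: "map Some bs = map Some cs \<longleftrightarrow> bs = cs" for cs :: "nat list"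
      by (simp add: inj_map_eq_map)
    show ?thesis
    proof (cases \<psi>)
      case (Rel R xs)
      then show ?thesis using Some bs inj by (auto simp: push_all_0 model_of_def)
    next
      case (Var Y xs)
      then show ?thesis using Some bs inj by (auto simp: push_all_0 asg_of_def so_of_def)
    next
      case (Eq x y)
      then show ?thesis using Some bs by (auto simp: push_def)
    qed (use atom in auto)
  qed
  then show ?thesis by (simp add: sem_atom[OF atom] pos_def eforce_atom[OF p atom])
qed

lemma eforce_Conj:
  assumes "sub_at \<phi> p = Some (Conj \<psi> \<chi>)"
  shows "eforce \<phi> X (B, g, sg, p) \<longleftrightarrow>
    (if sg = Plus then X (B, g, sg, p @ [0]) \<and> X (B, g, sg, p @ [1])
     else X (B, g, sg, p @ [0]) \<or> X (B, g, sg, p @ [1]))"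
  using assms by (cases sg) (auto simp: force_def)

lemma model_of_simps [simp]: "dom_of (model_of w l) = {..<lk w l dom_key}"
  by (simp add: model_of_def)

text \<open>Since \<open>X\<close> is arbitrary, this serves both soundness, where \<open>X\<close>
  is the set of won positions, and completeness, where \<open>X\<close> is an induction
  hypothesis.\<close>

lemma sem_step:
  assumes p: "sub_at \<phi> p = Some \<psi>"
  shows "sem (\<lambda>sg q l. X (pos w sg q l)) w \<phi> sg p \<psi> (valuation_vars \<psi>) 0 l \<longleftrightarrow> eforce \<phi> X (pos w sg p l)"
proof (cases "is_atom \<psi>")
  case True
  then show ?thesis using sem_step_atom[OF p] by blast
next
  case False
  have len: "length bs = length xs" if "bs \<in> tuples D (length xs)" for bs D xs
    using that by (simp add: tuples_def)
  note ev = eforce_verifier[OF p False]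
  show ?thesis
  proof (cases \<psi>)
    case (Jump k)
    have "(\<exists>q\<in>moves \<phi> (pos w sg p l). X q) \<longleftrightarrow> (\<exists>q\<in>labels \<phi> k. X (pos w sg q l))"
      "(\<forall>q\<in>moves \<phi> (pos w sg p l). X q) \<longleftrightarrow> (\<forall>q\<in>labels \<phi> k. X (pos w sg q l))"
      using p Jump by (auto simp: pos_def labels_def)
    then show ?thesis using ev Jump by (cases sg) (simp_all add: pos_def del: moves.simps)
  next
    case (Neg \<psi>1)
    then show ?thesis using ev p by (simp add: pos_def)
  next
    case (Label k \<psi>1)
    then show ?thesis using ev p by (simp add: pos_def)
  next
    case (Conj \<psi>1 \<psi>2)
    then show ?thesis using eforce_Conj[of \<phi> p \<psi>1 \<psi>2] p by (simp add: pos_def)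
  next
    case (Exists x \<psi>1)
    have "(\<exists>q\<in>moves \<phi> (pos w sg p l). X q) \<longleftrightarrow> (\<exists>b<lk w l dom_key. X (pos w sg (p @ [0]) (bind (fo_key x) (Suc b) l)))"
      "(\<forall>q\<in>moves \<phi> (pos w sg p l). X q) \<longleftrightarrow> (\<forall>b<lk w l dom_key. X (pos w sg (p @ [0]) (bind (fo_key x) (Suc b) l)))"
      using p Exists by (auto simp: pos_def)
    then show ?thesis using ev Exists by (auto simp: pos_def simp del: moves.simps)
  next
    case (Insert x \<psi>1)
    then show ?thesis using ev p by (simp add: pos_def model_of_bind_dom lessThan_Suc Let_def)
  next
    case (InsertRel R xs \<psi>1)
    define f where "f bs = bind (rel_key R (tuple_code bs)) 1 (assign xs bs l)" for bs
    have "moves \<phi> (pos w sg p l) = (\<lambda>bs. pos w sg (p @ [0]) (f bs)) ` tuples {..<lk w l dom_key} (length xs)"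
      using p InsertRel by (simp add: pos_def Setcompr_eq_image)
        (rule image_cong, simp_all add: f_def tuples_def asg_of_assign model_of_bind_rel )
    then show ?thesis using ev InsertRel sem_choice[OF False] 
      by (cases sg) (simp_all add: pos_def push_all_0 f_def del: moves.simps)
  next
    case (DeleteRel R xs \<psi>1)
    define f where "f bs = bind (rel_key R (tuple_code bs)) 0 (assign xs bs l)" for bs
    have "moves \<phi> (pos w sg p l) = (\<lambda>bs. pos w sg (p @ [0]) (f bs)) ` tuples {..<lk w l dom_key} (length xs)"
      using p DeleteRel by (simp add: pos_def Setcompr_eq_image)
        (rule image_cong, simp_all add: f_def tuples_def asg_of_assign model_of_bind_rel )
    then show ?thesis using ev DeleteRel sem_choice[OF False] 
      by (cases sg) (simp_all add: pos_def push_all_0 f_def del: moves.simps)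
  next
    case (InsertVar Y xs \<psi>1)
    define f where "f bs = bind (bound_key Y) 1 (bind (var_key Y (tuple_code bs)) 1 (assign xs bs l))" for bs
    have "moves \<phi> (pos w sg p l) = (\<lambda>bs. pos w sg (p @ [0]) (f bs)) ` tuples {..<lk w l dom_key} (length xs)"
      using p InsertVar by (simp add: pos_def Setcompr_eq_image)
        (rule image_cong, simp_all add: f_def tuples_def asg_of_assign asg_of_bind_var )
    then show ?thesis using ev InsertVar sem_choice[OF False] 
      by (cases sg) (simp_all add: pos_def push_all_0 f_def del: moves.simps)
  next
    case (DeleteVar Y xs \<psi>1)
    define f where "f bs = bind (bound_key Y) 1 (bind (var_key Y (tuple_code bs)) 0 (assign xs bs l))" for bs
    have "moves \<phi> (pos w sg p l) = (\<lambda>bs. pos w sg (p @ [0]) (f bs)) ` tuples {..<lk w l dom_key} (length xs)"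
      using p DeleteVar by (simp add: pos_def Setcompr_eq_image)
        (rule image_cong, simp_all add: f_def tuples_def asg_of_assign asg_of_bind_var )
    then show ?thesis using ev DeleteVar sem_choice[OF False] 
      by (cases sg) (simp_all add: pos_def push_all_0 f_def del: moves.simps)
  qed (use False in auto)
qed

section \<open>Horn clauses for the game\<close>

text \<open>The part of a position that ranges over finitely many values and is therefore a constant
  in each rule: sign, occurrence, and the number \<open>i\<close> of variables already
  treated.\<close>

definition ctl :: "sign \<Rightarrow> occ \<Rightarrow> nat \<Rightarrow> nat" where
  "ctl sg p i = prod_encode (if sg = Plus then 0 else 1, prod_encode (list_encode p, i))"

definition f_lk :: "nat \<Rightarrow> nat \<Rightarrow> nat \<Rightarrow> nat" where
  "f_lk l k v = prod_encode (0, prod_encode (l, prod_encode (k, v)))"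

definition f_less :: "nat \<Rightarrow> nat \<Rightarrow> nat" where
  "f_less b d = prod_encode (1, prod_encode (b, d))"

definition f_win :: "nat \<Rightarrow> nat \<Rightarrow> nat \<Rightarrow> nat" where
  "f_win c acc l = prod_encode (2, prod_encode (c, prod_encode (acc, l)))"

text \<open>Intermediate result of a bounded iteration: all values below \<open>b\<close> are good
  for the current variable. It stands in for a universal quantifier over the domain, which the body
  of a clause cannot contain.\<close>

definition f_all :: "nat \<Rightarrow> nat \<Rightarrow> nat \<Rightarrow> nat \<Rightarrow> nat" where
  "f_all c b acc l = prod_encode (3, prod_encode (c, prod_encode (b, prod_encode (acc, l))))"

definition "t_lk l k v = TPair (TConst 0) (TPair l (TPair k v))"
definition "t_less b d = TPair (TConst 1) (TPair b d)"
definition "t_win sg p i acc l = TPair (TConst 2) (TPair (TConst (ctl sg p i)) (TPair acc l))"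
definition "t_all sg p i b acc l =
  TPair (TConst 3) (TPair (TConst (ctl sg p i)) (TPair b (TPair acc l)))"
definition "t_bind k v l = TSuc (TPair (TPair k v) l)"
definition "t_push b acc = TSuc (TPair b acc)"
definition "t_rel R acc = TPair (TConst (sym_code R)) acc"
definition "t_var X acc = TPair (TConst 2) (TPair (TConst (rvar_code X)) acc)"

abbreviation "t_pos sg p l \<equiv> t_win sg p 0 (TConst 0) l"

lemma ev_terms [simp]:
  "ev \<rho> (t_lk l k v) = f_lk (ev \<rho> l) (ev \<rho> k) (ev \<rho> v)"
  "ev \<rho> (t_less b d) = f_less (ev \<rho> b) (ev \<rho> d)"
  "ev \<rho> (t_win sg p i acc l) = f_win (ctl sg p i) (ev \<rho> acc) (ev \<rho> l)"
  "ev \<rho> (t_all sg p i b acc l) = f_all (ctl sg p i) (ev \<rho> b) (ev \<rho> acc) (ev \<rho> l)"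
  "ev \<rho> (t_bind k v l) = bind (ev \<rho> k) (ev \<rho> v) (ev \<rho> l)"
  "ev \<rho> (t_push b acc) = push (ev \<rho> b) (ev \<rho> acc)"
  "ev \<rho> (t_rel R acc) = rel_key R (ev \<rho> acc)"
  "ev \<rho> (t_var X acc) = var_key X (ev \<rho> acc)"
  by (simp_all add: t_lk_def f_lk_def t_less_def f_less_def t_win_def f_win_def t_all_def f_all_def
      t_bind_def bind_def t_push_def push_def t_rel_def rel_key_def t_var_def var_key_def)

abbreviation "x0 \<equiv> TVar 0"
abbreviation "x1 \<equiv> TVar 1"
abbreviation "x2 \<equiv> TVar 2"
abbreviation "x3 \<equiv> TVar 3"
abbreviation "x4 \<equiv> TVar 4"

text \<open>The cell at address \<open>x0\<close> holds the letter of position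
  \<open>x0 + 1\<close>, and tuples are coded in reverse, so the second component of
  \<open>Succ\<close> is pushed last. A last letter at \<open>x0\<close> means length
  \<open>x0 + 1\<close> and domain size \<open>x0 + 2\<close>. Non-membership in a letter predicate
  is read off from another letter, from the end of the word, or from position 0.\<close>

definition letter_rules :: "'a::finite list \<Rightarrow> 'a \<Rightarrow> 'a rule list" where
  "letter_rules sigma a =
    [([Letter x0 (Some a), Letter (TSuc x0) None], t_lk (TConst 0) (TConst dom_key) (TSuc (TSuc x0))),
     ([Letter x0 (Some a)], t_lk (TConst 0) (t_rel (Succ :: 'a word_sym) (t_push (TSuc x0) (t_push x0 (TConst 0)))) (TConst 1)),
     ([Letter x0 (Some a)], t_lk (TConst 0) (t_rel (P a) (t_push (TSuc x0) (TConst 0))) (TConst 1)),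
     ([Letter x0 None], t_lk (TConst 0) (t_rel (P a) (t_push (TSuc x0) (TConst 0))) (TConst 0)),
     ([], t_lk (TConst 0) (t_rel (P a) (t_push (TConst 0) (TConst 0))) (TConst 0))] @
    map (\<lambda>b. ([Letter x0 (Some b)], t_lk (TConst 0) (t_rel (P a) (t_push (TSuc x0) (TConst 0))) (TConst 0)))
      (filter (\<lambda>b. b \<noteq> a) sigma)"

text \<open>\<open>Neq\<close> guards the passage to older entries, so a shadowed value is never
  derived. The empty word has no last letter and gets its domain size 1 from a rule of its
  own.\<close>

definition lookup_rules :: "'a::finite list \<Rightarrow> 'a rule list" where
  "lookup_rules sigma =
    [([], t_lk (t_bind x0 x1 x2) x0 x1),
     ([Neq x0 x3, Fact (t_lk x2 x0 x1)], t_lk (t_bind x3 x4 x2) x0 x1),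
     ([], t_less x0 (TSuc x0)),
     ([Fact (t_less x0 x1)], t_less x0 (TSuc x1)),
     ([Letter (TConst 0) None], t_lk (TConst 0) (TConst dom_key) (TConst 1)),
     ([], t_lk (TConst 0) (TPair (TConst 1) x0) (TConst 0)),
     ([], t_lk (TConst 0) (TPair (TConst 2) x0) (TConst 0)),
     ([Letter x0 None], t_lk (TConst 0) (t_rel (Succ :: 'a word_sym) (t_push (TSuc x0) (t_push x0 (TConst 0)))) (TConst 0)),
     ([Neq x1 (TSuc x0)], t_lk (TConst 0) (t_rel (Succ :: 'a word_sym) (t_push x1 (t_push x0 (TConst 0)))) (TConst 0))] @
    concat (map (letter_rules sigma) sigma)"

text \<open>In the rules for the game, \<^term>\<open>x0\<close> is the log and \<^term>\<open>x1\<close> the accumulated tuple.\<close>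

fun end_rules :: "(nat \<Rightarrow> occ list) \<Rightarrow> sign \<Rightarrow> occ \<Rightarrow> 'a::finite word_sym fm \<Rightarrow> 'a rule list" where
  "end_rules lab sg p (Rel R xs) =
     [([Fact (t_lk x0 (t_rel R x1) (if sg = Plus then TSuc x2 else TConst 0))], t_win sg p (length xs) x1 x0)]"
| "end_rules lab sg p (Var X xs) =
     [([Fact (t_lk x0 (t_var X x1) (if sg = Plus then TSuc x2 else TConst 0))], t_win sg p (length xs) x1 x0)]"
| "end_rules lab sg p (Eq x y) =
     (if sg = Plus then [([], t_win sg p 2 (t_push x1 (t_push x1 (TConst 0))) x0)]
      else [([Neq x1 x2], t_win sg p 2 (t_push x1 (t_push x2 (TConst 0))) x0)])"
| "end_rules lab sg p (Jump k) =
     (if sg = Plus then map (\<lambda>q. ([Fact (t_pos sg q x0)], t_win sg p 0 x1 x0)) (lab k)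
      else [(map (\<lambda>q. Fact (t_pos sg q x0)) (lab k), t_win sg p 0 x1 x0)])"
| "end_rules lab sg p (Neg \<psi>) = [([Fact (t_pos (opp sg) (p @ [0]) x0)], t_win sg p 0 x1 x0)]"
| "end_rules lab sg p (Conj \<psi> \<chi>) =
     (if sg = Plus then [([Fact (t_pos sg (p @ [0]) x0), Fact (t_pos sg (p @ [1]) x0)], t_win sg p 0 x1 x0)]
      else [([Fact (t_pos sg (p @ [0]) x0)], t_win sg p 0 x1 x0),
            ([Fact (t_pos sg (p @ [1]) x0)], t_win sg p 0 x1 x0)])"
| "end_rules lab sg p (Exists x \<psi>) = [([Fact (t_pos sg (p @ [0]) x0)], t_win sg p 1 x1 x0)]"
| "end_rules lab sg p (Insert x \<psi>) =
     [([Fact (t_lk x0 (TConst dom_key) x2), Fact (t_pos sg (p @ [0])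
         (t_bind (TConst (fo_key x)) (TSuc x2) (t_bind (TConst dom_key) (TSuc x2) x0)))], t_win sg p 0 x1 x0)]"
| "end_rules lab sg p (InsertRel R xs \<psi>) =
     [([Fact (t_pos sg (p @ [0]) (t_bind (t_rel R x1) (TConst 1) x0))], t_win sg p (length xs) x1 x0)]"
| "end_rules lab sg p (InsertVar X xs \<psi>) =
     [([Fact (t_pos sg (p @ [0]) (t_bind (TConst (bound_key X)) (TConst 1) (t_bind (t_var X x1) (TConst 1) x0)))],
       t_win sg p (length xs) x1 x0)]"
| "end_rules lab sg p (DeleteRel R xs \<psi>) =
     [([Fact (t_pos sg (p @ [0]) (t_bind (t_rel R x1) (TConst 0) x0))], t_win sg p (length xs) x1 x0)]"
| "end_rules lab sg p (DeleteVar X xs \<psi>) =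
     [([Fact (t_pos sg (p @ [0]) (t_bind (TConst (bound_key X)) (TConst 1) (t_bind (t_var X x1) (TConst 0) x0)))],
       t_win sg p (length xs) x1 x0)]"
| "end_rules lab sg p (Label k \<psi>) = [([Fact (t_pos sg (p @ [0]) x0)], t_win sg p 0 x1 x0)]"

definition var_rules :: "sign \<Rightarrow> occ \<Rightarrow> 'a word_sym fm \<Rightarrow> nat \<Rightarrow> 'a rule list" where
  "var_rules sg p \<psi> i = (let x = TConst (fo_key (valuation_vars \<psi> ! i)) in
     if is_atom \<psi>
     then ([Fact (t_lk x0 x (TSuc x2)), Fact (t_win sg p (Suc i) (t_push x2 x1) x0)], t_win sg p i x1 x0) #
       (if sg = Minus then [([Fact (t_lk x0 x (TConst 0))], t_win sg p i x1 x0)] else [])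
     else if sg = Plus
     then [([Fact (t_lk x0 (TConst dom_key) x3), Fact (t_less x2 x3),
         Fact (t_win sg p (Suc i) (t_push x2 x1) (t_bind x (TSuc x2) x0))], t_win sg p i x1 x0)]
     else [([], t_all sg p i (TConst 0) x1 x0),
       ([Fact (t_all sg p i x2 x1 x0), Fact (t_win sg p (Suc i) (t_push x2 x1) (t_bind x (TSuc x2) x0))],
         t_all sg p i (TSuc x2) x1 x0),
       ([Fact (t_lk x0 (TConst dom_key) x3), Fact (t_all sg p i x3 x1 x0)], t_win sg p i x1 x0)])"

definition occ_rules :: "(nat \<Rightarrow> occ list) \<Rightarrow> sign \<Rightarrow> occ \<Rightarrow> 'a::finite word_sym fm \<Rightarrow> 'a rule list" where
  "occ_rules lab sg p \<psi> = end_rules lab sg p \<psi> @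
     concat (map (var_rules sg p \<psi>) [0..<length (valuation_vars \<psi>)])"

lemma holds_simps [simp]:
  "holds w \<rho> W (Neq s t) \<longleftrightarrow> ev \<rho> s \<noteq> ev \<rho> t"
  "holds w \<rho> W (Letter t l) \<longleftrightarrow> letter_at w (ev \<rho> t) = l"
  by (simp_all add: holds_def)

lemma size_children: "\<psi> \<in> set (children \<phi>) \<Longrightarrow> size \<psi> < size \<phi>"
  by (cases \<phi>) auto

lemma finite_occs: "finite {p. sub_at \<phi> p \<noteq> None}"
proof (induction \<phi> rule: measure_induct_rule[of size])
  case (less \<phi>)
  have "{p. sub_at \<phi> p \<noteq> None} \<subseteq>
      insert [] (\<Union>i<length (children \<phi>). (#) i ` {p. sub_at (children \<phi> ! i) p \<noteq> None})"
  proof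
    fix p assume "p \<in> {p. sub_at \<phi> p \<noteq> None}"
    then show "p \<in> insert [] (\<Union>i<length (children \<phi>). (#) i ` {p. sub_at (children \<phi> ! i) p \<noteq> None})"
      by (cases p) (auto split: if_splits)
  qed
  moreover have "finite {p. sub_at (children \<phi> ! i) p \<noteq> None}" if "i < length (children \<phi>)" for i
    by (rule less.IH[OF size_children]) (use that in simp)
  ultimately show ?case
    by (elim finite_subset) (intro finite.insertI finite_UN_I finite_imageI finite_lessThan, simp)
qed

lemma sub_at_append: "sub_at \<phi> p = Some \<psi> \<Longrightarrow> sub_at \<phi> (p @ q) = sub_at \<psi> q"
  by (induction \<phi> p rule: sub_at.induct) (auto split: if_splits)

lemma sub_at_Lstar: "in_Lstar ar \<phi> \<Longrightarrow> sub_at \<phi> p = Some \<psi> \<Longrightarrow> in_Lstar ar \<psi>"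
proof (induction \<phi> p rule: sub_at.induct)
  case (2 \<phi> i p)
  then show ?case by (cases \<phi>) (auto split: if_splits simp: less_Suc_eq)
qed simp

locale game_rules =
  fixes \<phi> :: "'a::finite word_sym fm" and sigma :: "'a list" and occs :: "occ list"
    and lab :: "nat \<Rightarrow> occ list"
  assumes letters: "set sigma = UNIV" and occs: "set occs = {p. sub_at \<phi> p \<noteq> None}"
    and lab: "set (lab k) = labels \<phi> k" and Lstar: "in_Lstar word_arity \<phi>"
begin

definition rules :: "'a rule list" where
  "rules = lookup_rules sigma @ concat (map (\<lambda>p. occ_rules lab Plus p (the (sub_at \<phi> p)) @
     occ_rules lab Minus p (the (sub_at \<phi> p))) occs)"

section \<open>Soundness of the clauses\<close>

definition val :: "'a list \<Rightarrow> nat \<Rightarrow> nat \<Rightarrow> nat \<Rightarrow> nat \<Rightarrow> nat \<Rightarrow> bool" where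
  "val w s c i acc l \<longleftrightarrow> (let sg = if s = 0 then Plus else Minus; p = list_decode c in
     case sub_at \<phi> p of None \<Rightarrow> True
     | Some \<psi> \<Rightarrow> sem (\<lambda>sg q l. eloise \<phi> (pos w sg q l)) w \<phi> sg p \<psi> (drop i (valuation_vars \<psi>)) acc l)"

definition quantified :: "nat \<Rightarrow> nat \<Rightarrow> nat" where
  "quantified c i = (case sub_at \<phi> (list_decode c) of None \<Rightarrow> 0 | Some \<psi> \<Rightarrow> valuation_vars \<psi> ! i)"

text \<open>The intended meaning of each number as a fact, chosen to be closed under all rules. The
  code of an \<open>f_all\<close> fact does not mention the variable being iterated, so
  \<open>quantified\<close> recovers it from the occurrence and the index.\<close>

definition facts :: "'a list \<Rightarrow> nat set" where
  "facts w = {n. case prod_decode n of (t, x) \<Rightarrow> case prod_decode x of (a, y) \<Rightarrow>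
     if t = 0 then case prod_decode y of (k, v) \<Rightarrow> lk w a k = v
     else if t = 1 then a < y
     else case prod_decode a of (s, c) \<Rightarrow> case prod_decode c of (p, i) \<Rightarrow>
       if t = 2 then case prod_decode y of (acc, l) \<Rightarrow> val w s p i acc l
       else case prod_decode y of (m, z) \<Rightarrow> case prod_decode z of (acc, l) \<Rightarrow>
         \<forall>b<m. val w s p (Suc i) (push b acc) (bind (fo_key (quantified p i)) (Suc b) l)}"

lemma facts_simps [simp]:
  "f_lk l k v \<in> facts w \<longleftrightarrow> lk w l k = v"
  "f_less b d \<in> facts w \<longleftrightarrow> b < d"
  by (simp_all add: facts_def f_lk_def f_less_def)

lemma facts_win:
  assumes "sub_at \<phi> p = Some \<psi>"
  shows "f_win (ctl sg p i) acc l \<in> facts w \<longleftrightarrow>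
      sem (\<lambda>sg q l. eloise \<phi> (pos w sg q l)) w \<phi> sg p \<psi> (drop i (valuation_vars \<psi>)) acc l"
    "f_all (ctl sg p i) m acc l \<in> facts w \<longleftrightarrow> (\<forall>b<m. sem (\<lambda>sg q l. eloise \<phi> (pos w sg q l)) w \<phi> sg p \<psi>
      (drop (Suc i) (valuation_vars \<psi>)) (push b acc) (bind (fo_key (valuation_vars \<psi> ! i)) (Suc b) l))"
  using assms by (cases sg; simp add: facts_def f_win_def f_all_def ctl_def val_def quantified_def)+

text \<open>Index 0 with an empty accumulator stands for a position whose round has not begun; here
  \<open>sem_step\<close> meets the fixed point equation of \<open>wins\<close>.\<close>

lemma facts_pos:
  assumes "sub_at \<phi> p = Some \<psi>"
  shows "f_win (ctl sg p 0) 0 l \<in> facts w \<longleftrightarrow> eloise \<phi> (pos w sg p l)"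
  using sem_step[OF assms, of "eloise \<phi>"] wins_iff[of "moves \<phi>"] by (simp add: facts_win[OF assms])

lemma init_simps:
  "init w dom_key = Suc (length w)" "init w (fo_key x) = 0" "init w (var_key X acc) = 0"
  "init w (rel_key R (list_encode bs)) = (if rev bs \<in> word_rel w R then 1 else 0)"
  by (auto simp: init_def list_encode_eq)

lemma push_encode: "push b 0 = list_encode [b]" "push c (list_encode bs) = list_encode (c # bs)"
  by (simp_all add: push_def)

lemma init_push:
  "init w (rel_key R (push b 0)) = (if [b] \<in> word_rel w R then 1 else 0)"
  "init w (rel_key R (push c (push b 0))) = (if [b, c] \<in> word_rel w R then 1 else 0)"
  unfolding push_encode init_simps by simp_all

lemma sound_lookup:
  assumes "(ps, t) \<in> set (lookup_rules sigma)" "\<forall>q\<in>set ps. holds w \<rho> (facts w) q"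
  shows "ev \<rho> t \<in> facts w"
proof -
  have "init w (prod_encode (1, n)) = 0" "init w (prod_encode (2, n)) = 0" for n
    by (auto simp: init_def rel_key_def)
  then show ?thesis
    using assms unfolding lookup_rules_def letter_rules_def
    by (auto simp: init_simps init_push letter_at_def split: if_splits)
qed

lemma sound_var:
  assumes p: "sub_at \<phi> p = Some \<psi>" and i: "i < length (valuation_vars \<psi>)"
    and "(ps, t) \<in> set (var_rules sg p \<psi> i)" "\<forall>q\<in>set ps. holds w \<rho> (facts w) q"
  shows "ev \<rho> t \<in> facts w"
proof -
  note d = Cons_nth_drop_Suc[OF i, symmetric]
  show ?thesis
    using assms(3,4) unfolding var_rules_def
    by (auto simp: facts_win[OF p] d Let_def less_Suc_eq split: if_splits nat.splits)
qed

lemma sound_end: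
  assumes p: "sub_at \<phi> p = Some \<psi>"
    and "(ps, t) \<in> set (end_rules lab sg p \<psi>)" "\<forall>q\<in>set ps. holds w \<rho> (facts w) q"
  shows "ev \<rho> t \<in> facts w"
proof -
  have child: "sub_at \<phi> (p @ [i]) = Some (children \<psi> ! i)" if "i < length (children \<psi>)" for i
    using sub_at_append[OF p, of "[i]"] that by simp
  have lab': "q \<in> set (lab k) \<Longrightarrow> \<exists>\<chi>. sub_at \<phi> q = Some \<chi>" for q k
    using lab by (auto simp: labels_def)
  show ?thesis
  proof (cases \<psi>)
    case (Rel R xs)
    then show ?thesis using assms(2,3) by (cases sg) (auto simp: facts_win[OF p])
  next
    case (Var X xs)
    then show ?thesis using assms(2,3) by (cases sg) (auto simp: facts_win[OF p])
  next
    case (Eq x y)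
    then show ?thesis using assms(2,3) by (cases sg) (auto simp: facts_win[OF p] push_def)
  next
    case (Jump k)
    then show ?thesis using assms(2,3) lab lab'
      by (cases sg) (fastforce simp: facts_win[OF p] facts_pos)+
  qed (use assms(2,3) child[of 0] child[of 1] in \<open>auto simp: facts_win[OF p] facts_pos split: if_splits\<close>)
qed

text \<open>This direction uses that derivability is least, and of \<open>wins\<close> only that it
  is a fixed point; the converse uses the leastness of \<open>wins\<close>.\<close>

lemma rules_sound: "derived rules w \<subseteq> facts w"
proof
  fix x assume "x \<in> derived rules w"
  then show "x \<in> facts w"
  proof induction
    case (derivedI ps t \<rho>)
    have h: "\<forall>q\<in>set ps. holds w \<rho> (facts w) q"
      using derivedI.IH derivedI.hyps by (auto simp: holds_def split: prem.splits)
    consider "(ps, t) \<in> set (lookup_rules sigma)" | p \<psi> sg where "sub_at \<phi> p = Some \<psi>"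
        "(ps, t) \<in> set (occ_rules lab sg p \<psi>)"
      using derivedI.hyps(1) occs unfolding rules_def by fastforce
    then show ?case
    proof cases
      case 1
      then show ?thesis using sound_lookup h by blast
    next
      case (2 p \<psi> sg)
      then show ?thesis using sound_end[OF 2(1)] sound_var[OF 2(1)] h
        unfolding occ_rules_def by fastforce
    qed
  qed
qed

section \<open>Completeness of the clauses\<close>

lemma ruleI:
  "(ps, t) \<in> set rules \<Longrightarrow> \<forall>q\<in>set ps. holds w \<rho> (derived rules w) q \<Longrightarrow> ev \<rho> t \<in> derived rules w"
  by (rule derivedI) (auto dest: holds_side)

lemma lookup_in_rules: "r \<in> set (lookup_rules sigma) \<Longrightarrow> r \<in> set rules"
  by (simp add: rules_def)

lemma occ_in_rules:
  "sub_at \<phi> p = Some \<psi> \<Longrightarrow> r \<in> set (occ_rules lab sg p \<psi>) \<Longrightarrow> r \<in> set rules"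
  using occs unfolding rules_def by (cases sg) force+

text \<open>For the relations of the word, initial values are derivable only for tuples of the right
  length; well-formedness of the formula guarantees that no others are looked up.\<close>

definition proper_key :: "nat \<Rightarrow> bool" where
  "proper_key k \<longleftrightarrow> k = dom_key \<or> (\<exists>x. k = fo_key x) \<or> (\<exists>X acc. k = var_key X acc) \<or>
     (\<exists>(R :: 'a word_sym) bs. k = rel_key R (list_encode bs) \<and> length bs = word_arity R)"

lemma complete_less: "b < d \<Longrightarrow> f_less b d \<in> derived rules w"
proof (induction d)
  case (Suc d)
  show ?case
  proof (cases "b = d")
    case True
    then show ?thesis
      using ruleI[OF lookup_in_rules, of "[]" "t_less x0 (TSuc x0)" w "\<lambda>_. b"] by (simp add: lookup_rules_def)
  next
    case False
    then show ?thesis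
      using Suc ruleI[OF lookup_in_rules, of "[Fact (t_less x0 x1)]" "t_less x0 (TSuc x1)" w "(\<lambda>_. b)(1 := d)"]
      by (simp add: lookup_rules_def)
  qed
qed simp

lemma complete_init:
  assumes "proper_key k"
  shows "f_lk 0 k (init w k) \<in> derived rules w"
proof -
  have letter: "r \<in> set rules" if "r \<in> set (letter_rules sigma a)" for r a
    using that letters by (intro lookup_in_rules) (auto simp: lookup_rules_def)
  have rel2: "push j (push i 0) = list_encode [j, i]" "push i 0 = list_encode [i]" for i j
    by (simp_all add: push_def)
  consider "k = dom_key" | x where "k = fo_key x" | X acc where "k = var_key X acc"
    | i j where "k = rel_key (Succ :: 'a word_sym) (push j (push i 0))" | a i where "k = rel_key (P a :: 'a word_sym) (push i 0)"
  proof -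
    have "\<exists>i j. k = rel_key (Succ :: 'a word_sym) (push j (push i 0)) \<or> (\<exists>a. k = rel_key (P a :: 'a word_sym) (push i 0))"
      if kR: "k = rel_key R (list_encode bs)" "length bs = word_arity R" for R :: "'a word_sym" and bs
    proof (cases R)
      case Succ
      then obtain j i where "bs = [j, i]" using kR(2) by (auto simp: length_Suc_conv numeral_2_eq_2)
      then show ?thesis using kR(1) Succ rel2 by metis
    next
      case (P a)
      then obtain i where "bs = [i]" using kR(2) by (auto simp: length_Suc_conv)
      then have "k = rel_key (P a) (push i 0)" using kR(1) P by (simp add: push_def)
      then show ?thesis by blast
    qed
    then show ?thesis using assms that unfolding proper_key_def by blast
  qed
  then show ?thesis
  proof cases
    case 1
    show ?thesis
    proof (cases "length w")
      case 0
      then show ?thesis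
        using 1 ruleI[OF lookup_in_rules, of "[Letter (TConst 0) None]"
          "t_lk (TConst 0) (TConst dom_key) (TConst 1)" w "\<lambda>_. 0"]
        by (simp add: lookup_rules_def init_simps letter_at_def)
    next
      \<comment> \<open>The letter at address \<open>n\<close> is the last one, so the rule yields
        the domain size \<open>n + 2\<close>.\<close>
      case (Suc n)
      then show ?thesis
        using 1 ruleI[OF letter, of "[Letter x0 (Some (w ! n)), Letter (TSuc x0) None]"
          "t_lk (TConst 0) (TConst dom_key) (TSuc (TSuc x0))" "w ! n" w "\<lambda>_. n"]
        by (simp add: letter_rules_def init_simps letter_at_def)
    qed
  next
    case (2 x)
    then have "init w k = 0" by (simp add: init_simps)
    then show ?thesis
      using 2 ruleI[OF lookup_in_rules, of "[]" "t_lk (TConst 0) (TPair (TConst 1) x0) (TConst 0)" w "\<lambda>_. x"]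
      by (simp add: lookup_rules_def fo_key_def)
  next
    case (3 X acc)
    then have "init w k = 0" by (simp add: init_simps)
    then show ?thesis
      using 3 ruleI[OF lookup_in_rules, of "[]" "t_lk (TConst 0) (TPair (TConst 2) x0) (TConst 0)" w
          "\<lambda>_. prod_encode (rvar_code X, acc)"]
      by (simp add: lookup_rules_def var_key_def)
  next
    case (4 i j)
    let ?t = "t_rel (Succ :: 'a word_sym) (t_push (TSuc x0) (t_push x0 (TConst 0)))"
    consider "j \<noteq> Suc i" | "j = Suc i" "letter_at w i = None" | a where "j = Suc i" "letter_at w i = Some a"
      by fastforce
    then show ?thesis
    proof cases
      case 1
      then show ?thesis
        using 4 ruleI[OF lookup_in_rules, of "[Neq x1 (TSuc x0)]"
            "t_lk (TConst 0) (t_rel (Succ :: 'a word_sym) (t_push x1 (t_push x0 (TConst 0)))) (TConst 0)"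
            w "(\<lambda>_. i)(1 := j)"]
        by (simp add: lookup_rules_def init_push)
    next
      case 2
      then show ?thesis
        using 4 ruleI[OF lookup_in_rules, of "[Letter x0 None]" "t_lk (TConst 0) ?t (TConst 0)" w "\<lambda>_. i"]
        by (simp add: lookup_rules_def init_push letter_at_def split: if_splits)
    next
      case (3 a)
      then show ?thesis
        using 4 ruleI[OF letter, of "[Letter x0 (Some a)]" "t_lk (TConst 0) ?t (TConst 1)" a w "\<lambda>_. i"]
        by (simp add: letter_rules_def init_push letter_at_def split: if_splits)
    qed
  next
    case (5 a i)
    let ?t = "t_rel (P a) (t_push (TSuc x0) (TConst 0))"
    consider "i = 0" | m where "i = Suc m" "letter_at w m = None" | m where "i = Suc m" "letter_at w m = Some a"
      | m b where "i = Suc m" "letter_at w m = Some b" "b \<noteq> a"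
      by (metis not0_implies_Suc option.exhaust)
    then show ?thesis
    proof cases
      case 1
      then show ?thesis
        using 5 ruleI[OF letter, of "[]" "t_lk (TConst 0) (t_rel (P a) (t_push (TConst 0) (TConst 0))) (TConst 0)"
            a w "\<lambda>_. 0"]
        by (simp add: letter_rules_def init_push)
    next
      case (2 m)
      then show ?thesis
        using 5 ruleI[OF letter, of "[Letter x0 None]" "t_lk (TConst 0) ?t (TConst 0)" a w "\<lambda>_. m"]
        by (simp add: letter_rules_def init_push letter_at_def split: if_splits)
    next
      case (3 m)
      then show ?thesis
        using 5 ruleI[OF letter, of "[Letter x0 (Some a)]" "t_lk (TConst 0) ?t (TConst 1)" a w "\<lambda>_. m"]
        by (auto simp add: letter_rules_def init_push letter_at_def split: if_splits)
    next
      case (4 m b)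
      then show ?thesis
        using 5 letters ruleI[OF letter, of "[Letter x0 (Some b)]" "t_lk (TConst 0) ?t (TConst 0)" a w "\<lambda>_. m"]
        by (auto simp add: letter_rules_def init_push letter_at_def split: if_splits)
    qed
  qed
qed

lemma complete_lookup:
  assumes "proper_key k"
  shows "f_lk l k (lk w l k) \<in> derived rules w"
proof (induction l rule: code_induct)
  case empty
  then show ?case using complete_init[OF assms] by simp
next
  case (bind k' v l)
  show ?case
  proof (cases "k = k'")
    case True
    then show ?thesis
      using ruleI[OF lookup_in_rules, of "[]" "t_lk (t_bind x0 x1 x2) x0 x1" w "(\<lambda>_. k)(1 := v, 2 := l)"]
      by (simp add: lookup_rules_def)
  next
    case False
    then show ?thesis
      using bind ruleI[OF lookup_in_rules, of "[Neq x0 x3, Fact (t_lk x2 x0 x1)]" "t_lk (t_bind x3 x4 x2) x0 x1" w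
          "(\<lambda>_. k)(1 := lk w l k, 2 := l, 3 := k', 4 := v)"]
      by (simp add: lookup_rules_def)
  qed
qed

lemma proper_keys:
  "proper_key dom_key" "proper_key (fo_key x)" "proper_key (var_key X acc)"
  "length bs = word_arity (R :: 'a word_sym) \<Longrightarrow> proper_key (rel_key R (list_encode bs))"
  by (auto simp: proper_key_def)

lemma valuation_arity:
  assumes "sub_at \<phi> p = Some (Rel R xs)"
  shows "length xs = word_arity R"
  using sub_at_Lstar[OF Lstar assms] by simp

lemma complete_end:
  assumes p: "sub_at \<phi> p = Some \<psi>"
    and X: "\<And>sg q l. sub_at \<phi> q \<noteq> None \<Longrightarrow> X sg q l \<Longrightarrow> f_win (ctl sg q 0) 0 l \<in> derived rules w"
    and bs: "length bs = length (valuation_vars \<psi>)"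
    and sem: "sem_end X w \<phi> sg p \<psi> (list_encode bs) l"
  shows "f_win (ctl sg p (length (valuation_vars \<psi>))) (list_encode bs) l \<in> derived rules w"
proof -
  let ?acc = "list_encode bs"
  let ?D = "derived rules w"
  have rule: "ev \<rho> t \<in> ?D" if "(ps, t) \<in> set (end_rules lab sg p \<psi>)" "\<forall>q\<in>set ps. holds w \<rho> ?D q" for ps t \<rho>
    by (rule ruleI[OF occ_in_rules[OF p, where sg = sg] that(2)]) (use that(1) in \<open>simp add: occ_rules_def\<close>)
  have child: "sub_at \<phi> (p @ [i]) \<noteq> None" if "i < length (children \<psi>)" for i
    using sub_at_append[OF p, of "[i]"] that by simp
  \<comment> \<open>As in the rules, variable 0 is the log and variable 1 the tuple. Variable 2 is
    auxiliary: the predecessor of a nonzero lookup, or the domain size at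
    \<open>Insert\<close>.\<close>
  define \<rho> where "\<rho> v = (\<lambda>_ :: nat. v)(0 := l, 1 := ?acc)" for v :: nat
  have \<rho>: "\<rho> v 0 = l" "\<rho> v (Suc 0) = ?acc" "\<rho> v 2 = v" for v by (simp_all add: \<rho>_def)
  have down: "f_win (ctl sg' (p @ [i]) 0) 0 l' \<in> ?D" if "X sg' (p @ [i]) l'" "i < length (children \<psi>)" for sg' i l'
    using X[OF child[OF that(2)] that(1)] .
  show ?thesis
  proof (cases \<psi>)
    case (Rel R xs)
    have key: "f_lk l (rel_key R ?acc) (lk w l (rel_key R ?acc)) \<in> ?D"
      using complete_lookup proper_keys(4)[of bs R] bs valuation_arity p Rel by simp
    show ?thesis
    proof (cases sg)
      case Plus
      then obtain v where "lk w l (rel_key R ?acc) = Suc v" using sem Rel by (auto simp: gr0_conv_Suc)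
      then show ?thesis using rule[of _ _ "\<rho> v"] key Rel Plus by (simp add: \<rho>)
    next
      case Minus
      then show ?thesis using rule[of _ _ "\<rho> 0"] key Rel sem by (simp add: \<rho>)
    qed
  next
    case (Var Y xs)
    have key: "f_lk l (var_key Y ?acc) (lk w l (var_key Y ?acc)) \<in> ?D"
      using complete_lookup proper_keys(3) by simp
    show ?thesis
    proof (cases sg)
      case Plus
      then obtain v where "lk w l (var_key Y ?acc) = Suc v" using sem Var by (auto simp: gr0_conv_Suc)
      then show ?thesis using rule[of _ _ "\<rho> v"] key Var Plus by (simp add: \<rho>)
    next
      case Minus
      then show ?thesis using rule[of _ _ "\<rho> 0"] key Var sem by (simp add: \<rho>)
    qed
  next
    case (Eq x y)
    then obtain b c where bc: "bs = [b, c]" using bs by (auto simp: length_Suc_conv)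
    then have acc: "?acc = push b (push c 0)" by (simp add: push_def)
    have push: "push b (push c 0) = push b' (push c' 0) \<longleftrightarrow> b = b' \<and> c = c'" for b' c'
      by (simp add: push_def)
    show ?thesis
    proof (cases sg)
      case Plus
      then have "b = c" using sem Eq unfolding acc by (auto simp: push)
      then show ?thesis using rule[of _ _ "(\<lambda>_. l)(1 := b)"] Eq Plus acc by (simp add: numeral_2_eq_2)
    next
      case Minus
      then have "b \<noteq> c" using sem Eq unfolding acc by (auto simp: push)
      then show ?thesis using rule[of _ _ "(\<lambda>_. l)(1 := b, 2 := c)"] Eq Minus acc by (simp add: numeral_2_eq_2)
    qed
  next
    case (Jump k)
    have down: "f_win (ctl sg q 0) 0 l \<in> ?D" if "X sg q l" "q \<in> labels \<phi> k" for q
      using X[OF _ that(1)] that(2) by (auto simp: labels_def)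
    show ?thesis
    proof (cases sg)
      case Plus
      then obtain q where q: "q \<in> labels \<phi> k" "X sg q l" using sem Jump by auto
      then show ?thesis using rule[of "[Fact (t_pos sg q x0)]" "t_win sg p 0 x1 x0" "\<rho> 0"] down[OF q(2,1)] Jump Plus lab
        by (auto simp: \<rho>)
    next
      case Minus
      then show ?thesis using rule[of _ _ "\<rho> 0"] down Jump lab sem by (simp add: \<rho>)
    qed
  next
    case (Conj \<psi>1 \<psi>2)
    show ?thesis
    proof (cases sg)
      case Plus
      then show ?thesis using rule[of _ _ "\<rho> 0"] down Conj sem by (simp add: \<rho>)
    next
      case Minus
      then consider "X sg (p @ [0]) l" | "X sg (p @ [1]) l" using sem Conj by auto
      then show ?thesis
      proof cases
        case 1
        then show ?thesis using rule[of "[Fact (t_pos sg (p @ [0]) x0)]" "t_win sg p 0 x1 x0" "\<rho> 0"] down[OF 1] Conj Minus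
          by (simp add: \<rho>)
      next
        case 2
        then show ?thesis using rule[of "[Fact (t_pos sg (p @ [1]) x0)]" "t_win sg p 0 x1 x0" "\<rho> 0"] down[OF 2] Conj Minus
          by (simp add: \<rho>)
      qed
    qed
  next
    case (Insert x \<psi>1)
    then show ?thesis using rule[of _ _ "\<rho> (lk w l dom_key)"] complete_lookup[OF proper_keys(1)] down sem
      by (simp add: \<rho>)
  qed (use rule[of _ _ "\<rho> 0"] down sem in \<open>simp_all add: \<rho>\<close>)
qed

text \<open>The induction runs downwards from the index at which all variables are treated, as the
  rules for one index refer to the next. Tying the length of \<open>bs\<close> to the index ensures
  that the completed tuple has the right arity.\<close>

lemma complete_sem:
  assumes p: "sub_at \<phi> p = Some \<psi>"
    and X: "\<And>sg q l. sub_at \<phi> q \<noteq> None \<Longrightarrow> X sg q l \<Longrightarrow> f_win (ctl sg q 0) 0 l \<in> derived rules w"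
  shows "i \<le> length (valuation_vars \<psi>) \<Longrightarrow> length bs = i \<Longrightarrow>
    sem X w \<phi> sg p \<psi> (drop i (valuation_vars \<psi>)) (list_encode bs) l \<Longrightarrow>
    f_win (ctl sg p i) (list_encode bs) l \<in> derived rules w"
proof (induction i arbitrary: bs l rule: inc_induct)
  case base
  then show ?case using complete_end[OF p X, where bs = bs] by simp
next
  case (step i)
  let ?D = "derived rules w"
  let ?x = "valuation_vars \<psi> ! i"
  let ?acc = "list_encode bs"
  have rule: "ev \<rho> t \<in> ?D" if "(ps, t) \<in> set (var_rules sg p \<psi> i)" "\<forall>q\<in>set ps. holds w \<rho> ?D q" for ps t \<rho>
    by (rule ruleI[OF occ_in_rules[OF p, where sg = sg] that(2)])
      (use that(1) step.hyps in \<open>auto simp: occ_rules_def\<close>)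
  have IH: "f_win (ctl sg p (Suc i)) (push b ?acc) l' \<in> ?D"
    if "sem X w \<phi> sg p \<psi> (drop (Suc i) (valuation_vars \<psi>)) (push b ?acc) l'" for b l'
    using step.IH[of "b # bs" l'] that step.prems(1) unfolding push_list_encode by simp
  define \<rho> where "\<rho> b d = (\<lambda>_ :: nat. d)(0 := l, 1 := ?acc, 2 := b)" for b d :: nat
  have \<rho>: "\<rho> b d 0 = l" "\<rho> b d (Suc 0) = ?acc" "\<rho> b d 2 = b" "\<rho> b d 3 = d" for b d by (simp_all add: \<rho>_def)
  have sem: "sem X w \<phi> sg p \<psi> (?x # drop (Suc i) (valuation_vars \<psi>)) ?acc l"
    using step.prems(2) Cons_nth_drop_Suc[OF step.hyps(2)] by simp
  show ?case
  proof (cases "is_atom \<psi>")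
    case True
    have key: "f_lk l (fo_key ?x) (lk w l (fo_key ?x)) \<in> ?D" using complete_lookup proper_keys(2) by simp
    show ?thesis
    proof (cases "lk w l (fo_key ?x)")
      case 0
      then show ?thesis using sem True key rule[of "[Fact (t_lk x0 (TConst (fo_key ?x)) (TConst 0))]" "t_win sg p i x1 x0" "\<rho> 0 0"]
        by (simp add: var_rules_def Let_def \<rho>)
    next
      case (Suc b)
      then have "f_win (ctl sg p (Suc i)) (push b ?acc) l \<in> ?D" using sem True IH by simp
      then show ?thesis using Suc key True
          rule[of "[Fact (t_lk x0 (TConst (fo_key ?x)) (TSuc x2)), Fact (t_win sg p (Suc i) (t_push x2 x1) x0)]"
            "t_win sg p i x1 x0" "\<rho> b 0"]
        by (simp add: var_rules_def Let_def \<rho>)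
    qed
  next
    case False
    have dom: "f_lk l dom_key (lk w l dom_key) \<in> ?D" using complete_lookup proper_keys(1) by simp
    show ?thesis
    proof (cases sg)
      case Plus
      then obtain b where b: "b < lk w l dom_key"
        "f_win (ctl sg p (Suc i)) (push b ?acc) (bind (fo_key ?x) (Suc b) l) \<in> ?D"
        using sem False IH by auto
      then show ?thesis using False Plus dom complete_less[OF b(1)] rule[of _ _ "\<rho> b (lk w l dom_key)"]
        by (simp add: var_rules_def Let_def \<rho>)
    next
      case Minus
      \<comment> \<open>A universal choice is rebuilt value by value along the domain.\<close>
      have all: "b \<le> lk w l dom_key \<Longrightarrow> f_all (ctl sg p i) b ?acc l \<in> ?D" for b
      proof (induction b)
        case 0
        then show ?case using False Minus rule[of "[]" "t_all sg p i (TConst 0) x1 x0" "\<rho> 0 0"]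
          by (simp add: var_rules_def Let_def \<rho>)
      next
        case (Suc b)
        have "f_win (ctl sg p (Suc i)) (push b ?acc) (bind (fo_key ?x) (Suc b) l) \<in> ?D"
          using sem False Minus IH Suc.prems by simp
        then show ?case using Suc False Minus
            rule[of "[Fact (t_all sg p i x2 x1 x0), Fact (t_win sg p (Suc i) (t_push x2 x1)
              (t_bind (TConst (fo_key ?x)) (TSuc x2) x0))]" "t_all sg p i (TSuc x2) x1 x0" "\<rho> b 0"]
          by (simp add: var_rules_def Let_def \<rho>)
      qed
      show ?thesis using False Minus dom all[OF order_refl]
          rule[of "[Fact (t_lk x0 (TConst dom_key) x3), Fact (t_all sg p i x3 x1 x0)]" "t_win sg p i x1 x0"
            "\<rho> 0 (lk w l dom_key)"]
        by (simp add: var_rules_def Let_def \<rho>)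
    qed
  qed
qed

lemma eloise_derived:
  "eloise \<phi> x \<Longrightarrow> x = pos w sg p l \<Longrightarrow> sub_at \<phi> p \<noteq> None \<Longrightarrow> f_win (ctl sg p 0) 0 l \<in> derived rules w"
proof (induction arbitrary: sg p l rule: wins.induct)
  case (winsI x)
  \<comment> \<open>Different logs may denote the same position, so the hypothesis has to cover
    every code of it.\<close>
  define X where "X q \<longleftrightarrow> (\<forall>sg p l. q = pos w sg p l \<longrightarrow> sub_at \<phi> p \<noteq> None \<longrightarrow>
    f_win (ctl sg p 0) 0 l \<in> derived rules w)" for q
  obtain \<psi> where \<psi>: "sub_at \<phi> p = Some \<psi>" using winsI.prems by blast
  have "eforce \<phi> X x"
    by (rule force_mono[rule_format, OF _ winsI.IH]) (auto simp: X_def)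
  then have "sem (\<lambda>sg q l. X (pos w sg q l)) w \<phi> sg p \<psi> (valuation_vars \<psi>) 0 l"
    using sem_step[OF \<psi>] winsI.prems(1) by blast
  then show ?case
    using complete_sem[OF \<psi>, of "\<lambda>sg q l. X (pos w sg q l)" w 0 "[]" sg l] by (simp add: X_def)
qed

lemma derived_iff_satisfies:
  "f_win (ctl sg [] 0) 0 0 \<in> derived rules w \<longleftrightarrow> satisfies (word_model w) sg \<phi>"
proof -
  have start: "pos w sg [] 0 = (word_model w, empty_asg, sg, [])"
    by (simp add: pos_def model_of_0 asg_of_0)
  have "f_win (ctl sg [] 0) 0 0 \<in> derived rules w \<longleftrightarrow> eloise \<phi> (pos w sg [] 0)"
  proof
    assume "f_win (ctl sg [] 0) 0 0 \<in> derived rules w"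
    from subsetD[OF rules_sound this] show "eloise \<phi> (pos w sg [] 0)"
      by (simp only: facts_pos[of "[]" \<phi>] sub_at.simps)
  next
    assume "eloise \<phi> (pos w sg [] 0)"
    from eloise_derived[OF this refl] show "f_win (ctl sg [] 0) 0 0 \<in> derived rules w" by simp
  qed
  then show ?thesis by (simp only: satisfies_def strategy_iff_wins start)
qed

end

theorem theorem2:
  fixes \<phi> :: "'a::finite word_sym fm"
  assumes "\<phi> \<in> L word_arity" and "sentence \<phi>"
  shows "\<exists>M :: 'a tm. turing_machine M \<and>
           (\<forall>w :: 'a list. tm_accepts M w \<longleftrightarrow> word_model w \<Turnstile>\<^sup>+ \<phi>) \<and>
           (\<forall>w :: 'a list. tm_rejects M w \<longleftrightarrow> word_model w \<Turnstile>\<^sup>- \<phi>)"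
proof -
  obtain sigma :: "'a list" where sigma: "set sigma = UNIV"
    using finite_list[OF finite_UNIV] by auto
  obtain occs where occs: "set occs = {p. sub_at \<phi> p \<noteq> None}" 
    using finite_list[OF finite_occs[of \<phi>]] by auto
  have "finite (labels \<phi> k)" for k
    by (rule finite_subset[OF _ finite_occs[of \<phi>]]) (auto simp: labels_def)
  then have "\<forall>k. \<exists>qs. set qs = labels \<phi> k" using finite_list by auto
  then obtain lab where lab: "\<And>k. set (lab k) = labels \<phi> k" by metis
  interpret game_rules \<phi> sigma occs lab
    by unfold_locales (use sigma occs lab assms(1) in \<open>auto simp: L_def\<close>)
  \<comment> \<open>The two initial positions differ only in the sign, so \<open>eloise_flip\<close>
    supplies the exclusiveness that the joint search requires.\<close>
  have "\<not> (satisfies (word_model w) Plus \<phi> \<and> satisfies (word_model w) Minus \<phi>)" for w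
    using eloise_flip[of \<phi> "(word_model w, empty_asg, Plus, [])"]
    by (simp only: satisfies_def strategy_iff_wins flip.simps opp.simps) blast
  then show ?thesis
    using semidecision_machine[of "f_win (ctl Plus [] 0) 0 0" rules "f_win (ctl Minus [] 0) 0 0"]
    unfolding derived_iff_satisfies by blast
qed

end
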